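(* Let $K$ be an algebraically closed field with a nontrivial non-Archimedean valuation, and let $d\ge 0$, $n\ge d+1$ be integers. Let $X\subset\mathbb{P}^{n-1}$ be a $d$-dimensional constant coefficient (projective) linear subspace, equal to the rowspace of a matrix $W\in K^{(d+1)\times n}$, and let $L(X)\subset\mathrm{Gr}(d,n)\subset\mathbb{P}^{\binom{n}{d}-1}$ be the locus of $(d-1)$-dimensional projective linear subspaces contained in $X$. Then $\mathrm{trop}(L(X))$ is the Bergman fan of each of the following (equal) matroids on the ground set $\binom{[n]}{d}$: (i) the matroid of linear dependencies among the columns of the matrix $V$; (ii) the dual matroid to the matroid of linear dependencies among the columns of the matrix $U$; (iii) the matroid of lines of the hyperplane arrangement $\mathcal{A}(X)$ induced by $X$. Here $V$, $U$, $\mathcal A(X)$, the matroid of lines, tropicalization and Bergman fans are as defined in the context.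
   Context: $[n]=\{1,\dots,n\}$ and $\binom{[n]}{m}$ is the set of $m$-element subsets of $[n]$. $\mathrm{Gr}(d,n)$ is the Grassmannian of $d$-dimensional linear subspaces of $K^n$ (equivalently $(d-1)$-dimensional subspaces of $\mathbb{P}^{n-1}$) in its Plücker embedding. $L(X)$ is a $d$-dimensional projective linear subspace of $\mathbb{P}^{\binom{n}{d}-1}$. Constant coefficient: a linear subspace is of constant coefficients if it is defined over a subfield of $K$ on which the valuation is trivial. Tropicalization: for a variety $Y\subset\mathbb{P}^k$, $\mathrm{trop}(Y)=\overline{-\mathrm{val}(Y\cap(K^* )^k)}\subset\mathbb{R}^k\cong\mathbb{R}^{k+1}/\mathbb{R}(1,\dots,1)$, the Euclidean closure of the image under coordinatewise negative valuation of the points of $Y$ in the torus $(K^* )^k\cong(K^* )^{k+1}/K^*$. Bergman fan: for $u\in\mathbb{R}^E$ let $\mathcal F(u)$ be the unique flag $\emptyset=F_0\subsetneq F_1\subsetneq\dots\subsetneq F_m=E$ such that $u_i<u_j$ iff there is $k$ with $i\in F_k$, $j\notin F_k$. The Bergman fan of a matroid $M$ on $E$ is the set of all $u$ such that every member of $\mathcal F(u)$ (including $F_0=\emptyset$) is a flat of $M$, viewed modulo $\mathbb{R}(1,\dots,1)$. The matrix $V$: $V_{i,J}=(-1)^{i+1}\det(W_{-i}^J)$ for $i\in[d+1]$, $J\in\binom{[n]}{d}$, where $W_{-i}^J$ is the submatrix of $W$ with rows $[d+1]\setminus\{i\}$ and columns $J$. The matrix $U$: rows indexed by pairs $(A,B)$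 with $A\in\binom{[n]}{d-1}$, $B\in\binom{[n]}{d+2}$, columns indexed by $J\in\binom{[n]}{d}$; $U_{(A,B),J}=(-1)^{|[i]\cap A|+|[i]\cap B|}q_{B\setminus\{i\}}$ if $J=A\cup\{i\}$ for some $i\in B\setminus A$, and $0$ otherwise, where $q_I=\det(W^I)$, $I\in\binom{[n]}{d+1}$, with $W^I$ the submatrix of $W$ with columns $I$. The arrangement $\mathcal A(X)$: the arrangement of $n$ hyperplanes in the $(d+1)$-dimensional linear space $X\cong K^{d+1}$ obtained by restricting the coordinate hyperplanes $\{x_k=0\}$ of $K^n$; it is linearly isomorphic to $\{H_k\}_{k=1}^n$ in $K^{d+1}$ with $H_k=\{x: w_k\cdot x=0\}$, $w_k$ the $k$-th column of $W$. Matroid of lines: for an arrangement $\{H_k\}_{k=1}^n$ in $K^{d+1}$ and $J\in\binom{[n]}{d}$, let $\ell_J=\bigcap_{k\in J}H_k$ if this intersection has dimension $1$, and $\ell_J=0$ otherwise. The matroid of lines is the matroid on $\binom{[n]}{d}$ in which a collection of $J$'s is independent iff the smallest linear subspace containing the corresponding $\ell_J$'s has dimension equal to the number of elements of the collection. *)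

theory Defs
  imports
    "Jordan_Normal_Form.DL_Rank"
    "Jordan_Normal_Form.DL_Submatrix"
    "HOL-Algebra.Subrings"
    "HOL-Library.Extended_Real"
    "HOL-Library.Ramsey"
    "HOL-Analysis.Function_Topology"
begin

text \<open>The index set \<open>[n]\<close> is \<open>{..<n}\<close> throughout, in accordance with the 0-based
  indices of matrices; \<open>nsets {..<n} m\<close> is the set of its \<open>m\<close>-element subsets.\<close>

section \<open>Matroids, given by a ground set and the family of independent sets\<close>

definition matroid :: "'e set \<Rightarrow> 'e set set \<Rightarrow> bool" where
  "matroid E I \<longleftrightarrow> finite E \<and> I \<subseteq> Pow E \<and> {} \<in> I \<and>
     (\<forall>S\<in>I. \<forall>T. T \<subseteq> S \<longrightarrow> T \<in> I) \<and>
     (\<forall>S\<in>I. \<forall>T\<in>I. card S < card T \<longrightarrow> (\<exists>x\<in>T - S. insert x S \<in> I))"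

definition matroid_rank :: "'e set set \<Rightarrow> 'e set \<Rightarrow> nat" where
  "matroid_rank I A = Max {card S | S. S \<in> I \<and> S \<subseteq> A}"

definition flat :: "'e set \<Rightarrow> 'e set set \<Rightarrow> 'e set \<Rightarrow> bool" where
  "flat E I F \<longleftrightarrow> F \<subseteq> E \<and> (\<forall>x\<in>E - F. matroid_rank I F < matroid_rank I (insert x F))"

definition basis_of :: "'e set set \<Rightarrow> 'e set \<Rightarrow> bool" where
  "basis_of I B \<longleftrightarrow> B \<in> I \<and> (\<forall>S\<in>I. B \<subseteq> S \<longrightarrow> S = B)"

definition dual_matroid :: "'e set \<Rightarrow> 'e set set \<Rightarrow> 'e set set" where
  "dual_matroid E I = {S. S \<subseteq> E \<and> (\<exists>B. basis_of I B \<and> S \<subseteq> E - B)}"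

text \<open>Linear dependencies among the columns of a matrix \<open>M\<close> with rows indexed by \<open>R\<close> and columns
  indexed by \<open>E\<close>. The columns are treated as a family, so two equal columns are dependent.\<close>

definition column_matroid :: "'r set \<Rightarrow> 'e set \<Rightarrow> ('r \<Rightarrow> 'e \<Rightarrow> 'a::field) \<Rightarrow> 'e set set" where
  "column_matroid R E M =
     {S. S \<subseteq> E \<and> (\<forall>c. (\<forall>r\<in>R. (\<Sum>J\<in>S. c J * M r J) = 0) \<longrightarrow> (\<forall>J\<in>S. c J = 0))}"

section \<open>The quotient of \<open>\<real>\<^sup>E\<close> by the all-ones vector, and Bergman fans\<close>

definition quotient_topology :: "'a topology \<Rightarrow> ('a \<Rightarrow> 'b) \<Rightarrow> 'b topology" where
  "quotient_topology T q =
     topology (\<lambda>U. U \<subseteq> q ` topspace T \<and> openin T {x \<in> topspace T. q x \<in> U})"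

lemma openin_quotient_topology:
  "openin (quotient_topology T q) U \<longleftrightarrow>
     U \<subseteq> q ` topspace T \<and> openin T {x \<in> topspace T. q x \<in> U}"
proof -
  have "istopology (\<lambda>U. U \<subseteq> q ` topspace T \<and> openin T {x \<in> topspace T. q x \<in> U})"
    unfolding istopology_def
  proof (intro conjI allI impI)
    fix S U
    assume "S \<subseteq> q ` topspace T \<and> openin T {x \<in> topspace T. q x \<in> S}"
      and "U \<subseteq> q ` topspace T \<and> openin T {x \<in> topspace T. q x \<in> U}"
    moreover have "{x \<in> topspace T. q x \<in> S \<inter> U} =
        {x \<in> topspace T. q x \<in> S} \<inter> {x \<in> topspace T. q x \<in> U}" by auto
    ultimately show "S \<inter> U \<subseteq> q ` topspace T" "openin T {x \<in> topspace T. q x \<in> S \<inter> U}"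
      by auto
  next
    fix K
    assume K: "\<forall>U\<in>K. U \<subseteq> q ` topspace T \<and> openin T {x \<in> topspace T. q x \<in> U}"
    have "{x \<in> topspace T. q x \<in> \<Union>K} = (\<Union>U\<in>K. {x \<in> topspace T. q x \<in> U})" by auto
    with K show "openin T {x \<in> topspace T. q x \<in> \<Union>K}" by auto
    from K show "\<Union>K \<subseteq> q ` topspace T" by blast
  qed
  then show ?thesis
    by (simp add: quotient_topology_def)
qed

lemma topspace_quotient_topology: "topspace (quotient_topology T q) = q ` topspace T"
proof
  show "topspace (quotient_topology T q) \<subseteq> q ` topspace T"
    by (metis openin_quotient_topology openin_topspace)
  have "{x \<in> topspace T. q x \<in> q ` topspace T} = topspace T" by auto
  then show "q ` topspace T \<subseteq> topspace (quotient_topology T q)"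
    by (simp add: openin_subset openin_quotient_topology)
qed

lemma quotient_map_quotient_topology: "quotient_map T (quotient_topology T q) q"
  unfolding quotient_map_def
  by (simp add: topspace_quotient_topology openin_quotient_topology)

text \<open>The class of \<open>u\<close> in \<open>\<real>\<^sup>E / \<real>(1,\<dots>,1)\<close>; elements of \<open>\<real>\<^sup>E\<close> are functions extensional on \<open>E\<close>.\<close>

definition trop_class :: "'e set \<Rightarrow> ('e \<Rightarrow> real) \<Rightarrow> ('e \<Rightarrow> real) set" where
  "trop_class E u = {(\<lambda>J\<in>E. u J + t) | t. True}"

definition trop_torus_topology :: "'e set \<Rightarrow> ('e \<Rightarrow> real) set topology" where
  "trop_torus_topology E = quotient_topology (powertop_real E) (trop_class E)"

definition flag_of :: "'e set \<Rightarrow> ('e \<Rightarrow> real) \<Rightarrow> 'e set list \<Rightarrow> bool" where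
  "flag_of E u Fs \<longleftrightarrow> Fs \<noteq> [] \<and> hd Fs = {} \<and> last Fs = E \<and> sorted_wrt (\<subset>) Fs \<and>
     (\<forall>i\<in>E. \<forall>j\<in>E. u i < u j \<longleftrightarrow> (\<exists>F\<in>set Fs. i \<in> F \<and> j \<notin> F))"

definition bergman_fan :: "'e set \<Rightarrow> 'e set set \<Rightarrow> ('e \<Rightarrow> real) set set" where
  "bergman_fan E I =
     trop_class E ` {u \<in> E \<rightarrow>\<^sub>E UNIV. \<exists>Fs. flag_of E u Fs \<and> (\<forall>F\<in>set Fs. flat E I F)}"

section \<open>Valuations and tropicalization\<close>

definition nonarch_valuation :: "('a::field \<Rightarrow> ereal) \<Rightarrow> bool" where
  "nonarch_valuation v \<longleftrightarrow>
     (\<forall>x. v x \<noteq> -\<infinity>) \<and> (\<forall>x. v x = \<infinity> \<longleftrightarrow> x = 0) \<and>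
     (\<forall>x y. v (x * y) = v x + v y) \<and> (\<forall>x y. min (v x) (v y) \<le> v (x + y))"

definition trivial_on :: "('a::field \<Rightarrow> ereal) \<Rightarrow> 'a set \<Rightarrow> bool" where
  "trivial_on v k \<longleftrightarrow> (\<forall>x\<in>k. x \<noteq> 0 \<longrightarrow> v x = 0)"

text \<open>A point of the projective space with coordinates indexed by \<open>E\<close> is represented by the set of
  all its homogeneous coordinate vectors; \<open>Y\<close> is a set of such points.\<close>

definition tropicalization ::
    "('a::field \<Rightarrow> ereal) \<Rightarrow> 'e set \<Rightarrow> ('e \<Rightarrow> 'a) set set \<Rightarrow> ('e \<Rightarrow> real) set set" where
  "tropicalization v E Y =
     trop_torus_topology E closure_of
       {trop_class E (\<lambda>J. - real_of_ereal (v (p J))) | p P. P \<in> Y \<and> p \<in> P \<and> (\<forall>J\<in>E. p J \<noteq> 0)}"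

section \<open>Linear subspaces of \<open>K\<^sup>n\<close> and their Pluecker coordinates\<close>

abbreviation vec_span :: "nat \<Rightarrow> 'a::field vec set \<Rightarrow> 'a vec set" where
  "vec_span n \<equiv> LinearCombinations.module.span class_ring (module_vec TYPE('a) n)"

abbreviation subspace_dim :: "nat \<Rightarrow> 'a::field vec set \<Rightarrow> nat" where
  "subspace_dim n Y \<equiv> vectorspace.dim class_ring ((module_vec TYPE('a) n)\<lparr>carrier := Y\<rparr>)"

definition constant_coefficient :: "('a::field \<Rightarrow> ereal) \<Rightarrow> nat \<Rightarrow> 'a vec set \<Rightarrow> bool" where
  "constant_coefficient v n X \<longleftrightarrow>
     (\<exists>k. subfield k (class_ring :: 'a ring) \<and> trivial_on v k \<and>
       (\<exists>S. S \<subseteq> {x \<in> carrier_vec n. \<forall>i<n. x $ i \<in> k} \<and> X = vec_span n S))"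

definition grassmannian :: "nat \<Rightarrow> nat \<Rightarrow> 'a::field vec set set" where
  "grassmannian d n =
     {Y. VectorSpace.subspace class_ring Y (module_vec TYPE('a) n) \<and> subspace_dim n Y = d}"

definition plucker_point :: "nat \<Rightarrow> nat \<Rightarrow> 'a::field vec set \<Rightarrow> (nat set \<Rightarrow> 'a) set" where
  "plucker_point d n Y =
     {(\<lambda>J\<in>nsets {..<n} d. c * det (submatrix A UNIV J)) | A c.
        A \<in> carrier_mat d n \<and> vec_space.row_space n A = Y \<and> c \<noteq> 0}"

definition subspaces_locus :: "nat \<Rightarrow> nat \<Rightarrow> 'a::field vec set \<Rightarrow> (nat set \<Rightarrow> 'a) set set" where
  "subspaces_locus d n X = plucker_point d n ` {Y \<in> grassmannian d n. Y \<subseteq> X}"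

section \<open>The matrices \<open>V\<close> and \<open>U\<close>\<close>

text \<open>The sign \<open>(-1)\<^sup>i\<^sup>+\<^sup>1\<close> for 1-based \<open>i\<close> is \<open>(-1)\<^sup>i\<close> for 0-based \<open>i\<close>, and the initial segment
  \<open>{1,\<dots>,i}\<close> becomes \<open>{..i}\<close>.\<close>

definition V_matrix :: "'a::field mat \<Rightarrow> nat \<Rightarrow> nat set \<Rightarrow> 'a" where
  "V_matrix W i J = (-1) ^ i * det (submatrix W (UNIV - {i}) J)"

definition U_rows :: "nat \<Rightarrow> nat \<Rightarrow> (nat set \<times> nat set) set" where
  "U_rows d n = {A. A \<subseteq> {..<n} \<and> card A + 1 = d} \<times> nsets {..<n} (d + 2)"

definition U_matrix :: "'a::field mat \<Rightarrow> nat set \<times> nat set \<Rightarrow> nat set \<Rightarrow> 'a" where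
  "U_matrix W = (\<lambda>(A, B) J.
     if \<exists>i\<in>B - A. J = insert i A
     then let i = (THE i. i \<in> B - A \<and> J = insert i A)
          in (-1) ^ (card ({..i} \<inter> A) + card ({..i} \<inter> B)) * det (submatrix W UNIV (B - {i}))
     else 0)"

section \<open>The arrangement of a subspace and its matroid of lines\<close>

definition coordinate_arrangement :: "'a::field vec set \<Rightarrow> nat \<Rightarrow> 'a vec set" where
  "coordinate_arrangement X k = {x \<in> X. x $ k = 0}"

text \<open>\<open>H\<close> is an arrangement inside a linear subspace \<open>X\<close> of \<open>K\<^sup>m\<close>, so that the intersection of the
  empty subfamily is \<open>X\<close>.\<close>

definition arrangement_line ::
    "nat \<Rightarrow> 'a::field vec set \<Rightarrow> (nat \<Rightarrow> 'a vec set) \<Rightarrow> nat set \<Rightarrow> 'a vec set" where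
  "arrangement_line m X H J =
     (let S = X \<inter> (\<Inter>k\<in>J. H k) in if subspace_dim m S = 1 then S else {0\<^sub>v m})"

definition matroid_of_lines ::
    "nat \<Rightarrow> 'a::field vec set \<Rightarrow> (nat \<Rightarrow> 'a vec set) \<Rightarrow> nat set set \<Rightarrow> nat set set set" where
  "matroid_of_lines m X H E =
     {S. S \<subseteq> E \<and> subspace_dim m (vec_span m (\<Union>J\<in>S. arrangement_line m X H J)) = card S}"

end

theory Submission
  imports Defs
begin

text \<open>Pluecker vectors of \<open>d\<close>-dimensional subspaces of \<open>X\<close> are exactly the nonzero elements of the row
  space of \<open>V\<close>: for \<open>a \<noteq> 0\<close>, an invertible change of basis moving \<open>a\<close> to a multiple of a unit vector
  turns \<open>\<Sum>\<^sub>r a\<^sub>r V\<^sub>r\<^sub>J\<close> into a maximal minor of a matrix with \<open>d\<close> rows. By Cramer's rule these vectors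
  satisfy the relations \<open>U\<close>, and conversely the kernel of \<open>U\<close> is the row space of \<open>V\<close>: after
  subtracting a row combination one may assume that \<open>p\<^sub>J = 0\<close> for all \<open>J \<subset> I\<close>, where \<open>I\<close> indexes a nonzero
  maximal minor of \<open>W\<close>, and then the relation for \<open>A = J - {j}\<close>, \<open>B = I \<union> {j}\<close> kills \<open>p\<^sub>J\<close> by induction
  on \<open>|J - I|\<close>. This gives the duality, and the columns of \<open>V\<close> span the lines of the arrangement.

  For the tropicalization one may take \<open>W\<close> over a trivially valued subfield \<open>k\<close>. A dependency
  between columns of \<open>V\<close> then has coefficients of valuation zero, so the sublevel sets of \<open>-val p\<close> are flats, and
  the Bergman fan is closed. Conversely, given \<open>u\<close> in the Bergman fan, let \<open>f\<^sub>J\<close> be a functional over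
  \<open>k\<close> vanishing on all columns \<open>J'\<close> with \<open>u\<^sub>J\<^sub>' < u\<^sub>J\<close> but not on column \<open>J\<close>. If \<open>t\<close> has small
  positive valuation \<open>\<delta>\<close> and the integers \<open>e\<^sub>J\<close> are distinct with \<open>e\<^sub>J \<delta> \<approx> -u\<^sub>J\<close>, then the valuations of the
  coordinates given by \<open>\<Sum>\<^sub>J t\<^bsup>e\<^sub>J\<^esup> f\<^sub>J\<close> approximate \<open>-u\<close>, so no
  genericity in the residue field is needed.\<close>

section \<open>Linear systems over a subfield\<close>

lemma sum_mult_diff_divide:
  fixes c a g :: "'e \<Rightarrow> 'a::field"
  shows "(\<Sum>J\<in>S. c J * (a J - g J * b / h)) = (\<Sum>J\<in>S. c J * a J) - (\<Sum>J\<in>S. c J * g J) * b / h"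
  by (simp add: right_diff_distrib sum_subtractf sum_distrib_right sum_divide_distrib mult.assoc)

text \<open>Subfields are kept as subsets of the ambient type, so that one elimination argument
  serves the trivially valued subfield and, with \<open>UNIV\<close>, the whole field.\<close>

locale field_subset =
  fixes k :: "'a::field set"
  assumes zero_closed: "0 \<in> k" and one_closed: "1 \<in> k"
    and add_closed: "x \<in> k \<Longrightarrow> y \<in> k \<Longrightarrow> x + y \<in> k"
    and mult_closed: "x \<in> k \<Longrightarrow> y \<in> k \<Longrightarrow> x * y \<in> k"
    and uminus_closed: "x \<in> k \<Longrightarrow> - x \<in> k"
    and inverse_closed: "x \<in> k \<Longrightarrow> inverse x \<in> k"
begin

lemma divide_closed: "x \<in> k \<Longrightarrow> y \<in> k \<Longrightarrow> x / y \<in> k"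
  by (simp add: divide_inverse mult_closed inverse_closed)

lemma diff_closed: "x \<in> k \<Longrightarrow> y \<in> k \<Longrightarrow> x - y \<in> k"
  using add_closed uminus_closed by (metis diff_conv_add_uminus)

lemma sum_closed: "(\<And>i. i \<in> A \<Longrightarrow> f i \<in> k) \<Longrightarrow> sum f A \<in> k"
  by (induction A rule: infinite_finite_induct) (auto simp: zero_closed add_closed)

lemma prod_closed: "(\<And>i. i \<in> A \<Longrightarrow> f i \<in> k) \<Longrightarrow> prod f A \<in> k"
  by (induction A rule: infinite_finite_induct) (auto simp: one_closed mult_closed)

lemmas closed = zero_closed one_closed add_closed mult_closed uminus_closed divide_closed diff_closed
  sum_closed

text \<open>Fredholm alternative by Gaussian elimination, which never leaves \<open>k\<close>. The
  second case rules out a relation with coefficient 1 at \<open>J0\<close> even over the large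
  field, so such a relation over the large field always descends to one over
  \<open>k\<close>.\<close>

lemma linear_alternative:
  fixes N :: "'r \<Rightarrow> 'e \<Rightarrow> 'a"
  assumes "finite R" "finite E" "J0 \<in> E" "\<And>r J. r \<in> R \<Longrightarrow> J \<in> E \<Longrightarrow> N r J \<in> k"
  shows "(\<exists>c. (\<forall>J. c J \<in> k) \<and> c J0 = 1 \<and> (\<forall>r\<in>R. (\<Sum>J\<in>E. c J * N r J) = 0)) \<or>
    (\<exists>f. (\<forall>r. f r \<in> k) \<and> (\<forall>J\<in>E. (\<Sum>r\<in>R. f r * N r J) = (if J = J0 then 1 else 0)))"
  using assms
proof (induction R arbitrary: E N rule: finite_induct)
  case empty
  show ?case
    by (rule disjI1, rule exI[of _ "\<lambda>J. if J = J0 then 1 else 0"]) (auto simp: closed)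
next
  case (insert r R)
  consider (zero) "\<forall>J\<in>E. N r J = 0" | (pivot) J1 where "J1 \<in> E" "J1 \<noteq> J0" "N r J1 \<noteq> 0"
    | (only) "N r J0 \<noteq> 0" "\<forall>J\<in>E - {J0}. N r J = 0"
    by blast
  then show ?case
  proof cases
    case zero
    have "(\<exists>c. (\<forall>J. c J \<in> k) \<and> c J0 = 1 \<and> (\<forall>r\<in>R. (\<Sum>J\<in>E. c J * N r J) = 0)) \<or>
      (\<exists>f. (\<forall>r. f r \<in> k) \<and> (\<forall>J\<in>E. (\<Sum>r\<in>R. f r * N r J) = (if J = J0 then 1 else 0)))"
      by (rule insert.IH) (use insert.prems in auto)
    then show ?thesis
    proof (elim disjE exE conjE)
      fix c assume "\<forall>J. c J \<in> k" "c J0 = 1" "\<forall>r\<in>R. (\<Sum>J\<in>E. c J * N r J) = 0"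
      then show ?thesis using zero by (intro disjI1 exI[of _ c]) auto
    next
      fix f assume "\<forall>r. f r \<in> k" "\<forall>J\<in>E. (\<Sum>r\<in>R. f r * N r J) = (if J = J0 then 1 else 0)"
      then show ?thesis using zero insert.hyps by (intro disjI2 exI[of _ f]) auto
    qed
  next
    case only
    have "(\<Sum>s\<in>insert r R. (if s = r then inverse (N r J0) else 0) * N s J) =
      inverse (N r J0) * N r J" for J
    proof -
      have "(\<Sum>s\<in>R. (if s = r then inverse (N r J0) else 0) * N s J) = 0"
        using insert.hyps by (intro sum.neutral) auto
      then show ?thesis using insert.hyps by simp
    qed
    then show ?thesis
      using only insert.prems
      by (intro disjI2 exI[of _ "\<lambda>s. if s = r then inverse (N r J0) else 0"])
        (auto simp: closed inverse_closed)
  next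
    case pivot
    \<comment> \<open>Schur complement of the pivot entry: \<open>N'\<close> vanishes in row
      \<open>r\<close> and in column \<open>J1\<close>, so the induction hypothesis is applied with
      both removed.\<close>
    define N' where "N' = (\<lambda>s J. N s J - N s J1 * N r J / N r J1)"
    define E' where "E' = E - {J1}"
    have E': "finite E'" "J1 \<notin> E'" "E = insert J1 E'" "J0 \<in> E'"
      using insert.prems pivot by (auto simp: E'_def)
    have "(\<exists>c. (\<forall>J. c J \<in> k) \<and> c J0 = 1 \<and> (\<forall>s\<in>R. (\<Sum>J\<in>E'. c J * N' s J) = 0)) \<or>
      (\<exists>f. (\<forall>s. f s \<in> k) \<and> (\<forall>J\<in>E'. (\<Sum>s\<in>R. f s * N' s J) = (if J = J0 then 1 else 0)))"
      by (rule insert.IH) (use insert.prems E' in \<open>auto simp: N'_def closed\<close>)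
    then show ?thesis
    proof (elim disjE exE conjE)
      fix c assume c: "\<forall>J. c J \<in> k" "c J0 = 1" "\<forall>s\<in>R. (\<Sum>J\<in>E'. c J * N' s J) = 0"
      \<comment> \<open>The coefficient at \<open>J1\<close> is forced by the equation of row
        \<open>r\<close>.\<close>
      define c' where "c' = c(J1 := - (\<Sum>J\<in>E'. c J * N r J) / N r J1)"
      have s: "(\<Sum>J\<in>E. c' J * N s J) = (\<Sum>J\<in>E'. c J * N' s J)" for s
      proof -
        have "(\<Sum>J\<in>E'. c' J * N s J) = (\<Sum>J\<in>E'. c J * N s J)"
          using E' by (intro sum.cong) (auto simp: c'_def)
        then have "(\<Sum>J\<in>E. c' J * N s J) =
            (\<Sum>J\<in>E'. c J * N s J) - (\<Sum>J\<in>E'. c J * N r J) * N s J1 / N r J1"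
          using E' by (simp add: c'_def)
        also have "\<dots> = (\<Sum>J\<in>E'. c J * N' s J)"
          unfolding N'_def mult.commute[of "N s J1"] by (rule sum_mult_diff_divide[symmetric])
        finally show ?thesis .
      qed
      have "(\<Sum>J\<in>E'. c J * N' r J) = 0" using pivot by (simp add: N'_def)
      with s c have "\<forall>s\<in>insert r R. (\<Sum>J\<in>E. c' J * N s J) = 0" by simp
      moreover have "\<forall>J. c' J \<in> k" using c E' insert.prems by (auto simp: c'_def intro!: closed)
      moreover have "c' J0 = 1" using c pivot by (simp add: c'_def)
      ultimately show ?thesis by blast
    next
      fix f assume f: "\<forall>s. f s \<in> k"
        "\<forall>J\<in>E'. (\<Sum>s\<in>R. f s * N' s J) = (if J = J0 then 1 else 0)"
      \<comment> \<open>The coefficient at \<open>r\<close> is chosen so that the functional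
        vanishes on column \<open>J1\<close>.\<close>
      define f' where "f' = f(r := - (\<Sum>s\<in>R. f s * N s J1) / N r J1)"
      have s: "(\<Sum>s\<in>insert r R. f' s * N s J) = (\<Sum>s\<in>R. f s * N' s J)" for J
      proof -
        have "(\<Sum>s\<in>R. f' s * N s J) = (\<Sum>s\<in>R. f s * N s J)"
          using insert.hyps by (intro sum.cong) (auto simp: f'_def)
        then have "(\<Sum>s\<in>insert r R. f' s * N s J) =
            (\<Sum>s\<in>R. f s * N s J) - (\<Sum>s\<in>R. f s * N s J1) * N r J / N r J1"
          using insert.hyps by (simp add: f'_def)
        also have "\<dots> = (\<Sum>s\<in>R. f s * N' s J)"
          unfolding N'_def by (rule sum_mult_diff_divide[symmetric])
        finally show ?thesis .
      qed
      have "(\<Sum>s\<in>R. f s * N' s J1) = 0" using pivot by (simp add: N'_def)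
      with s f E' pivot have "\<forall>J\<in>E. (\<Sum>s\<in>insert r R. f' s * N s J) = (if J = J0 then 1 else 0)"
        by simp
      moreover have "\<forall>s. f' s \<in> k"
        using f E' insert.prems by (auto simp: f'_def intro!: closed)
      ultimately show ?thesis by blast
    qed
  qed
qed

end

interpretation univ_field_subset: field_subset UNIV
  by standard auto

text \<open>Each pivot uses up one equation and one unknown, so an unknown is left over. This is the
  counting argument behind the exchange property and behind the size of a nonzero minor.\<close>

lemma underdetermined_system:
  fixes N :: "'r \<Rightarrow> 'e \<Rightarrow> 'a::field"
  assumes "finite R" "finite E" "card R < card E"
  shows "\<exists>c. (\<exists>J\<in>E. c J \<noteq> 0) \<and> (\<forall>r\<in>R. (\<Sum>J\<in>E. c J * N r J) = 0)"
  using assms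
proof (induction R arbitrary: E N rule: finite_induct)
  case empty
  then obtain J where "J \<in> E" by fastforce
  then show ?case by (intro exI[of _ "\<lambda>_. 1"]) auto
next
  case (insert r R)
  show ?case
  proof (cases "\<forall>J\<in>E. N r J = 0")
    case True
    have "\<exists>c. (\<exists>J\<in>E. c J \<noteq> 0) \<and> (\<forall>r\<in>R. (\<Sum>J\<in>E. c J * N r J) = 0)"
      by (rule insert.IH) (use insert in auto)
    then show ?thesis using True by auto
  next
    case False
    then obtain J1 where J1: "J1 \<in> E" "N r J1 \<noteq> 0" by blast
    define N' where "N' = (\<lambda>s J. N s J - N s J1 * N r J / N r J1)"
    define E' where "E' = E - {J1}"
    have E': "finite E'" "J1 \<notin> E'" "E = insert J1 E'"
      using insert.prems J1 by (auto simp: E'_def)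
    have "\<exists>c. (\<exists>J\<in>E'. c J \<noteq> 0) \<and> (\<forall>s\<in>R. (\<Sum>J\<in>E'. c J * N' s J) = 0)"
      by (rule insert.IH) (use insert E' in auto)
    then obtain c where c: "\<exists>J\<in>E'. c J \<noteq> 0" "\<forall>s\<in>R. (\<Sum>J\<in>E'. c J * N' s J) = 0"
      by blast
    define c' where "c' = c(J1 := - (\<Sum>J\<in>E'. c J * N r J) / N r J1)"
    have s: "(\<Sum>J\<in>E. c' J * N s J) = (\<Sum>J\<in>E'. c J * N' s J)" for s
    proof -
      have "(\<Sum>J\<in>E'. c' J * N s J) = (\<Sum>J\<in>E'. c J * N s J)"
        using E' by (intro sum.cong) (auto simp: c'_def)
      then have "(\<Sum>J\<in>E. c' J * N s J) =
          (\<Sum>J\<in>E'. c J * N s J) - (\<Sum>J\<in>E'. c J * N r J) * N s J1 / N r J1"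
        using E' by (simp add: c'_def)
      also have "\<dots> = (\<Sum>J\<in>E'. c J * N' s J)"
        unfolding N'_def mult.commute[of "N s J1"] by (rule sum_mult_diff_divide[symmetric])
      finally show ?thesis .
    qed
    have "(\<Sum>J\<in>E'. c J * N' r J) = 0" using J1 by (simp add: N'_def)
    with s c have "\<forall>s\<in>insert r R. (\<Sum>J\<in>E. c' J * N s J) = 0" by simp
    moreover have "\<exists>J\<in>E. c' J \<noteq> 0" using c E' by (auto simp: c'_def)
    ultimately show ?thesis by blast
  qed
qed

section \<open>Column matroids\<close>

definition in_span :: "'r set \<Rightarrow> ('r \<Rightarrow> 'e \<Rightarrow> 'a::field) \<Rightarrow> 'e set \<Rightarrow> 'e \<Rightarrow> bool" where
  "in_span R M S x \<longleftrightarrow> (\<exists>c. \<forall>r\<in>R. M r x = (\<Sum>J\<in>S. c J * M r J))"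

lemma in_span_mono:
  assumes "in_span R M S x" "S \<subseteq> F" "finite F"
  shows "in_span R M F x"
proof -
  obtain c where c: "\<forall>r\<in>R. M r x = (\<Sum>J\<in>S. c J * M r J)" using assms by (auto simp: in_span_def)
  have "(\<Sum>J\<in>S. c J * M r J) = (\<Sum>J\<in>F. (if J \<in> S then c J else 0) * M r J)" for r
    using assms by (intro sum.mono_neutral_cong_left) auto
  with c show ?thesis unfolding in_span_def by metis
qed

lemma in_span_self:
  assumes "x \<in> S" "finite S"
  shows "in_span R M S x"
proof -
  have "in_span R M {x} x" unfolding in_span_def by (rule exI[of _ "\<lambda>_. 1"]) auto
  then show ?thesis by (rule in_span_mono) (use assms in auto)
qed

lemma in_span_trans:
  assumes "in_span R M F x" "\<And>J. J \<in> F \<Longrightarrow> in_span R M S J"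
  shows "in_span R M S x"
proof -
  obtain c where c: "\<forall>r\<in>R. M r x = (\<Sum>J\<in>F. c J * M r J)" using assms by (auto simp: in_span_def)
  have "\<forall>J\<in>F. \<exists>b. \<forall>r\<in>R. M r J = (\<Sum>i\<in>S. b i * M r i)" using assms by (auto simp: in_span_def)
  then obtain b where b: "\<forall>J\<in>F. \<forall>r\<in>R. M r J = (\<Sum>i\<in>S. b J i * M r i)" by metis
  have "M r x = (\<Sum>i\<in>S. (\<Sum>J\<in>F. c J * b J i) * M r i)" if "r \<in> R" for r
  proof -
    have "M r x = (\<Sum>J\<in>F. c J * (\<Sum>i\<in>S. b J i * M r i))" using b c that by simp
    also have "\<dots> = (\<Sum>i\<in>S. (\<Sum>J\<in>F. c J * b J i) * M r i)"
      by (subst sum_distrib_left, subst sum.swap) (simp add: sum_distrib_right mult.assoc)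
    finally show ?thesis .
  qed
  then show ?thesis unfolding in_span_def by (intro exI[of _ "\<lambda>i. \<Sum>J\<in>F. c J * b J i"]) auto
qed

lemma column_matroidI:
  assumes "S \<subseteq> E" "\<And>c J. \<forall>r\<in>R. (\<Sum>J\<in>S. c J * M r J) = 0 \<Longrightarrow> J \<in> S \<Longrightarrow> c J = 0"
  shows "S \<in> column_matroid R E M"
  unfolding column_matroid_def using assms by blast

lemma column_matroidD:
  assumes "S \<in> column_matroid R E M" "\<forall>r\<in>R. (\<Sum>J\<in>S. c J * M r J) = 0" "J \<in> S"
  shows "c J = 0"
  using assms unfolding column_matroid_def by blast

lemma column_matroid_subset: "S \<in> column_matroid R E M \<Longrightarrow> S \<subseteq> E"
  by (simp add: column_matroid_def)

lemma column_matroid_finite: "S \<in> column_matroid R E M \<Longrightarrow> finite E \<Longrightarrow> finite S"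
  by (meson column_matroid_subset finite_subset)

lemma column_matroid_hereditary:
  assumes "S \<in> column_matroid R E M" "T \<subseteq> S" "finite E"
  shows "T \<in> column_matroid R E M"
proof -
  have "finite S" "T \<subseteq> E"
    using column_matroid_finite[OF assms(1,3)] column_matroid_subset[OF assms(1)] assms(2) by auto
  moreover have "\<forall>J\<in>T. c J = 0" if "\<forall>r\<in>R. (\<Sum>J\<in>T. c J * M r J) = 0" for c
  proof -
    have "(\<Sum>J\<in>T. c J * M r J) = (\<Sum>J\<in>S. (if J \<in> T then c J else 0) * M r J)" for r
      using assms \<open>finite S\<close> by (intro sum.mono_neutral_cong_left) auto
    then have "\<forall>r\<in>R. (\<Sum>J\<in>S. (if J \<in> T then c J else 0) * M r J) = 0" using that by simp
    then have "\<forall>J\<in>S. (if J \<in> T then c J else 0) = 0"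
      using assms(1) unfolding column_matroid_def
      by (elim CollectE conjE allE[of _ "\<lambda>J. if J \<in> T then c J else 0"]) simp
    then show ?thesis using assms(2) by (metis subsetD)
  qed
  ultimately show ?thesis by (intro column_matroidI) blast+
qed

text \<open>A relation that involves \<open>x\<close> can be divided by its coefficient there, which
  expresses \<open>x\<close> through \<open>S\<close>; a relation that avoids \<open>x\<close> is
  trivial by independence of \<open>S\<close>.\<close>

lemma insert_in_column_matroid:
  assumes "S \<in> column_matroid R E M" "x \<in> E - S" "finite E"
  shows "insert x S \<in> column_matroid R E M \<longleftrightarrow> \<not> in_span R M S x"
proof -
  have S: "finite S" "x \<notin> S" "S \<subseteq> E" "x \<in> E"
    using column_matroid_finite[OF assms(1,3)] column_matroid_subset[OF assms(1)] assms(2) by auto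
  show ?thesis
  proof
    assume ins: "insert x S \<in> column_matroid R E M"
    show "\<not> in_span R M S x"
    proof
      assume "in_span R M S x"
      then obtain c where c: "\<forall>r\<in>R. M r x = (\<Sum>J\<in>S. c J * M r J)" by (auto simp: in_span_def)
      have "(\<Sum>J\<in>S. (c(x := -1)) J * M r J) = (\<Sum>J\<in>S. c J * M r J)" for r
        using S by (intro sum.cong) auto
      with c S have "\<forall>r\<in>R. (\<Sum>J\<in>insert x S. (c(x := -1)) J * M r J) = 0" by simp
      with ins have "\<forall>J\<in>insert x S. (c(x := -1)) J = 0" unfolding column_matroid_def by blast
      then show False by simp
    qed
  next
    assume nspan: "\<not> in_span R M S x"
    have "c J = 0" if c: "\<forall>r\<in>R. (\<Sum>J\<in>insert x S. c J * M r J) = 0" and J: "J \<in> insert x S" for c J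
    proof -
      have c': "\<forall>r\<in>R. c x * M r x + (\<Sum>J\<in>S. c J * M r J) = 0" using c S by simp
      have cx: "c x = 0"
      proof (rule ccontr)
        assume "c x \<noteq> 0"
        then have "\<forall>r\<in>R. M r x = (\<Sum>J\<in>S. (- c J / c x) * M r J)"
          using c' by (simp add: sum_negf eq_neg_iff_add_eq_0 field_simps flip: sum_divide_distrib)
        then have "in_span R M S x" unfolding in_span_def by (rule exI[of _ "\<lambda>J. - c J / c x"])
        then show False using nspan by contradiction
      qed
      with c' have "\<forall>r\<in>R. (\<Sum>J\<in>S. c J * M r J) = 0" by simp
      with cx J show ?thesis using column_matroidD[OF assms(1)] by blast
    qed
    moreover have "insert x S \<subseteq> E" using S by blast
    ultimately show "insert x S \<in> column_matroid R E M" by (intro column_matroidI)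
  qed
qed

text \<open>If exchange failed, every column of \<open>T\<close> would lie in the span of the fewer
  columns of \<open>S\<close>. The system for the coefficients then has fewer equations than
  unknowns and yields a relation inside \<open>T\<close>.\<close>

lemma matroid_column_matroid:
  assumes "finite E"
  shows "matroid E (column_matroid R E M)"
  unfolding matroid_def
proof (intro conjI ballI allI impI)
  fix S T assume S: "S \<in> column_matroid R E M" and T: "T \<in> column_matroid R E M"
    and card: "card S < card T"
  have fin: "finite S" "finite T" "S \<subseteq> E" "T \<subseteq> E"
    using S T assms by (auto dest: column_matroid_finite column_matroid_subset)
  show "\<exists>x\<in>T - S. insert x S \<in> column_matroid R E M"
  proof (rule ccontr)
    assume contr: "\<not> ?thesis"
    have "in_span R M S x" if "x \<in> T" for x
    proof (cases "x \<in> S")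
      case False
      then show ?thesis using contr insert_in_column_matroid[OF S _ assms, of x] that fin by auto
    qed (simp add: fin in_span_self)
    then obtain b where b: "\<forall>x\<in>T. \<forall>r\<in>R. M r x = (\<Sum>s\<in>S. b x s * M r s)"
      unfolding in_span_def by metis
    obtain c where c: "\<exists>x\<in>T. c x \<noteq> 0" "\<forall>s\<in>S. (\<Sum>x\<in>T. c x * b x s) = 0"
      using underdetermined_system[OF fin(1,2) card, of "\<lambda>s x. b x s"] by blast
    have "(\<Sum>x\<in>T. c x * M r x) = 0" if "r \<in> R" for r
    proof -
      have "(\<Sum>x\<in>T. c x * M r x) = (\<Sum>x\<in>T. c x * (\<Sum>s\<in>S. b x s * M r s))" using b that by simp
      also have "\<dots> = (\<Sum>s\<in>S. (\<Sum>x\<in>T. c x * b x s) * M r s)"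
        by (subst sum_distrib_left, subst sum.swap) (simp add: sum_distrib_right mult.assoc)
      also have "\<dots> = 0" using c by simp
      finally show ?thesis .
    qed
    then show False using T c(1) unfolding column_matroid_def by blast
  qed
next
  show "column_matroid R E M \<subseteq> Pow E" by (auto dest: column_matroid_subset)
  show "{} \<in> column_matroid R E M" by (rule column_matroidI) auto
qed (use assms column_matroid_hereditary in blast)+

section \<open>Rank, flats and duality of column matroids\<close>

lemma matroid_rank_attained:
  assumes "matroid E I" "A \<subseteq> E"
  obtains S where "S \<in> I" "S \<subseteq> A" "card S = matroid_rank I A"
    "\<And>T. T \<in> I \<Longrightarrow> T \<subseteq> A \<Longrightarrow> card T \<le> matroid_rank I A"
proof -
  let ?C = "{card S | S. S \<in> I \<and> S \<subseteq> A}"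
  have "finite A" using assms by (auto simp: matroid_def intro: rev_finite_subset)
  have "?C \<subseteq> card ` Pow A" by auto
  then have fin: "finite ?C" using \<open>finite A\<close> by (meson finite_Pow_iff finite_imageI finite_subset)
  have "?C \<noteq> {}" using assms by (auto simp: matroid_def)
  then have "matroid_rank I A \<in> ?C" unfolding matroid_rank_def using fin Max_in by blast
  then obtain S where "S \<in> I" "S \<subseteq> A" "card S = matroid_rank I A" by auto
  moreover have "card T \<le> matroid_rank I A" if "T \<in> I" "T \<subseteq> A" for T
    unfolding matroid_rank_def using fin that by (intro Max_ge) auto
  ultimately show ?thesis using that by blast
qed

text \<open>A largest independent subset of \<open>F\<close> spans \<open>F\<close>, so adjoining
  \<open>x\<close> raises the rank exactly when \<open>x\<close> lies outside this span. Flats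
  become span-closed sets, the form used for Bergman fans.\<close>

lemma flat_column_matroid:
  assumes "finite E"
  shows "flat E (column_matroid R E M) F \<longleftrightarrow> F \<subseteq> E \<and> (\<forall>x\<in>E - F. \<not> in_span R M F x)"
proof -
  let ?I = "column_matroid R E M"
  note mat = matroid_column_matroid[OF assms, of R M]
  have "matroid_rank ?I F < matroid_rank ?I (insert x F) \<longleftrightarrow> \<not> in_span R M F x"
    if FE: "F \<subseteq> E" and xE: "x \<in> E - F" for x
  proof -
    obtain S where S: "S \<in> ?I" "S \<subseteq> F" "card S = matroid_rank ?I F"
      "\<And>T. T \<in> ?I \<Longrightarrow> T \<subseteq> F \<Longrightarrow> card T \<le> matroid_rank ?I F"
      using matroid_rank_attained[OF mat FE] by blast
    have xFE: "insert x F \<subseteq> E" using FE xE by auto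
    then obtain T where T: "T \<in> ?I" "T \<subseteq> insert x F" "card T = matroid_rank ?I (insert x F)"
      "\<And>T. T \<in> ?I \<Longrightarrow> T \<subseteq> insert x F \<Longrightarrow> card T \<le> matroid_rank ?I (insert x F)"
      using matroid_rank_attained[OF mat xFE] by blast
    have fin: "finite F" "finite S" using rev_finite_subset[OF assms FE] rev_finite_subset[OF _ S(2)] by auto
    have xS: "x \<in> E - S" using S xE by auto
    have span: "in_span R M S J" if "J \<in> F" for J
    proof (cases "J \<in> S")
      case False
      show ?thesis
      proof (rule ccontr)
        assume "\<not> in_span R M S J"
        then have "insert J S \<in> ?I"
          using insert_in_column_matroid[OF S(1) _ assms, of J] False that \<open>F \<subseteq> E\<close> by auto
        then have "card (insert J S) \<le> card S" using S that by auto
        then show False using False fin by simp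
      qed
    qed (simp add: fin in_span_self)
    show ?thesis
    proof
      assume less: "matroid_rank ?I F < matroid_rank ?I (insert x F)"
      obtain y where y: "y \<in> T - S" "insert y S \<in> ?I"
        using mat S(1) T(1) less S(3) T(3) unfolding matroid_def by metis
      have "y = x"
      proof (rule ccontr)
        assume "y \<noteq> x"
        then have "card (insert y S) \<le> card S" using y S T(2) by auto
        then show False using y fin by simp
      qed
      then have "\<not> in_span R M S x" using y insert_in_column_matroid[OF S(1) xS assms] by simp
      then show "\<not> in_span R M F x" using in_span_trans span by metis
    next
      assume "\<not> in_span R M F x"
      then have "\<not> in_span R M S x" using in_span_mono S(2) fin by metis
      then have "insert x S \<in> ?I" using insert_in_column_matroid[OF S(1) xS assms] by simp
      then have "card (insert x S) \<le> matroid_rank ?I (insert x F)" using S T(4) by blast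
      then show "matroid_rank ?I F < matroid_rank ?I (insert x F)" using S(3) xS fin by simp
    qed
  qed
  then show ?thesis unfolding flat_def by auto
qed

text \<open>By \<open>kernel\<close> the row space of \<open>V\<close> is the orthogonal complement
  of the row space of \<open>U\<close>. Hence \<open>S\<close> is independent for \<open>V\<close>
  exactly when the columns of \<open>U\<close> outside \<open>S\<close> span all columns, that is,
  contain a basis.\<close>

lemma dual_column_matroid:
  fixes V :: "'r \<Rightarrow> 'e \<Rightarrow> 'a::field" and U :: "'s \<Rightarrow> 'e \<Rightarrow> 'a"
  assumes "finite E" "finite R"
    and kernel: "\<And>p. (\<forall>s\<in>Q. (\<Sum>J\<in>E. p J * U s J) = 0) \<longleftrightarrow> (\<exists>a. \<forall>J\<in>E. p J = (\<Sum>r\<in>R. a r * V r J))"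
  shows "column_matroid R E V = dual_matroid E (column_matroid Q E U)"
proof (intro equalityI subsetI)
  fix S assume S: "S \<in> dual_matroid E (column_matroid Q E U)"
  then obtain B where B: "S \<subseteq> E" "basis_of (column_matroid Q E U) B" "S \<subseteq> E - B"
    by (auto simp: dual_matroid_def)
  have BI: "B \<in> column_matroid Q E U" using B by (simp add: basis_of_def)
  then have "B \<subseteq> E" "finite B" using assms by (auto dest: column_matroid_finite column_matroid_subset)
  have "finite S" using assms(1) B(1) by (rule rev_finite_subset)
  have "c J0 = 0" if c: "\<forall>r\<in>R. (\<Sum>J\<in>S. c J * V r J) = 0" and J0: "J0 \<in> S" for c J0
  proof -
    have "insert J0 B \<notin> column_matroid Q E U" 
      using B J0 unfolding basis_of_def by blast
    then have "in_span Q U B J0" using insert_in_column_matroid[OF BI _ assms(1), of J0] B J0 by auto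
    then obtain b where b: "\<forall>s\<in>Q. U s J0 = (\<Sum>J\<in>B. b J * U s J)" by (auto simp: in_span_def)
    \<comment> \<open>The relation expressing column \<open>J0\<close> of \<open>U\<close> through
      the basis. It meets \<open>S\<close> only in \<open>J0\<close> since \<open>B\<close> avoids
      \<open>S\<close>, so pairing it with \<open>c\<close> isolates \<open>c J0\<close>.\<close>
    define p where "p = (\<lambda>J. if J = J0 then -1 else if J \<in> B then b J else 0)"
    have "(\<Sum>J\<in>E. p J * U s J) = 0" if "s \<in> Q" for s
    proof -
      have "(\<Sum>J\<in>E. p J * U s J) = (\<Sum>J\<in>insert J0 B. p J * U s J)"
        using assms \<open>B \<subseteq> E\<close> J0 B by (intro sum.mono_neutral_right) (auto simp: p_def)
      also have "\<dots> = - U s J0 + (\<Sum>J\<in>B. p J * U s J)"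
        using \<open>finite B\<close> J0 B by (subst sum.insert) (auto simp: p_def)
      also have "(\<Sum>J\<in>B. p J * U s J) = (\<Sum>J\<in>B. b J * U s J)"
        using J0 B by (intro sum.cong) (auto simp: p_def)
      finally show ?thesis using b that by simp
    qed
    then obtain a where a: "\<forall>J\<in>E. p J = (\<Sum>r\<in>R. a r * V r J)" using kernel[of p] by blast
    have "(\<Sum>J\<in>S. c J * p J) = (\<Sum>J\<in>S. c J * (\<Sum>r\<in>R. a r * V r J))" using a B by (intro sum.cong) auto
    also have "\<dots> = (\<Sum>r\<in>R. a r * (\<Sum>J\<in>S. c J * V r J))"
      by (simp add: sum_distrib_left) (subst sum.swap, simp add: mult.left_commute)
    also have "\<dots> = 0" using c by simp
    also have "(\<Sum>J\<in>S. c J * p J) = (\<Sum>J\<in>{J0}. c J * p J)"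
      using \<open>finite S\<close> J0 B by (intro sum.mono_neutral_right) (auto simp: p_def)
    finally show ?thesis by (simp add: p_def)
  qed
  then show "S \<in> column_matroid R E V" using B(1) by (intro column_matroidI)
next
  fix S assume S: "S \<in> column_matroid R E V"
  let ?MU = "column_matroid Q E U"
  have "S \<subseteq> E" "finite S" using S assms by (auto dest: column_matroid_finite column_matroid_subset)
  obtain B where B: "B \<in> ?MU" "B \<subseteq> E - S" "\<And>T. T \<in> ?MU \<Longrightarrow> T \<subseteq> E - S \<Longrightarrow> card T \<le> card B"
    using matroid_rank_attained[OF matroid_column_matroid[OF assms(1)] Diff_subset] by metis
  have finB: "finite B" "finite (E - S)" using column_matroid_finite[OF B(1)] assms by auto
  have span: "in_span Q U B J" if J: "J \<in> E - S" for J
  proof (cases "J \<in> B")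
    case False
    show ?thesis
    proof (rule ccontr)
      assume "\<not> in_span Q U B J"
      then have "insert J B \<in> ?MU"
        using insert_in_column_matroid[OF B(1) _ assms(1), of J] False J by auto
      then have "card (insert J B) \<le> card B" using B J by blast
      then show False using False finB by simp
    qed
  qed (simp add: finB in_span_self)
  \<comment> \<open>Independence of \<open>S\<close> gives a row combination of \<open>V\<close>
    equal to 1 at \<open>J0\<close> and 0 on the rest of \<open>S\<close>. Being a relation among
    the columns of \<open>U\<close>, it expresses column \<open>J0\<close> through columns outside
    \<open>S\<close>.\<close>
  have spanS: "in_span Q U B J0" if J0: "J0 \<in> S" for J0
  proof -
    have "c J0 \<noteq> 1" if "\<forall>r\<in>R. (\<Sum>J\<in>S. c J * V r J) = 0" for c
    proof -
      have "c J0 = 0" using S J0 that unfolding column_matroid_def by blast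
      then show ?thesis by simp
    qed
    then obtain f where f: "\<forall>J\<in>S. (\<Sum>r\<in>R. f r * V r J) = (if J = J0 then 1 else 0)"
      using univ_field_subset.linear_alternative[OF assms(2) \<open>finite S\<close> J0, of V] by blast
    define p where "p = (\<lambda>J. \<Sum>r\<in>R. f r * V r J)"
    have p: "\<forall>s\<in>Q. (\<Sum>J\<in>E. p J * U s J) = 0" using kernel[of p] by (auto simp: p_def)
    have "U s J0 = (\<Sum>J\<in>E - S. - p J * U s J)" if "s \<in> Q" for s
    proof -
      have "0 = (\<Sum>J\<in>S. p J * U s J) + (\<Sum>J\<in>E - S. p J * U s J)"
        using p that sum.subset_diff[OF \<open>S \<subseteq> E\<close> assms(1), of "\<lambda>J. p J * U s J"] by (simp add: add.commute)
      also have "(\<Sum>J\<in>S. p J * U s J) = (\<Sum>J\<in>{J0}. p J * U s J)"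
        using \<open>finite S\<close> J0 f by (intro sum.mono_neutral_right) (auto simp: p_def)
      finally have "0 = p J0 * U s J0 + (\<Sum>J\<in>E - S. p J * U s J)" by simp
      moreover have "p J0 = 1" using f J0 by (simp add: p_def)
      ultimately show ?thesis by (simp add: sum_negf eq_neg_iff_add_eq_0)
    qed
    then have "in_span Q U (E - S) J0" unfolding in_span_def by (intro exI[of _ "\<lambda>J. - p J"]) auto
    then show ?thesis using in_span_trans span by metis
  qed
  have "T = B" if T: "T \<in> ?MU" "B \<subseteq> T" for T
  proof (rule ccontr)
    assume "T \<noteq> B"
    then obtain J where J: "J \<in> T" "J \<notin> B" using T by blast
    then have "insert J B \<in> ?MU" using T column_matroid_hereditary[OF T(1) _ assms(1)] by auto
    moreover have "J \<in> E" using column_matroid_subset[OF T(1)] J by auto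
    ultimately show False using insert_in_column_matroid[OF B(1) _ assms(1), of J] J span spanS by blast
  qed
  then have "basis_of ?MU B" using B by (auto simp: basis_of_def)
  then show "S \<in> dual_matroid E ?MU" using B \<open>S \<subseteq> E\<close> by (auto simp: dual_matroid_def)
qed

section \<open>Maximal minors\<close>

text \<open>\<open>pick A c\<close> is the element of \<open>A\<close> with exactly \<open>c\<close>
  smaller ones. Inserting \<open>i\<close> shifts the elements above \<open>i\<close> by one
  position, which is the same index shift as in \<open>mat_delete\<close>.\<close>

lemma pick_insert:
  assumes "finite A" "i \<notin> A" "c < card A"
  shows "pick (insert i A) (if c < card {a \<in> A. a < i} then c else Suc c) = pick A c"
proof -
  define x where "x = pick A c"
  have x: "x \<in> A" "card {a \<in> A. a < x} = c"
    using assms pick_in_set_le card_pick_le by (auto simp: x_def)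
  have "x \<noteq> i" using x assms by auto
  show ?thesis
  proof (cases "i < x")
    case True
    have "card {a \<in> A. a < i} \<le> c"
      unfolding x(2)[symmetric] using assms True by (intro card_mono) auto
    moreover have "{a \<in> insert i A. a < x} = insert i {a \<in> A. a < x}" using True by auto
    then have "card {a \<in> insert i A. a < x} = Suc c" using assms x by simp
    ultimately show ?thesis using pick_card_in_set[of x "insert i A"] x by (simp add: x_def)
  next
    case False
    then have "x < i" using \<open>x \<noteq> i\<close> by simp
    have "card (insert x {a \<in> A. a < x}) \<le> card {a \<in> A. a < i}"
      using assms \<open>x < i\<close> x by (intro card_mono) auto
    then have "c < card {a \<in> A. a < i}" using assms x by simp
    moreover have "{a \<in> insert i A. a < x} = {a \<in> A. a < x}" using False by auto
    then have "card {a \<in> insert i A. a < x} = c" using x by simp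
    ultimately show ?thesis using pick_card_in_set[of x "insert i A"] x by (simp add: x_def)
  qed
qed

lemma pick_insert_self:
  assumes "i \<notin> A"
  shows "pick (insert i A) (card {a \<in> A. a < i}) = i"
proof -
  have "{a \<in> insert i A. a < i} = {a \<in> A. a < i}" by auto
  then show ?thesis using pick_card_in_set[of i "insert i A"] by simp
qed

lemma pick_Compl_singleton: "pick (UNIV - {s}) r = (if r < s then r else Suc r)"
proof -
  define x where "x = (if r < s then r else Suc r)"
  have "{a \<in> UNIV - {s}. a < x} = (if r < s then {..<r} else {..<Suc r} - {s})"
    by (auto simp: x_def)
  then have "card {a \<in> UNIV - {s}. a < x} = r" by auto
  moreover have "x \<in> UNIV - {s}" by (auto simp: x_def)
  ultimately show ?thesis using pick_card_in_set[of x "UNIV - {s}"] by (simp add: x_def)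
qed

lemma submatrix_cols:
  assumes "M \<in> carrier_mat m n" "J \<subseteq> {..<n}"
  shows "submatrix M UNIV J = mat m (card J) (\<lambda>(r, c). M $$ (r, pick J c))"
proof -
  have "{j. j < n \<and> j \<in> J} = J" using assms by auto
  then show ?thesis using assms unfolding submatrix_def pick_UNIV by simp
qed

lemma submatrix_del_row_cols:
  assumes "M \<in> carrier_mat (Suc m) n" "J \<subseteq> {..<n}" "s < Suc m"
  shows "submatrix M (UNIV - {s}) J =
    mat m (card J) (\<lambda>(r, c). M $$ (if r < s then r else Suc r, pick J c))"
proof -
  have "{j. j < n \<and> j \<in> J} = J" using assms by auto
  moreover have "{i. i < Suc m \<and> i \<in> UNIV - {s}} = {..<Suc m} - {s}" by auto
  then have "card {i. i < Suc m \<and> i \<in> UNIV - {s}} = m" using assms by simp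
  ultimately show ?thesis using assms unfolding submatrix_def pick_Compl_singleton by simp
qed

lemma pick_less:
  assumes "J \<subseteq> {..<n}" "c < card J"
  shows "pick J c < n"
  using assms pick_in_set_le[of c J] by auto

section \<open>Bordered determinants and Laplace expansion\<close>

definition border_mat :: "(nat \<Rightarrow> 'a) \<Rightarrow> 'a mat \<Rightarrow> nat set \<Rightarrow> 'a mat" where
  "border_mat a M A =
     mat (dim_row M) (dim_row M) (\<lambda>(s, c). if c = 0 then a s else M $$ (s, pick A (c - 1)))"

text \<open>Laplace expansion along the prepended column: its cofactor in row \<open>s\<close> is
  \<open>V_matrix M s A\<close>, sign included. Combinations of rows of \<open>V\<close> thus become
  determinants.\<close>

lemma det_border_mat:
  fixes M :: "'a::field mat"
  assumes M: "M \<in> carrier_mat m n" and A: "A \<subseteq> {..<n}" "Suc (card A) = m"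
  shows "(\<Sum>s<m. a s * V_matrix M s A) = det (border_mat a M A)"
proof -
  let ?B = "border_mat a M A"
  have B: "?B \<in> carrier_mat m m" using M by (auto simp: border_mat_def)
  have "m > 0" using A by auto
  have "mat_delete ?B s 0 = submatrix M (UNIV - {s}) A" if "s < m" for s
  proof -
    have "submatrix M (UNIV - {s}) A =
        mat (m - 1) (card A) (\<lambda>(r, c). M $$ (if r < s then r else Suc r, pick A c))"
      using submatrix_del_row_cols[of M "m - 1" n A s] M A that by auto
    then show ?thesis using M A that
      by (auto simp: mat_delete_def border_mat_def intro!: eq_matI)
  qed
  then show ?thesis
    using laplace_expansion_column[OF B \<open>m > 0\<close>] M A
    by (auto simp: cofactor_def V_matrix_def border_mat_def mult.assoc)
qed

text \<open>For \<open>i\<close> in \<open>A\<close> this is a determinant with a repeated column.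
  Otherwise it is the expansion of the larger minor along column \<open>i\<close>, whose position in
  \<open>insert i A\<close> is the number of smaller elements, whence the sign.\<close>

lemma V_matrix_cofactor:
  fixes M :: "'a::field mat"
  assumes M: "M \<in> carrier_mat m n" and A: "A \<subseteq> {..<n}" "Suc (card A) = m" and i: "i < n"
  shows "(\<Sum>s<m. M $$ (s, i) * V_matrix M s A) =
    (if i \<in> A then 0 else (-1) ^ card {a \<in> A. a < i} * det (submatrix M UNIV (insert i A)))"
proof (cases "i \<in> A")
  case True
  have fA: "finite A" using A finite_subset by blast
  let ?B = "border_mat (\<lambda>s. M $$ (s, i)) M A"
  let ?c = "Suc (card {a \<in> A. a < i})"
  have B: "?B \<in> carrier_mat m m" using M by (auto simp: border_mat_def)
  have "card {a \<in> A. a < i} < card A" using True fA by (intro psubset_card_mono) auto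
  then have c: "?c < m" "0 < m" using A by auto
  have "col ?B 0 = col ?B ?c"
    using M c pick_card_in_set[OF True] by (intro eq_vecI) (auto simp: border_mat_def)
  then have "det ?B = 0" using det_identical_columns[OF B _ c(2,1)] by simp
  then show ?thesis using det_border_mat[OF M A] True by simp
next
  case False
  have fA: "finite A" using A finite_subset by blast
  let ?p = "card {a \<in> A. a < i}"
  let ?I = "insert i A"
  have I: "?I \<subseteq> {..<n}" "card ?I = m" using A i False fA by auto
  have S: "submatrix M UNIV ?I = mat m m (\<lambda>(r, c). M $$ (r, pick ?I c))"
    using submatrix_cols[OF M I(1)] I by simp
  have "?p \<le> card A" using fA by (intro card_mono) auto
  then have p: "?p < m" using A by simp
  have "mat_delete (submatrix M UNIV ?I) s ?p = submatrix M (UNIV - {s}) A" if "s < m" for s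
  proof -
    have "submatrix M (UNIV - {s}) A =
        mat (m - 1) (card A) (\<lambda>(r, c). M $$ (if r < s then r else Suc r, pick A c))"
      using submatrix_del_row_cols[of M "m - 1" n A s] M A that by auto
    moreover have "pick ?I (if c < ?p then c else Suc c) = pick A c" if "c < card A" for c
      using pick_insert[OF fA False that] .
    ultimately show ?thesis using A \<open>s < m\<close> unfolding S mat_delete_def
      by (intro eq_matI) auto
  qed
  then have "det (submatrix M UNIV ?I) =
      (\<Sum>s<m. M $$ (s, i) * ((-1) ^ (s + ?p) * det (submatrix M (UNIV - {s}) A)))"
    using laplace_expansion_column[of "submatrix M UNIV ?I" m ?p] p pick_insert_self[OF False]
    by (simp add: S cofactor_def)
  also have "(-1) ^ ?p * \<dots> = (\<Sum>s<m. M $$ (s, i) * V_matrix M s A)"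
    by (auto simp: sum_distrib_left V_matrix_def power_add algebra_simps intro!: sum.cong)
  finally show ?thesis using False by simp
qed

text \<open>Repeating row \<open>s\<close> on top of \<open>M\<close> gives a square minor on
  \<open>B\<close> with two equal rows; expanding it along the top row gives the relation.\<close>

lemma cramer_relation:
  fixes M :: "'a::field mat"
  assumes M: "M \<in> carrier_mat m n" and B: "B \<subseteq> {..<n}" "card B = Suc m" and s: "s < m"
  shows "(\<Sum>i\<in>B. (-1) ^ card ({..i} \<inter> B) * det (submatrix M UNIV (B - {i})) * M $$ (s, i)) = 0"
proof -
  have fB: "finite B" using B finite_subset by blast
  define M' where "M' = mat (Suc m) n (\<lambda>(r, j). if r = 0 then M $$ (s, j) else M $$ (r - 1, j))"
  have M': "M' \<in> carrier_mat (Suc m) n" by (simp add: M'_def)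
  let ?S = "submatrix M' UNIV B"
  have S: "?S = mat (Suc m) (Suc m) (\<lambda>(r, c). M' $$ (r, pick B c))"
    using submatrix_cols[OF M' B(1)] B by simp
  have M'_index: "M' $$ (0, j) = M $$ (s, j)" "r < m \<Longrightarrow> M' $$ (Suc r, j) = M $$ (r, j)" if "j < n" for r j
    using that by (auto simp: M'_def)
  have "row ?S 0 = row ?S (Suc s)"
    unfolding S using s pick_less[OF B(1)] B by (intro eq_vecI) (auto simp: M'_index)
  then have 0: "det ?S = 0" using det_identical_rows[of ?S "Suc m" 0 "Suc s"] s by (simp add: S)
  have del: "mat_delete ?S 0 c = submatrix M UNIV (B - {pick B c})" if "c < Suc m" for c
  proof -
    let ?i = "pick B c"
    have i: "?i \<in> B" "card {a \<in> B. a < ?i} = c"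
      using that B pick_in_set_le card_pick_le by auto
    have "{a \<in> B - {?i}. a < ?i} = {a \<in> B. a < ?i}" by auto
    then have p: "card {a \<in> B - {?i}. a < ?i} = c" using i by simp
    have cB: "card (B - {?i}) = m" using i B fB by simp
    have "pick B (if c' < c then c' else Suc c') = pick (B - {?i}) c'" if "c' < m" for c'
      using pick_insert[of "B - {?i}" ?i c'] fB p cB that i by (simp add: insert_absorb)
    moreover have "pick (B - {?i}) c' < n" if "c' < m" for c'
      using pick_less[of "B - {?i}" n c'] B cB that by auto
    moreover have "submatrix M UNIV (B - {?i}) = mat m m (\<lambda>(r, c). M $$ (r, pick (B - {?i}) c))"
      using submatrix_cols[OF M, of "B - {?i}"] B cB by auto
    ultimately show ?thesis unfolding S mat_delete_def by (intro eq_matI) (auto simp: M'_index)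
  qed
  have bij: "bij_betw (pick B) {..<Suc m} B"
    unfolding bij_betw_def
  proof
    show inj: "inj_on (pick B) {..<Suc m}"
    proof (rule inj_onI)
      fix x y assume xy: "x \<in> {..<Suc m}" "y \<in> {..<Suc m}" and eq: "pick B x = pick B y"
      have "x < card B" "y < card B" using xy B(2) by auto
      then have "card {a \<in> B. a < pick B x} = x" "card {a \<in> B. a < pick B y} = y"
        using card_pick_le[of x B] card_pick_le[of y B] by blast+
      then show "x = y" unfolding eq by (rule trans[OF sym])
    qed
    have "pick B ` {..<Suc m} \<subseteq> B" using B pick_in_set_le by auto
    moreover have "card (pick B ` {..<Suc m}) = card B" using card_image[OF inj] B by simp
    ultimately show "pick B ` {..<Suc m} = B" using fB card_subset_eq by metis
  qed
  \<comment> \<open>The part of \<open>B\<close> up to and including \<open>pick B c\<close> has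
    \<open>Suc c\<close> elements, so the signs are opposite to the cofactor signs of the top row
    and the sum becomes \<open>- det ?S\<close>.\<close>
  have c: "card ({..pick B c} \<inter> B) = Suc c" if "c < Suc m" for c
  proof -
    have "pick B c \<in> B" "card {a \<in> B. a < pick B c} = c"
      using that B pick_in_set_le card_pick_le by auto
    moreover have "{..pick B c} \<inter> B = insert (pick B c) {a \<in> B. a < pick B c}"
      using \<open>pick B c \<in> B\<close> by auto
    ultimately show ?thesis using fB by simp
  qed
  have "(\<Sum>i\<in>B. (-1) ^ card ({..i} \<inter> B) * det (submatrix M UNIV (B - {i})) * M $$ (s, i)) =
      (\<Sum>c<Suc m. (-1) ^ card ({..pick B c} \<inter> B) * det (submatrix M UNIV (B - {pick B c})) * M $$ (s, pick B c))"
    by (rule sum.reindex_bij_betw[OF bij, symmetric])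
  also have "\<dots> = (\<Sum>c<Suc m. - (?S $$ (0, c) * cofactor ?S 0 c))"
    by (intro sum.cong refl)
      (use c del pick_less[OF B(1)] B in \<open>auto simp: cofactor_def S M'_index\<close>)
  also have "\<dots> = - det ?S"
    using laplace_expansion_row[of ?S "Suc m" 0] by (simp add: S sum_negf)
  finally show ?thesis using 0 by simp
qed

section \<open>Left multiplication of \<open>W\<close> and the row space of \<open>V\<close>\<close>

lemma det_border_mat_mult:
  fixes W :: "'a::field mat"
  assumes G: "G \<in> carrier_mat m m" and W: "W \<in> carrier_mat m n"
    and A: "A \<subseteq> {..<n}" "Suc (card A) = m"
  shows "det (border_mat (\<lambda>s. \<Sum>t<m. G $$ (s, t) * a t) (G * W) A) = det G * det (border_mat a W A)"
proof -
  have "G * border_mat a W A = border_mat (\<lambda>s. \<Sum>t<m. G $$ (s, t) * a t) (G * W) A"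
    using G W A pick_less[OF A(1)]
    by (intro eq_matI) (auto simp: border_mat_def scalar_prod_def atLeast0LessThan)
  then show ?thesis
    using det_mult[OF G, of "border_mat a W A"] W by (auto simp: border_mat_def)
qed

text \<open>The bordering column is multiplied by \<open>G\<close> together with the matrix, so the
  coefficient vector \<open>a\<close> turns into \<open>G a\<close> and a factor
  \<open>det G\<close> appears. For invertible \<open>G\<close> the row space of \<open>V\<close> is
  therefore unchanged.\<close>

lemma V_matrix_mult:
  fixes W :: "'a::field mat"
  assumes G: "G \<in> carrier_mat m m" and W: "W \<in> carrier_mat m n"
    and A: "A \<subseteq> {..<n}" "Suc (card A) = m"
  shows "(\<Sum>s<m. (\<Sum>t<m. G $$ (s, t) * a t) * V_matrix (G * W) s A) =
    det G * (\<Sum>s<m. a s * V_matrix W s A)"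
  using det_border_mat[OF mult_carrier_mat[OF G W] A] det_border_mat[OF W A]
    det_border_mat_mult[OF assms] by metis

section \<open>The linear relations given by \<open>U\<close>\<close>

lemma nsets_iff: "J \<in> nsets {..<n} d \<longleftrightarrow> J \<subseteq> {..<n} \<and> card J = d" for J :: "nat set"
  unfolding nsets_def using finite_subset by blast

lemma finite_nsets_lessThan: "finite (nsets {..<n::nat} d)"
  by (rule finite_subset[of _ "Pow {..<n}"]) (auto simp: nsets_def)

text \<open>The sets \<open>insert i A\<close> with \<open>i\<close> outside \<open>A\<close> are
  distinct, so the description in the definition of \<open>U\<close> is unique and the row sum can
  be indexed by \<open>i\<close> itself.\<close>

lemma sum_U_matrix:
  assumes AB: "(A, B) \<in> U_rows d n"
  shows "(\<Sum>J\<in>nsets {..<n} d. p J * U_matrix W (A, B) J) =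
    (\<Sum>i\<in>B - A. p (insert i A) *
      ((-1) ^ (card ({..i} \<inter> A) + card ({..i} \<inter> B)) * det (submatrix W UNIV (B - {i}))))"
proof -
  have A: "A \<subseteq> {..<n}" "card A + 1 = d" and B: "B \<subseteq> {..<n}" "card B = d + 2"
    using AB by (auto simp: U_rows_def nsets_iff)
  have fA: "finite A" using A finite_subset by blast
  have inj: "inj_on (\<lambda>i. insert i A) (B - A)" by (auto simp: inj_on_def)
  have sub: "(\<lambda>i. insert i A) ` (B - A) \<subseteq> nsets {..<n} d" using A B fA by (auto simp: nsets_iff)
  have "(\<Sum>J\<in>nsets {..<n} d. p J * U_matrix W (A, B) J) =
      (\<Sum>J\<in>(\<lambda>i. insert i A) ` (B - A). p J * U_matrix W (A, B) J)"
    using sub by (intro sum.mono_neutral_right finite_nsets_lessThan) (auto simp: U_matrix_def)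
  also have "\<dots> = (\<Sum>i\<in>B - A. p (insert i A) * U_matrix W (A, B) (insert i A))"
    using sum.reindex[OF inj] by simp
  also have "\<dots> = (\<Sum>i\<in>B - A. p (insert i A) *
      ((-1) ^ (card ({..i} \<inter> A) + card ({..i} \<inter> B)) * det (submatrix W UNIV (B - {i}))))"
  proof (intro sum.cong refl)
    fix i assume i: "i \<in> B - A"
    then have "(THE j. j \<in> B - A \<and> insert i A = insert j A) = i"
      by (intro the_equality) auto
    moreover have "\<exists>j\<in>B - A. insert i A = insert j A" using i by auto
    ultimately show "p (insert i A) * U_matrix W (A, B) (insert i A) = p (insert i A) *
      ((-1) ^ (card ({..i} \<inter> A) + card ({..i} \<inter> B)) * det (submatrix W UNIV (B - {i})))"
      by (simp add: U_matrix_def Let_def)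
  qed
  finally show ?thesis .
qed

text \<open>The vector of signed minors of \<open>W\<close> on \<open>B\<close> is orthogonal to the
  rows of \<open>W\<close> by \<open>cramer_relation\<close>, hence to the rows of \<open>M\<close>.
  Expanding the minors of \<open>M\<close> along column \<open>i\<close> exhibits the sum as a
  combination of these vanishing products.\<close>

lemma minors_satisfy_U:
  fixes W M :: "'a::field mat"
  assumes W: "W \<in> carrier_mat (d + 1) n" and M: "M \<in> carrier_mat d n"
    and rows: "\<And>r j. r < d \<Longrightarrow> j < n \<Longrightarrow> M $$ (r, j) = (\<Sum>s<d + 1. b r s * W $$ (s, j))"
    and AB: "(A, B) \<in> U_rows d n"
  shows "(\<Sum>J\<in>nsets {..<n} d. det (submatrix M UNIV J) * U_matrix W (A, B) J) = 0"
proof -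
  have A: "A \<subseteq> {..<n}" "Suc (card A) = d" and B: "B \<subseteq> {..<n}" "card B = Suc (d + 1)"
    using AB by (auto simp: U_rows_def nsets_iff)
  have fB: "finite B" using B finite_subset by blast
  define g where "g = (\<lambda>i. (-1) ^ card ({..i} \<inter> B) * det (submatrix W UNIV (B - {i})))"
  have g: "(\<Sum>i\<in>B. g i * M $$ (r, i)) = 0" if "r < d" for r
  proof -
    have "(\<Sum>i\<in>B. g i * M $$ (r, i)) = (\<Sum>i\<in>B. g i * (\<Sum>s<d + 1. b r s * W $$ (s, i)))"
      using rows that B by (intro sum.cong) auto
    also have "\<dots> = (\<Sum>s<d + 1. b r s * (\<Sum>i\<in>B. g i * W $$ (s, i)))"
      unfolding sum_distrib_left by (subst sum.swap) (simp add: mult.left_commute)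
    also have "\<dots> = 0"
      using cramer_relation[OF W B] by (intro sum.neutral) (auto simp: g_def)
    finally show ?thesis .
  qed
  have "(\<Sum>J\<in>nsets {..<n} d. det (submatrix M UNIV J) * U_matrix W (A, B) J) =
    (\<Sum>i\<in>B - A. det (submatrix M UNIV (insert i A)) *
      ((-1) ^ (card ({..i} \<inter> A) + card ({..i} \<inter> B)) * det (submatrix W UNIV (B - {i}))))"
    by (rule sum_U_matrix[OF AB])
  also have "\<dots> = (\<Sum>i\<in>B - A. g i * (\<Sum>s<d. M $$ (s, i) * V_matrix M s A))"
  proof (intro sum.cong refl)
    fix i assume i: "i \<in> B - A"
    have "{..i} \<inter> A = {a \<in> A. a < i}" using i by (auto simp: order_le_less)
    moreover have "i < n" using i B by auto
    ultimately show "det (submatrix M UNIV (insert i A)) *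
      ((-1) ^ (card ({..i} \<inter> A) + card ({..i} \<inter> B)) * det (submatrix W UNIV (B - {i}))) =
      g i * (\<Sum>s<d. M $$ (s, i) * V_matrix M s A)"
      using V_matrix_cofactor[OF M A, of i] i by (simp add: g_def power_add)
  qed
  \<comment> \<open>The terms with \<open>i\<close> in \<open>A\<close> may be added because their
    cofactor sums vanish by \<open>V_matrix_cofactor\<close>.\<close>
  also have "\<dots> = (\<Sum>i\<in>B. g i * (\<Sum>s<d. M $$ (s, i) * V_matrix M s A))"
  proof (rule sum.mono_neutral_left[OF fB])
    show "\<forall>i\<in>B - (B - A). g i * (\<Sum>s<d. M $$ (s, i) * V_matrix M s A) = 0"
      using V_matrix_cofactor[OF M A] B by auto
  qed auto
  also have "\<dots> = (\<Sum>s<d. V_matrix M s A * (\<Sum>i\<in>B. g i * M $$ (s, i)))"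
    unfolding sum_distrib_left by (subst sum.swap) (simp add: mult_ac)
  also have "\<dots> = 0" using g by simp
  finally show ?thesis .
qed

lemma submatrix_delete_row:
  assumes W: "W \<in> carrier_mat (d + 1) n" and s: "s < d + 1" and J: "J \<in> nsets {..<n} d"
  shows "submatrix W (UNIV - {s}) J =
    submatrix (mat d n (\<lambda>(r, j). W $$ (if r < s then r else Suc r, j))) UNIV J"
proof -
  let ?M = "mat d n (\<lambda>(r, j). W $$ (if r < s then r else Suc r, j))"
  have "?M \<in> carrier_mat d n" by simp
  from submatrix_cols[OF this, of J] submatrix_del_row_cols[of W d n J s] show ?thesis
    using W s J pick_less[of J n] by (intro eq_matI) (auto simp: nsets_iff)
qed

text \<open>Up to a common sign, row \<open>s\<close> of \<open>V\<close> lists the maximal minors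
  of \<open>W\<close> with row \<open>s\<close> deleted, a matrix whose rows are rows of
  \<open>W\<close>.\<close>

lemma V_matrix_satisfies_U:
  fixes W :: "'a::field mat"
  assumes W: "W \<in> carrier_mat (d + 1) n" and s: "s < d + 1" and AB: "(A, B) \<in> U_rows d n"
  shows "(\<Sum>J\<in>nsets {..<n} d. V_matrix W s J * U_matrix W (A, B) J) = 0"
proof -
  let ?r = "\<lambda>r. if r < s then r else Suc r"
  define M where "M = mat d n (\<lambda>(r, j). W $$ (?r r, j))"
  have M: "M \<in> carrier_mat d n" by (simp add: M_def)
  have sub: "submatrix W (UNIV - {s}) J = submatrix M UNIV J" if "J \<in> nsets {..<n} d" for J
    unfolding M_def by (rule submatrix_delete_row[OF W s that])
  have "(\<Sum>J\<in>nsets {..<n} d. V_matrix W s J * U_matrix W (A, B) J) =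
      (\<Sum>J\<in>nsets {..<n} d. (-1) ^ s * (det (submatrix M UNIV J) * U_matrix W (A, B) J))"
    by (intro sum.cong refl) (simp add: V_matrix_def sub)
  also have "\<dots> = (-1) ^ s * (\<Sum>J\<in>nsets {..<n} d. det (submatrix M UNIV J) * U_matrix W (A, B) J)"
    by (simp add: sum_distrib_left)
  also have "\<dots> = 0"
  proof -
    have "M $$ (r, j) = (\<Sum>t<d + 1. (if t = ?r r then 1 else 0) * W $$ (t, j))"
      if "r < d" "j < n" for r j
    proof -
      have "(\<Sum>t<d + 1. (if t = ?r r then 1 else 0) * W $$ (t, j)) =
          (\<Sum>t\<in>{?r r}. (if t = ?r r then 1 else 0) * W $$ (t, j))"
        using that by (intro sum.mono_neutral_right) auto
      then show ?thesis using that by (simp add: M_def)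
    qed
    then show ?thesis using minors_satisfy_U[OF W M _ AB] by simp
  qed
  finally show ?thesis .
qed

lemma U_kernel:
  fixes W :: "'a::field mat"
  assumes W: "W \<in> carrier_mat (d + 1) n"
    and I: "I \<subseteq> {..<n}" "card I = d + 1" "det (submatrix W UNIV I) \<noteq> 0"
  shows "(\<forall>s\<in>U_rows d n. (\<Sum>J\<in>nsets {..<n} d. p J * U_matrix W s J) = 0) \<longleftrightarrow>
    (\<exists>a. \<forall>J\<in>nsets {..<n} d. p J = (\<Sum>r<d + 1. a r * V_matrix W r J))" (is "?L p \<longleftrightarrow> ?R")
proof
  have span: "?L (\<lambda>J. \<Sum>r<d + 1. a r * V_matrix W r J)" for a
  proof
    fix s assume "s \<in> U_rows d n"
    then obtain A B where s: "s = (A, B)" "(A, B) \<in> U_rows d n" by (cases s) auto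
    have "(\<Sum>J\<in>nsets {..<n} d. (\<Sum>r<d + 1. a r * V_matrix W r J) * U_matrix W s J) =
        (\<Sum>r<d + 1. a r * (\<Sum>J\<in>nsets {..<n} d. V_matrix W r J * U_matrix W s J))"
      unfolding sum_distrib_left sum_distrib_right by (subst sum.swap) (simp add: mult_ac)
    also have "\<dots> = 0" using V_matrix_satisfies_U[OF W _ s(2)] s(1) by (intro sum.neutral) auto
    finally show "(\<Sum>J\<in>nsets {..<n} d. (\<Sum>r<d + 1. a r * V_matrix W r J) * U_matrix W s J) = 0" .
  qed
  {
    assume ?R
    then obtain a where "\<forall>J\<in>nsets {..<n} d. p J = (\<Sum>r<d + 1. a r * V_matrix W r J)" by blast
    then show "?L p" using span[of a] by (simp cong: sum.cong)
  }
  assume L: "?L p"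
  have fI: "finite I" using I finite_subset by blast
  let ?q = "det (submatrix W UNIV I)"
  define e :: "nat \<Rightarrow> 'a" where "e = (\<lambda>k. (-1) ^ card {a \<in> I - {k}. a < k})"
  \<comment> \<open>For \<open>k\<close> and \<open>k'\<close> in \<open>I\<close>, column
    \<open>k'\<close> of \<open>W\<close> pairs with \<open>V\<close> at \<open>I - {k}\<close> to
    \<open>e k * ?q\<close> if \<open>k' = k\<close> and to 0 otherwise. Hence the combination with
    these coefficients agrees with \<open>p\<close> on all \<open>d\<close>-subsets of
    \<open>I\<close>.\<close>
  define a where "a = (\<lambda>r. \<Sum>k\<in>I. e k * p (I - {k}) * W $$ (r, k) / ?q)"
  define p' where "p' = (\<lambda>J. p J - (\<Sum>r<d + 1. a r * V_matrix W r J))"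
  have L': "?L p'" using L span[of a] by (simp add: p'_def left_diff_distrib sum_subtractf)
  have base: "p' (I - {k}) = 0" if k: "k \<in> I" for k
  proof -
    have J: "I - {k} \<subseteq> {..<n}" "Suc (card (I - {k})) = d + 1" using I k fI by auto
    have "(\<Sum>r<d + 1. a r * V_matrix W r (I - {k})) =
        (\<Sum>k'\<in>I. e k' * p (I - {k'}) / ?q * (\<Sum>r<d + 1. W $$ (r, k') * V_matrix W r (I - {k})))"
      unfolding a_def sum_distrib_right sum_distrib_left by (subst sum.swap) (simp add: mult_ac)
    also have "\<dots> = (\<Sum>k'\<in>{k}. e k' * p (I - {k'}) / ?q * (\<Sum>r<d + 1. W $$ (r, k') * V_matrix W r (I - {k})))"
    proof (rule sum.mono_neutral_right[OF fI])
      show "\<forall>k'\<in>I - {k}. e k' * p (I - {k'}) / ?q * (\<Sum>r<d + 1. W $$ (r, k') * V_matrix W r (I - {k})) = 0"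
        using V_matrix_cofactor[OF W J] I by auto
    qed (use k in auto)
    also have "\<dots> = e k * p (I - {k}) / ?q * (e k * ?q)"
    proof -
      have "(\<Sum>r<d + 1. W $$ (r, k) * V_matrix W r (I - {k})) = e k * ?q"
        using V_matrix_cofactor[OF W J, of k] k I by (subst V_matrix_cofactor[OF W J]) (auto simp: e_def insert_absorb)
      then show ?thesis by (simp only: sum.insert finite.emptyI empty_iff sum.empty add_0_right not_False_eq_True)
    qed
    also have "\<dots> = e k * e k * p (I - {k})" using I(3) by simp
    also have "e k * e k = 1" by (simp add: e_def flip: power_add)
    finally show ?thesis by (simp add: p'_def)
  qed
  have "p' J = 0" if "J \<in> nsets {..<n} d" for J
    using that
  proof (induction "card (J - I)" arbitrary: J)
    case 0
    have J: "J \<subseteq> {..<n}" "card J = d" using 0 by (auto simp: nsets_iff)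
    then have "finite J" using finite_subset by blast
    then have "J \<subseteq> I" using 0 by simp
    then have "card (I - J) = 1" using card_Diff_subset[OF \<open>finite J\<close>] I J by simp
    then obtain k where "I - J = {k}" by (auto simp: card_1_singleton_iff)
    then have "k \<in> I" "J = I - {k}" using \<open>J \<subseteq> I\<close> by auto
    then show ?case using base by simp
  next
    case (Suc m)
    have J: "J \<subseteq> {..<n}" "card J = d" using Suc.prems by (auto simp: nsets_iff)
    then have fJ: "finite J" using finite_subset by blast
    obtain j where j: "j \<in> J" "j \<notin> I" using Suc.hyps(2) by (metis Diff_eq_empty_iff card.empty nat.distinct(1) subsetI)
    define A where "A = J - {j}"
    define B where "B = insert j I"
    have "card A + 1 = d" using j J fJ unfolding A_def by (metis Suc_eq_plus1 card_Suc_Diff1)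
    moreover have "card B = d + 2" using j I fI by (simp add: B_def)
    ultimately have AB: "(A, B) \<in> U_rows d n"
      using j J I by (auto simp: U_rows_def nsets_iff A_def B_def)
    let ?t = "\<lambda>i. p' (insert i A) *
      ((-1) ^ (card ({..i} \<inter> A) + card ({..i} \<inter> B)) * det (submatrix W UNIV (B - {i})))"
    \<comment> \<open>For \<open>i\<close> other than \<open>j\<close>, \<open>insert i A\<close>
      trades \<open>j\<close> for an element of \<open>I\<close> and is covered by the induction
      hypothesis. The remaining term has coefficient \<open>?q\<close> up to sign, because
      \<open>B - {j} = I\<close>.\<close>
    have "0 = (\<Sum>i\<in>B - A. ?t i)" using L' AB sum_U_matrix[OF AB, of p' W] by simp
    also have "\<dots> = (\<Sum>i\<in>{j}. ?t i)"
    proof (rule sum.mono_neutral_right)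
      show "finite (B - A)" using fI by (simp add: B_def)
      show "{j} \<subseteq> B - A" by (auto simp: A_def B_def)
      show "\<forall>i\<in>B - A - {j}. ?t i = 0"
      proof
        fix i assume i: "i \<in> B - A - {j}"
        then have iI: "i \<in> I" "i \<notin> A" by (auto simp: B_def)
        have "insert i A - I = (J - I) - {j}" using iI by (auto simp: A_def)
        then have "m = card (insert i A - I)" using Suc.hyps(2) j fJ by simp
        moreover have "insert i A \<in> nsets {..<n} d"
          using \<open>card A + 1 = d\<close> iI I J fJ by (auto simp: nsets_iff A_def)
        ultimately have "p' (insert i A) = 0" by (rule Suc.hyps(1))
        then show "?t i = 0" by simp
      qed
    qed
    also have "\<dots> = p' J * ((-1) ^ (card ({..j} \<inter> A) + card ({..j} \<inter> B)) * ?q)"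
      using j by (simp add: A_def B_def insert_absorb)
    finally show ?case using I(3) by simp
  qed
  then show ?R by (intro exI[of _ a]) (simp add: p'_def)
qed

section \<open>Non-Archimedean valuations\<close>

locale valuation =
  fixes v :: "'a::field \<Rightarrow> ereal"
  assumes valuation: "nonarch_valuation v"
begin

text \<open>A real-valued version for arithmetic. It sends 0 to 0 by the convention for
  \<open>real_of_ereal \<infinity>\<close>, so bounds on terms that may vanish are stated with
  \<open>v\<close> instead.\<close>

definition rv :: "'a \<Rightarrow> real" where "rv x = real_of_ereal (v x)"

lemma v_eq: "x \<noteq> 0 \<Longrightarrow> v x = ereal (rv x)"
  using valuation unfolding nonarch_valuation_def rv_def by (cases "v x") auto

lemma v_zero: "v 0 = \<infinity>"
  using valuation by (simp add: nonarch_valuation_def)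

lemma rv_mult:
  assumes "x \<noteq> 0" "y \<noteq> 0"
  shows "rv (x * y) = rv x + rv y"
proof -
  have "v (x * y) = v x + v y" using valuation by (simp add: nonarch_valuation_def)
  then show ?thesis using assms v_eq by simp
qed

lemma rv_one: "rv 1 = 0"
  using rv_mult[of 1 1] by simp

lemma rv_inverse: "x \<noteq> 0 \<Longrightarrow> rv (inverse x) = - rv x"
  using rv_mult[of x "inverse x"] rv_one by simp

lemma rv_power: "x \<noteq> 0 \<Longrightarrow> rv (x ^ n) = real n * rv x"
  by (induction n) (auto simp: rv_one rv_mult algebra_simps)

lemma rv_power_int: "x \<noteq> 0 \<Longrightarrow> rv (x powi e) = of_int e * rv x"
  by (auto simp: power_int_def rv_power rv_inverse)

lemma rv_uminus: "x \<noteq> 0 \<Longrightarrow> rv (- x) = rv x"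
  using rv_mult[of "-1" x] rv_mult[of "-1" "-1"] rv_one by simp

lemma v_add: "min (v x) (v y) \<le> v (x + y)"
  using valuation by (simp add: nonarch_valuation_def)

section \<open>Valuations of sums\<close>

lemma v_sum_gt:
  assumes "\<And>i. i \<in> A \<Longrightarrow> ereal b < v (f i)"
  shows "ereal b < v (sum f A)"
  using assms
proof (induction A rule: infinite_finite_induct)
  case (insert x F)
  have "min (v (f x)) (v (sum f F)) \<le> v (f x + sum f F)" by (rule v_add)
  moreover have "ereal b < min (v (f x)) (v (sum f F))" using insert by simp
  ultimately have "ereal b < v (f x + sum f F)" by (rule less_le_trans[rotated])
  then show ?case using insert by simp
qed (auto simp: v_zero)

text \<open>If the valuation of \<open>x + y\<close> were larger than that of \<open>x\<close>, then
  \<open>x\<close>, written as \<open>x + y\<close> plus \<open>- y\<close>, would be a sum of two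
  terms of larger valuation.\<close>

lemma rv_add_dominant:
  assumes "x \<noteq> 0" "ereal (rv x) < v y"
  shows "x + y \<noteq> 0" "rv (x + y) = rv x"
proof -
  show nz: "x + y \<noteq> 0"
  proof
    assume "x + y = 0"
    then have "y = - x" by (simp add: eq_neg_iff_add_eq_0 add.commute)
    then show False using assms rv_uminus v_eq by simp
  qed
  have vmy: "ereal (rv x) < v (- y)"
    using assms rv_uminus v_eq by (cases "y = 0") (auto simp: v_zero)
  have "rv x \<le> rv (x + y)"
    using v_add[of x y] assms v_eq[OF nz] v_eq[OF assms(1)] by (auto simp: min_def split: if_splits)
  moreover have "rv (x + y) \<le> rv x"
  proof (rule ccontr)
    assume "\<not> ?thesis"
    then have "ereal (rv x) < min (v (x + y)) (v (- y))" using vmy v_eq[OF nz] by simp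
    also have "\<dots> \<le> v (x + y + - y)" by (rule v_add)
    finally show False using v_eq[OF assms(1)] by simp
  qed
  ultimately show "rv (x + y) = rv x" by simp
qed

lemma trivial_on_rv: "trivial_on v k \<Longrightarrow> x \<in> k \<Longrightarrow> x \<noteq> 0 \<Longrightarrow> rv x = 0"
  by (auto simp: trivial_on_def rv_def)

text \<open>Nonzero coefficients have valuation 0 and the exponents are distinct, so the nonzero
  terms have pairwise different valuations. The term of least exponent dominates, whatever the
  residue field.\<close>

lemma rv_sum_powers:
  assumes "finite E" "inj_on e E" and t: "t \<noteq> 0" "rv t > 0"
    and k: "trivial_on v k" "\<And>J. J \<in> E \<Longrightarrow> g J \<in> k" and "J0 \<in> E" "g J0 \<noteq> 0"
  obtains J where "J \<in> E" "g J \<noteq> 0" "e J \<le> e J0" "(\<Sum>J\<in>E. t powi e J * g J) \<noteq> 0"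
    "rv (\<Sum>J\<in>E. t powi e J * g J) = of_int (e J) * rv t"
proof -
  let ?S = "{J \<in> E. g J \<noteq> 0}"
  define J where "J = arg_min_on e ?S"
  have S: "finite ?S" "?S \<noteq> {}" using assms by auto
  have J: "J \<in> ?S" using arg_min_if_finite(1)[OF S, of e] by (simp add: J_def)
  have min: "e J \<le> e J'" if "J' \<in> ?S" for J'
    using arg_min_least[OF S that, of e] by (simp add: J_def)
  let ?x = "t powi e J * g J" and ?y = "\<Sum>J\<in>E - {J}. t powi e J * g J"
  have x: "?x \<noteq> 0" "rv ?x = of_int (e J) * rv t"
    using J t rv_mult rv_power_int trivial_on_rv[OF k(1) k(2)] by auto
  have "ereal (rv ?x) < v (t powi e J' * g J')" if J': "J' \<in> E - {J}" for J'
  proof (cases "g J' = 0")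
    case False
    then have "e J < e J'"
      using min[of J'] J' J assms(2) by (auto simp: order_le_less inj_on_def)
    moreover have "rv (t powi e J' * g J') = of_int (e J') * rv t"
      using False J' t rv_mult rv_power_int trivial_on_rv[OF k(1) k(2)] by auto
    ultimately show ?thesis using False t x v_eq[of "t powi e J' * g J'"] by simp
  qed (simp add: v_zero)
  then have y: "ereal (rv ?x) < v ?y" by (rule v_sum_gt)
  have "(\<Sum>J\<in>E. t powi e J * g J) = ?x + ?y" using J by (intro sum.remove assms(1)) simp
  then show ?thesis using that[of J] rv_add_dominant[OF x(1) y] J min[of J0] assms x by simp
qed

end

text \<open>Taking an \<open>m\<close>-th root divides the valuation by \<open>m\<close>, so a
  nontrivial value group contains arbitrarily small positive values.\<close>

lemma (in valuation) small_value:
  fixes \<epsilon> :: real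
  assumes "\<And>x n. n > 0 \<Longrightarrow> \<exists>y. y ^ n = (x :: 'a)" "\<not> trivial_on v UNIV" "\<epsilon> > 0"
  obtains t where "t \<noteq> 0" "0 < rv t" "rv t < \<epsilon>"
proof -
  obtain x where x: "x \<noteq> 0" "v x \<noteq> 0" using assms by (auto simp: trivial_on_def)
  then have "rv x \<noteq> 0" using v_eq by (auto simp: zero_ereal_def)
  then obtain y where y: "y \<noteq> 0" "0 < rv y"
    using x rv_inverse[of x] by (metis inverse_nonzero_iff_nonzero linorder_neqE_linordered_idom neg_0_less_iff_less)
  obtain m :: nat where m: "rv y / \<epsilon> < real m" using reals_Archimedean2 by blast
  moreover have "rv y / \<epsilon> > 0" using y assms by simp
  ultimately have "m > 0" by (metis not_gr_zero of_nat_0 order_less_asym)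
  then obtain t where t: "t ^ m = y" using assms(1) by blast
  then have "t \<noteq> 0" using y \<open>m > 0\<close> by auto
  then have "rv t = rv y / real m" using rv_power[of t m] t \<open>m > 0\<close> by (auto simp: field_simps)
  moreover have "rv y / real m < \<epsilon>" using m assms \<open>m > 0\<close> by (simp add: field_simps)
  ultimately show ?thesis using that[of t] \<open>t \<noteq> 0\<close> y \<open>m > 0\<close> by simp
qed

section \<open>Bergman fans\<close>

text \<open>The circuit description of the Bergman fan, that the maximum over each circuit is
  attained at least twice, rephrased with spanning sets. For \<open>S = {}\<close> it excludes
  loops, matching the demand that the empty set be a flat.\<close>

definition bergman_vector :: "'r set \<Rightarrow> 'e set \<Rightarrow> ('r \<Rightarrow> 'e \<Rightarrow> 'a::field) \<Rightarrow> ('e \<Rightarrow> real) \<Rightarrow> bool" where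
  "bergman_vector R E N u \<longleftrightarrow> (\<forall>x\<in>E. \<forall>S\<subseteq>E. in_span R N S x \<longrightarrow> (\<exists>y\<in>S. u x \<le> u y))"

text \<open>The members of the flag are the empty set and the sublevel sets of \<open>u\<close>.
  They are span-closed exactly when no element is spanned by elements of strictly smaller
  value.\<close>

lemma flag_of_flats_iff:
  assumes E: "finite E" "E \<noteq> {}"
  shows "(\<exists>Fs. flag_of E u Fs \<and> (\<forall>F\<in>set Fs. flat E (column_matroid R E N) F)) \<longleftrightarrow>
    bergman_vector R E N u"
proof
  assume "\<exists>Fs. flag_of E u Fs \<and> (\<forall>F\<in>set Fs. flat E (column_matroid R E N) F)"
  then obtain Fs where H: "flag_of E u Fs \<and> (\<forall>F\<in>set Fs. flat E (column_matroid R E N) F)" ..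
  then have flat: "\<forall>F\<in>set Fs. flat E (column_matroid R E N) F" ..
  have flag: "Fs \<noteq> [] \<and> hd Fs = {} \<and> last Fs = E \<and> sorted_wrt (\<subset>) Fs \<and>
      (\<forall>i\<in>E. \<forall>j\<in>E. u i < u j \<longleftrightarrow> (\<exists>F\<in>set Fs. i \<in> F \<and> j \<notin> F))"
    using H[THEN conjunct1] unfolding flag_of_def .
  note Fs = flag[THEN conjunct1] flag[THEN conjunct2, THEN conjunct1]
    flag[THEN conjunct2, THEN conjunct2, THEN conjunct2, THEN conjunct1]
    flag[THEN conjunct2, THEN conjunct2, THEN conjunct2, THEN conjunct2]
  show "bergman_vector R E N u"
    unfolding bergman_vector_def
  proof (intro ballI allI impI)
    fix x S assume x: "x \<in> E" and S: "S \<subseteq> E" "in_span R N S x"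
    show "\<exists>y\<in>S. u x \<le> u y"
    proof (rule ccontr)
      assume less: "\<not> ?thesis"
      \<comment> \<open>The last member of the flag missing \<open>x\<close>, which exists since the
        flag starts with the empty set. By monotonicity it contains every element of value smaller
        than \<open>u x\<close>.\<close>
      define i where "i = Max {i. i < length Fs \<and> x \<notin> Fs ! i}"
      have "0 \<in> {i. i < length Fs \<and> x \<notin> Fs ! i}" using Fs(1,2) by (auto simp: hd_conv_nth)
      then have "i \<in> {i. i < length Fs \<and> x \<notin> Fs ! i}" unfolding i_def by (intro Max_in) auto
      then have i: "i < length Fs" "x \<notin> Fs ! i" by auto
      have "S \<subseteq> Fs ! i"
      proof
        fix y assume "y \<in> S"
        then have "u y < u x" "y \<in> E" using less S(1) by (auto simp: not_le)
        then obtain F where "F \<in> set Fs" "y \<in> F" "x \<notin> F" using Fs(4) x by blast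
        then obtain j where j: "j < length Fs" "y \<in> Fs ! j" "x \<notin> Fs ! j" by (metis in_set_conv_nth)
        then have "j \<le> i" unfolding i_def by (intro Max_ge) auto
        then show "y \<in> Fs ! i"
          using sorted_wrt_nth_less[OF Fs(3), of j i] i j by (cases "j = i") auto
      qed
      moreover have F: "Fs ! i \<subseteq> E" "\<forall>x\<in>E - Fs ! i. \<not> in_span R N (Fs ! i) x"
        using flat nth_mem[OF i(1)] unfolding flat_column_matroid[OF E(1)] by auto
      ultimately have "in_span R N (Fs ! i) x"
        by (intro in_span_mono[OF S(2)] rev_finite_subset[OF E(1)])
      then show False using F(2) x i(2) by blast
    qed
  qed
next
  assume C: "bergman_vector R E N u"
  \<comment> \<open>The flag consists of the sublevel sets at the attained values, in increasing
    order, with the empty set in front.\<close>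
  define vs where "vs = sorted_list_of_set (u ` E)"
  define L where "L = (\<lambda>c. {J \<in> E. u J \<le> c})"
  define Fs where "Fs = {} # map L vs"
  have vs: "set vs = u ` E" "sorted_wrt (<) vs" "vs \<noteq> []" using E by (auto simp: vs_def)
  have "sorted_wrt (\<subset>) (map L vs)"
    unfolding sorted_wrt_map
  proof (rule sorted_wrt_mono_rel[OF _ vs(2)])
    fix x y assume "x \<in> set vs" "y \<in> set vs" "x < y"
    then obtain J where "J \<in> E" "u J = y" using vs by auto
    with \<open>x < y\<close> have "J \<in> L y - L x" by (auto simp: L_def)
    moreover have "L x \<subseteq> L y" using \<open>x < y\<close> by (auto simp: L_def)
    ultimately show "L x \<subset> L y" by blast
  qed
  moreover have "{} \<subset> L c" if "c \<in> set vs" for c using that vs by (auto simp: L_def)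
  ultimately have "sorted_wrt (\<subset>) Fs" by (auto simp: Fs_def)
  moreover have "last Fs = E"
  proof -
    have "u J \<le> last vs" if J: "J \<in> E" for J
    proof -
      obtain i where i: "i < length vs" "vs ! i = u J" using J vs(1) by (metis image_eqI in_set_conv_nth)
      then show ?thesis
        using sorted_wrt_nth_less[OF vs(2), of i "length vs - 1"] vs(3)
        by (cases "i = length vs - 1") (auto simp: last_conv_nth intro!: less_imp_le)
    qed
    then show ?thesis using vs(3) by (auto simp: Fs_def last_map L_def)
  qed
  moreover have "u i < u j \<longleftrightarrow> (\<exists>F\<in>set Fs. i \<in> F \<and> j \<notin> F)" if "i \<in> E" "j \<in> E" for i j
  proof
    assume "u i < u j"
    then have "L (u i) \<in> set Fs" "i \<in> L (u i)" "j \<notin> L (u i)"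
      using that vs(1) by (auto simp: Fs_def L_def)
    then show "\<exists>F\<in>set Fs. i \<in> F \<and> j \<notin> F" by blast
  qed (use that in \<open>auto simp: Fs_def L_def\<close>)
  ultimately have "flag_of E u Fs" by (simp add: flag_of_def Fs_def)
  moreover have "flat E (column_matroid R E N) F" if "F \<in> set Fs" for F
  proof -
    have F: "F \<subseteq> E" "\<And>x y. x \<in> E - F \<Longrightarrow> y \<in> F \<Longrightarrow> u y < u x"
      using that by (auto simp: Fs_def L_def)
    have "\<not> in_span R N F x" if x: "x \<in> E - F" for x
    proof
      assume "in_span R N F x"
      then obtain y where "y \<in> F" "u x \<le> u y" using C F(1) x unfolding bergman_vector_def by blast
      then show False using F(2)[OF x] by force
    qed
    then show ?thesis using F(1) flat_column_matroid[OF E(1)] by blast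
  qed
  ultimately show "\<exists>Fs. flag_of E u Fs \<and> (\<forall>F\<in>set Fs. flat E (column_matroid R E N) F)" by blast
qed

lemma bergman_fan_eq:
  assumes "finite E" "E \<noteq> {}"
  shows "bergman_fan E (column_matroid R E N) =
    trop_class E ` {u \<in> extensional E. bergman_vector R E N u}"
  unfolding bergman_fan_def flag_of_flats_iff[OF assms] by (simp add: PiE_def)

section \<open>Topology of the tropical torus\<close>

lemma trop_class_eqD:
  assumes "trop_class E u = trop_class E w" "w \<in> extensional E"
  obtains t where "\<And>J. J \<in> E \<Longrightarrow> w J = u J + t"
proof -
  have "w = (\<lambda>J\<in>E. w J + 0)" using assms(2) by (auto simp: extensional_def)
  then have "w \<in> trop_class E w" unfolding trop_class_def by blast
  then obtain t where "w = (\<lambda>J\<in>E. u J + t)" using assms(1) unfolding trop_class_def by blast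
  then show ?thesis using that[of t] by simp
qed

lemma trop_class_cong:
  assumes "\<And>J. J \<in> E \<Longrightarrow> u J = w J"
  shows "trop_class E u = trop_class E w"
proof -
  have "(\<lambda>J\<in>E. u J + t) = (\<lambda>J\<in>E. w J + t)" for t using assms by auto
  then show ?thesis by (simp add: trop_class_def)
qed

lemma bergman_vector_shift:
  assumes t: "\<And>J. J \<in> E \<Longrightarrow> w J = u J + t"
  shows "bergman_vector R E N u \<longleftrightarrow> bergman_vector R E N w"
  unfolding bergman_vector_def
proof (intro ball_cong all_cong refl arg_cong2[where f = "(\<longrightarrow>)"] bex_cong)
  fix x S y assume "x \<in> E" "S \<subseteq> E" "y \<in> S"
  then show "u x \<le> u y \<longleftrightarrow> w x \<le> w y" using t by (simp add: subset_iff)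
qed

text \<open>In the quotient topology it suffices that the preimage is closed. Each \<open>x\<close>
  and each set spanning it contribute a finite union of closed half-spaces, and these unions are
  intersected.\<close>

lemma closedin_bergman_fan:
  assumes E: "finite E" "E \<noteq> {}"
  shows "closedin (trop_torus_topology E) (bergman_fan E (column_matroid R E N))"
proof -
  let ?T = "powertop_real E" and ?B = "bergman_fan E (column_matroid R E N)"
  have quot: "quotient_map ?T (trop_torus_topology E) (trop_class E)"
    unfolding trop_torus_topology_def by (rule quotient_map_quotient_topology)
  have top: "topspace ?T = extensional E" by (simp add: PiE_def)
  have pre: "{u \<in> topspace ?T. trop_class E u \<in> ?B} = {u \<in> topspace ?T. bergman_vector R E N u}"
  proof (intro Collect_cong conj_cong refl iffI)
    fix u assume u: "u \<in> topspace ?T" "trop_class E u \<in> ?B"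
    then obtain w where w: "w \<in> extensional E" "bergman_vector R E N w" "trop_class E u = trop_class E w"
      unfolding bergman_fan_eq[OF E] by blast
    obtain t where "\<And>J. J \<in> E \<Longrightarrow> w J = u J + t" using trop_class_eqD[OF w(3,1)] by blast
    then show "bergman_vector R E N u" using bergman_vector_shift w(2) by blast
  next
    fix u assume "u \<in> topspace ?T" "bergman_vector R E N u"
    then show "trop_class E u \<in> ?B" unfolding bergman_fan_eq[OF E] top by blast
  qed
  have proj: "continuous_map ?T euclideanreal (\<lambda>u. u x)" if "x \<in> E" for x
    using that by (rule continuous_map_product_projection)
  have half: "closedin ?T {u \<in> topspace ?T. u x \<le> u y}" if "x \<in> E" "y \<in> E" for x y
  proof -
    have "continuous_map ?T euclideanreal (\<lambda>u. u x - u y)"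
      using proj that by (intro continuous_map_diff) auto
    then have "closedin ?T {u \<in> topspace ?T. u x - u y \<in> {..0}}"
      by (rule closedin_continuous_map_preimage) (simp flip: closed_closedin)
    then show ?thesis by simp
  qed
  have "{u \<in> topspace ?T. bergman_vector R E N u} =
      topspace ?T \<inter> (\<Inter>x\<in>E. \<Inter>S\<in>{S. S \<subseteq> E \<and> in_span R N S x}. \<Union>y\<in>S. {u \<in> topspace ?T. u x \<le> u y})"
    unfolding bergman_vector_def by auto
  \<comment> \<open>The whole space is inserted so that the intersected family is visibly
    nonempty.\<close>
  also have "\<dots> = (\<Inter>C\<in>insert (topspace ?T) ((\<lambda>(x, S). \<Union>y\<in>S. {u \<in> topspace ?T. u x \<le> u y}) `
      (SIGMA x:E. {S. S \<subseteq> E \<and> in_span R N S x})). C)"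
    by auto
  also have "closedin ?T \<dots>"
  proof (rule closedin_Inter)
    fix C assume "C \<in> (\<lambda>C. C) ` insert (topspace ?T) ((\<lambda>(x, S). \<Union>y\<in>S. {u \<in> topspace ?T. u x \<le> u y}) `
      (SIGMA x:E. {S. S \<subseteq> E \<and> in_span R N S x}))"
    then consider "C = topspace ?T" | x S where "x \<in> E" "S \<subseteq> E"
      "C = (\<Union>y\<in>S. {u \<in> topspace ?T. u x \<le> u y})" by auto
    then show "closedin ?T C"
    proof cases
      case 1
      then show ?thesis by (simp only: closedin_topspace)
    next
      case 2
      then have "finite S" using E(1) by (auto intro: rev_finite_subset)
      then show ?thesis unfolding 2(3)
        using half 2(1,2) by (intro closedin_Union) auto
    qed
  qed auto
  finally have "closedin ?T {u \<in> topspace ?T. trop_class E u \<in> ?B}" unfolding pre .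
  moreover have "?B \<subseteq> topspace (trop_torus_topology E)"
    unfolding bergman_fan_eq[OF E] trop_torus_topology_def topspace_quotient_topology top by blast
  ultimately show ?thesis using quot unfolding quotient_map_closedin by blast
qed

text \<open>Approximation in each coordinate gives a sequence converging in the product topology,
  and the class map is continuous. Members of \<open>S\<close> may fail to be extensional, so they
  are restricted to \<open>E\<close>, which leaves their classes unchanged.\<close>

lemma trop_class_in_closure:
  assumes u: "u \<in> extensional E"
    and approx: "\<And>\<epsilon>. \<epsilon> > 0 \<Longrightarrow> \<exists>w\<in>S. \<forall>J\<in>E. \<bar>w J - u J\<bar> < \<epsilon>"
  shows "trop_class E u \<in> trop_torus_topology E closure_of (trop_class E ` S)"
proof -
  let ?T = "powertop_real E"
  have "\<exists>w\<in>S. \<forall>J\<in>E. \<bar>w J - u J\<bar> < inverse (real (Suc m))" for m by (rule approx) simp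
  then obtain w where w: "\<And>m. w m \<in> S" "\<And>m J. J \<in> E \<Longrightarrow> \<bar>w m J - u J\<bar> < inverse (real (Suc m))"
    by metis
  define w' where "w' = (\<lambda>m. restrict (w m) E)"
  have "limitin ?T w' u sequentially"
    unfolding limitin_componentwise
  proof (intro conjI ballI)
    fix J assume J: "J \<in> E"
    have "(\<lambda>m. w m J) \<longlonglongrightarrow> u J"
    proof (rule LIMSEQ_I)
      fix r :: real assume "r > 0"
      then obtain N where N: "inverse (real (Suc N)) < r" using reals_Archimedean by blast
      have "norm (w m J - u J) < r" if "m \<ge> N" for m
      proof -
        have "inverse (real (Suc m)) \<le> inverse (real (Suc N))" using that by (simp add: field_simps)
        then show ?thesis using w(2)[OF J, of m] N unfolding real_norm_def by linarith
      qed
      then show "\<exists>N. \<forall>m\<ge>N. norm (w m J - u J) < r" by blast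
    qed
    then show "limitin euclideanreal (\<lambda>m. w' m J) (u J) sequentially" using J by (simp add: w'_def)
  qed (use u in \<open>auto simp: w'_def\<close>)
  then have lim: "u \<in> topspace ?T"
    "\<And>U. openin ?T U \<Longrightarrow> u \<in> U \<Longrightarrow> eventually (\<lambda>m. w' m \<in> U) sequentially"
    by (auto simp: limitin_def)
  have "u \<in> ?T closure_of range w'"
    unfolding in_closure_of
  proof (intro conjI allI impI lim(1))
    fix U assume "u \<in> U \<and> openin ?T U"
    then have "eventually (\<lambda>m. w' m \<in> U) sequentially" using lim(2) by blast
    then obtain m where "w' m \<in> U" by (auto simp: eventually_sequentially)
    then show "\<exists>y. y \<in> range w' \<and> y \<in> U" by blast
  qed
  moreover have "continuous_map ?T (trop_torus_topology E) (trop_class E)"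
    unfolding trop_torus_topology_def
    by (rule quotient_imp_continuous_map[OF quotient_map_quotient_topology])
  ultimately have "trop_class E u \<in> trop_torus_topology E closure_of (trop_class E ` range w')"
    using continuous_map_image_closure_subset by blast
  moreover have "trop_class E ` range w' \<subseteq> trop_class E ` S"
  proof
    fix c assume "c \<in> trop_class E ` range w'"
    then obtain m where "c = trop_class E (w' m)" by blast
    also have "\<dots> = trop_class E (w m)" by (rule trop_class_cong) (simp add: w'_def)
    finally show "c \<in> trop_class E ` S" using w(1) by blast
  qed
  ultimately show ?thesis by (rule rev_subsetD[OF _ closure_of_mono])
qed

section \<open>Tropicalization of a constant-coefficient linear space\<close>

locale trivially_valued_subfield = valuation v + field_subset k
  for v :: "'a::field \<Rightarrow> ereal" and k :: "'a set" +
  assumes trivial: "trivial_on v k"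
begin

text \<open>If \<open>x\<close> is spanned by \<open>S\<close>, the relation can be chosen over
  \<open>k\<close>, with coefficients zero or of valuation 0. By the ultrametric inequality the
  valuation of \<open>p x\<close> is then at least the least valuation occurring on
  \<open>S\<close>.\<close>

lemma bergman_vector_neg_rv:
  fixes N :: "'r \<Rightarrow> 'e \<Rightarrow> 'a"
  assumes E: "finite E" and R: "finite R" and N: "\<And>r J. r \<in> R \<Longrightarrow> J \<in> E \<Longrightarrow> N r J \<in> k"
    and p: "\<And>J. J \<in> E \<Longrightarrow> p J = (\<Sum>r\<in>R. a r * N r J)" "\<And>J. J \<in> E \<Longrightarrow> p J \<noteq> 0"
  shows "bergman_vector R E N (\<lambda>J. - rv (p J))"
  unfolding bergman_vector_def
proof (intro ballI allI impI)
  fix x S assume x: "x \<in> E" and S: "S \<subseteq> E" "in_span R N S x"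
  have fS: "finite S" using E S(1) by (rule rev_finite_subset)
  show "\<exists>y\<in>S. - rv (p x) \<le> - rv (p y)"
  proof (cases "x \<in> S")
    case False
    obtain b where b: "\<forall>r\<in>R. N r x = (\<Sum>J\<in>S. b J * N r J)" using S(2) by (auto simp: in_span_def)
    \<comment> \<open>A functional separating \<open>x\<close> from \<open>S\<close> contradicts the
      relation over the large field, so \<open>linear_alternative\<close> yields coefficients in
      \<open>k\<close>.\<close>
    have "\<not> (\<forall>J\<in>insert x S. (\<Sum>r\<in>R. f r * N r J) = (if J = x then 1 else 0))" for f
    proof
      assume f: "\<forall>J\<in>insert x S. (\<Sum>r\<in>R. f r * N r J) = (if J = x then 1 else 0)"
      have "(1::'a) = (\<Sum>r\<in>R. f r * N r x)" using f by simp
      also have "\<dots> = (\<Sum>r\<in>R. f r * (\<Sum>J\<in>S. b J * N r J))" using b by simp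
      also have "\<dots> = (\<Sum>J\<in>S. b J * (\<Sum>r\<in>R. f r * N r J))"
        unfolding sum_distrib_left by (subst sum.swap) (simp add: mult.left_commute)
      also have "\<dots> = 0" using f False by (intro sum.neutral) auto
      finally show False by simp
    qed
    moreover have "N r J \<in> k" if "r \<in> R" "J \<in> insert x S" for r J using N that x S(1) by blast
    ultimately obtain c where c: "\<forall>J. c J \<in> k" "c x = 1"
      "\<forall>r\<in>R. (\<Sum>J\<in>insert x S. c J * N r J) = 0"
      using linear_alternative[OF R, of "insert x S" x N] fS by blast
    have "(\<Sum>J\<in>insert x S. c J * p J) = (\<Sum>J\<in>insert x S. c J * (\<Sum>r\<in>R. a r * N r J))"
      using p(1) x S(1) by (intro sum.cong) auto
    also have "\<dots> = (\<Sum>r\<in>R. a r * (\<Sum>J\<in>insert x S. c J * N r J))"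
      unfolding sum_distrib_left by (subst sum.swap) (simp add: mult.left_commute)
    also have "\<dots> = 0" using c(3) by simp
    finally have "p x + (\<Sum>J\<in>S. c J * p J) = 0" using c(2) fS False by simp
    then have px: "p x = (\<Sum>J\<in>S. - c J * p J)" by (simp add: sum_negf eq_neg_iff_add_eq_0)
    show ?thesis
    proof (rule ccontr)
      assume less: "\<not> ?thesis"
      have "ereal (rv (p x)) < v (- c J * p J)" if J: "J \<in> S" for J
      proof (cases "c J = 0")
        case False
        have pJ: "p J \<noteq> 0" using p(2) J S(1) by auto
        have "rv (- c J * p J) = rv (p J)"
          using rv_mult[of "- c J" "p J"] False pJ c(1) rv_uminus trivial_on_rv[OF trivial] by simp
        moreover have "rv (p x) < rv (p J)" using less J by force
        ultimately show ?thesis using v_eq[of "- c J * p J"] False pJ by simp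
      qed (simp add: v_zero)
      then have "ereal (rv (p x)) < v (\<Sum>J\<in>S. - c J * p J)" by (rule v_sum_gt)
      then show False unfolding px[symmetric] using v_eq p(2) x by simp
    qed
  qed auto
qed

lemma bergman_vector_approx:
  fixes N :: "'r \<Rightarrow> 'e \<Rightarrow> 'a" and \<epsilon> :: real
  assumes E: "finite E" and R: "finite R" and N: "\<And>r J. r \<in> R \<Longrightarrow> J \<in> E \<Longrightarrow> N r J \<in> k"
    and roots: "\<And>x n. n > 0 \<Longrightarrow> \<exists>y. y ^ n = (x :: 'a)" and nontriv: "\<not> trivial_on v UNIV"
    and u: "bergman_vector R E N u" and "\<epsilon> > 0"
  obtains a where "\<And>J. J \<in> E \<Longrightarrow> (\<Sum>r\<in>R. a r * N r J) \<noteq> 0"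
    "\<And>J. J \<in> E \<Longrightarrow> \<bar>- rv (\<Sum>r\<in>R. a r * N r J) - u J\<bar> < \<epsilon>"
proof (cases "E = {}")
  case True
  then show ?thesis using that by blast
next
  case False
  \<comment> \<open>A functional over \<open>k\<close>, normalised at \<open>J\<close> and zero on
    the strict sublevel set. The other case of \<open>linear_alternative\<close> would put
    \<open>J\<close> in the span of that set, against the Bergman condition.\<close>
  have "\<exists>f. (\<forall>r. f r \<in> k) \<and> (\<Sum>r\<in>R. f r * N r J) = 1 \<and>
      (\<forall>J'\<in>E. u J' < u J \<longrightarrow> (\<Sum>r\<in>R. f r * N r J') = 0)" if J: "J \<in> E" for J
  proof -
    let ?S = "{J' \<in> E. u J' < u J}"
    have fS: "finite ?S" "?S \<subseteq> E" using E by auto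
    have "\<not> (c J = 1 \<and> (\<forall>r\<in>R. (\<Sum>J'\<in>insert J ?S. c J' * N r J') = 0))" for c
    proof
      assume c: "c J = 1 \<and> (\<forall>r\<in>R. (\<Sum>J'\<in>insert J ?S. c J' * N r J') = 0)"
      then have "c J = 1" ..
      with c have "\<forall>r\<in>R. N r J = (\<Sum>J'\<in>?S. - c J' * N r J')"
        using fS(1) by (simp add: sum_negf eq_neg_iff_add_eq_0)
      then have "in_span R N ?S J" unfolding in_span_def by (rule exI[of _ "\<lambda>J'. - c J'"])
      then have "\<exists>y\<in>?S. u J \<le> u y" using u J fS(2) unfolding bergman_vector_def by blast
      then show False by auto
    qed
    moreover have "N r J' \<in> k" if "r \<in> R" "J' \<in> insert J ?S" for r J' using N that J by blast
    ultimately obtain f where "\<forall>r. f r \<in> k"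
      "\<forall>J'\<in>insert J ?S. (\<Sum>r\<in>R. f r * N r J') = (if J' = J then 1 else 0)"
      using linear_alternative[OF R, of "insert J ?S" J N] fS(1) by blast
    then show ?thesis by (intro exI[of _ f]) auto
  qed
  then have "\<exists>f. \<forall>J\<in>E. (\<forall>r. f J r \<in> k) \<and> (\<Sum>r\<in>R. f J r * N r J) = 1 \<and>
      (\<forall>J'\<in>E. u J' < u J \<longrightarrow> (\<Sum>r\<in>R. f J r * N r J') = 0)"
    by (intro bchoice ballI)
  then obtain f where f: "\<And>J r. J \<in> E \<Longrightarrow> f J r \<in> k"
    "\<And>J. J \<in> E \<Longrightarrow> (\<Sum>r\<in>R. f J r * N r J) = 1"
    "\<And>J J'. J \<in> E \<Longrightarrow> J' \<in> E \<Longrightarrow> u J' < u J \<Longrightarrow> (\<Sum>r\<in>R. f J r * N r J') = 0"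
    by blast
  define m where "m = card E"
  have m: "m > 0" using E False by (simp add: m_def card_gt_0_iff)
  obtain h where h: "bij_betw h E {0..<m}" using ex_bij_betw_finite_nat[OF E] m_def by blast
  then have h': "inj_on h E" "\<And>J. J \<in> E \<Longrightarrow> h J < m" by (auto simp: bij_betw_def)
  \<comment> \<open>The exponents below reproduce \<open>- u\<close> only up to an error of
    \<open>m\<close> times the valuation of \<open>t\<close>, whence the bound
    \<open>\<epsilon> / real m\<close>.\<close>
  obtain t where t: "t \<noteq> 0" "0 < rv t" "rv t < \<epsilon> / real m"
    using small_value[OF roots nontriv, of "\<epsilon> / real m"] \<open>\<epsilon> > 0\<close> m by auto
  define \<delta> where "\<delta> = rv t"
  have \<delta>: "\<delta> > 0" "real m * \<delta> < \<epsilon>" using t m by (auto simp: \<delta>_def field_simps)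
  \<comment> \<open>Multiples of \<open>m\<close> shifted by the numbering \<open>h\<close>, so that distinct indices get distinct exponents.\<close>
  define e where "e = (\<lambda>J. int m * \<lfloor>- u J / (real m * \<delta>)\<rfloor> + int (h J))"
  have e_inj: "inj_on e E"
  proof (rule inj_onI)
    fix x y assume xy: "x \<in> E" "y \<in> E" "e x = e y"
    have "e z mod int m = int (h z)" if "z \<in> E" for z using h'(2)[OF that] by (simp add: e_def)
    then have "h x = h y" using xy by (metis of_nat_eq_iff)
    then show "x = y" using h'(1) xy by (simp add: inj_on_def)
  qed
  have e_bounds: "- u J - real m * \<delta> < of_int (e J) * \<delta>" "of_int (e J) * \<delta> < - u J + real m * \<delta>"
    if J: "J \<in> E" for J
  proof -
    let ?z = "- u J / (real m * \<delta>)"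
    have z: "?z * (real m * \<delta>) = - u J" using m \<delta> by simp
    have pos: "real m * \<delta> > 0" using m \<delta> by simp
    have "(?z - 1) * (real m * \<delta>) < of_int \<lfloor>?z\<rfloor> * (real m * \<delta>)"
      using pos by (intro mult_strict_right_mono) linarith+
    then have 1: "- u J - real m * \<delta> < of_int \<lfloor>?z\<rfloor> * (real m * \<delta>)" using z by (simp add: left_diff_distrib)
    have "of_int \<lfloor>?z\<rfloor> * (real m * \<delta>) \<le> ?z * (real m * \<delta>)"
      using pos by (intro mult_right_mono) linarith+
    then have 2: "of_int \<lfloor>?z\<rfloor> * (real m * \<delta>) \<le> - u J" using z by simp
    have 3: "of_int (e J) * \<delta> = of_int \<lfloor>?z\<rfloor> * (real m * \<delta>) + real (h J) * \<delta>"
      by (simp add: e_def algebra_simps)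
    have "0 \<le> real (h J) * \<delta>" "real (h J) * \<delta> < real m * \<delta>" using h'(2)[OF J] \<delta> by auto
    with 1 2 3 show "- u J - real m * \<delta> < of_int (e J) * \<delta>" "of_int (e J) * \<delta> < - u J + real m * \<delta>"
      by linarith+
  qed
  define a where "a = (\<lambda>r. \<Sum>J\<in>E. t powi e J * f J r)"
  have "(\<Sum>r\<in>R. a r * N r J') \<noteq> 0 \<and> \<bar>- rv (\<Sum>r\<in>R. a r * N r J') - u J'\<bar> < \<epsilon>" if J': "J' \<in> E" for J'
  proof -
    let ?g = "\<lambda>J. \<Sum>r\<in>R. f J r * N r J'"
    have eq: "(\<Sum>r\<in>R. a r * N r J') = (\<Sum>J\<in>E. t powi e J * ?g J)"
      unfolding a_def sum_distrib_right sum_distrib_left by (subst sum.swap) (simp add: mult.assoc)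
    have g: "?g J \<in> k" if "J \<in> E" for J using that f(1) N J' by (intro sum_closed mult_closed)
    have g0: "?g J' \<noteq> 0" using f(2)[OF J'] by simp
    note powers = rv_sum_powers[where g = "?g", OF E e_inj t(1,2) trivial g J' g0]
    obtain J where J: "J \<in> E" "?g J \<noteq> 0" "e J \<le> e J'" "(\<Sum>J\<in>E. t powi e J * ?g J) \<noteq> 0"
      "rv (\<Sum>J\<in>E. t powi e J * ?g J) = of_int (e J) * rv t"
      by (rule powers)
    \<comment> \<open>Since \<open>?g J\<close> is nonzero, \<open>u J \<le> u J'\<close>, which
      bounds the valuation from below; \<open>e J \<le> e J'\<close> bounds it from above. Both
      bounds are within \<open>real m * \<delta>\<close> of \<open>- u J'\<close>.\<close>
    have "u J \<le> u J'" using f(3)[OF J(1) J'] J(2) by force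
    moreover have "of_int (e J) * \<delta> \<le> of_int (e J') * \<delta>" using J(3) \<delta> by simp
    ultimately show ?thesis
      using e_bounds[OF J(1)] e_bounds[OF J'] J(4,5) \<delta>(2) unfolding eq \<delta>_def[symmetric] by linarith
  qed
  then show ?thesis using that by blast
qed

text \<open>Tropicalization only sees points with all coordinates nonzero, so \<open>Y'\<close> asks
  only for row space vectors of that kind. One inclusion uses that the Bergman fan is closed, the
  other the approximation of its vectors.\<close>

theorem tropicalization_linear_space:
  fixes N :: "'r \<Rightarrow> 'e \<Rightarrow> 'a"
  assumes E: "finite E" "E \<noteq> {}" and R: "finite R" and N: "\<And>r J. r \<in> R \<Longrightarrow> J \<in> E \<Longrightarrow> N r J \<in> k"
    and roots: "\<And>x n. n > 0 \<Longrightarrow> \<exists>y. y ^ n = (x :: 'a)" and nontriv: "\<not> trivial_on v UNIV"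
    and Y: "\<And>P p. P \<in> Y \<Longrightarrow> p \<in> P \<Longrightarrow> \<exists>a. \<forall>J\<in>E. p J = (\<Sum>r\<in>R. a r * N r J)"
    and Y': "\<And>a. (\<And>J. J \<in> E \<Longrightarrow> (\<Sum>r\<in>R. a r * N r J) \<noteq> 0) \<Longrightarrow>
      \<exists>P\<in>Y. \<exists>p\<in>P. \<forall>J\<in>E. p J = (\<Sum>r\<in>R. a r * N r J)"
  shows "tropicalization v E Y = bergman_fan E (column_matroid R E N)"
proof -
  let ?S = "{\<lambda>J. - rv (p J) | p P. P \<in> Y \<and> p \<in> P \<and> (\<forall>J\<in>E. p J \<noteq> 0)}"
  have "{trop_class E (\<lambda>J. - real_of_ereal (v (p J))) | p P. P \<in> Y \<and> p \<in> P \<and> (\<forall>J\<in>E. p J \<noteq> 0)} =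
      trop_class E ` ?S" (is "?L = ?R")
  proof (intro equalityI subsetI)
    fix c assume "c \<in> ?L"
    then obtain p P where c: "c = trop_class E (\<lambda>J. - rv (p J))" and p: "P \<in> Y" "p \<in> P" "\<forall>J\<in>E. p J \<noteq> 0"
      unfolding rv_def by blast
    from p have "(\<lambda>J. - rv (p J)) \<in> ?S" by blast
    then show "c \<in> ?R" unfolding c by (rule imageI)
  next
    fix c assume "c \<in> ?R"
    then obtain p P where "c = trop_class E (\<lambda>J. - rv (p J))" "P \<in> Y" "p \<in> P" "\<forall>J\<in>E. p J \<noteq> 0"
      by blast
    then show "c \<in> ?L" unfolding rv_def by blast
  qed
  then have trop: "tropicalization v E Y = trop_torus_topology E closure_of (trop_class E ` ?S)"
    unfolding tropicalization_def by (rule arg_cong)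
  have "tropicalization v E Y \<subseteq> bergman_fan E (column_matroid R E N)"
    unfolding trop
  proof (rule closure_of_minimal[OF _ closedin_bergman_fan[OF E]], rule image_subsetI)
    fix w assume "w \<in> ?S"
    then obtain p P where w: "w = (\<lambda>J. - rv (p J))" and p: "P \<in> Y" "p \<in> P" "\<forall>J\<in>E. p J \<noteq> 0" by blast
    obtain a where "\<forall>J\<in>E. p J = (\<Sum>r\<in>R. a r * N r J)" using Y[OF p(1,2)] by blast
    then have "bergman_vector R E N w"
      unfolding w using N p(3) by (intro bergman_vector_neg_rv[OF E(1) R, of N p a]) auto
    then have "bergman_vector R E N (restrict w E)"
      using bergman_vector_shift[of E "restrict w E" w 0 R N] by simp
    then have "trop_class E (restrict w E) \<in> bergman_fan E (column_matroid R E N)"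
      unfolding bergman_fan_eq[OF E] by (intro imageI CollectI conjI restrict_extensional)
    moreover have "trop_class E w = trop_class E (restrict w E)" by (rule trop_class_cong) simp
    ultimately show "trop_class E w \<in> bergman_fan E (column_matroid R E N)" by (rule back_subst[OF _ sym])
  qed
  moreover have "bergman_fan E (column_matroid R E N) \<subseteq> tropicalization v E Y"
    unfolding bergman_fan_eq[OF E] trop
  proof (rule image_subsetI)
    fix u assume "u \<in> {u \<in> extensional E. bergman_vector R E N u}"
    then have u: "u \<in> extensional E" "bergman_vector R E N u" by auto
    show "trop_class E u \<in> trop_torus_topology E closure_of (trop_class E ` ?S)"
    proof (rule trop_class_in_closure[OF u(1)])
      fix \<epsilon> :: real assume "\<epsilon> > 0"
      then obtain a where a: "\<And>J. J \<in> E \<Longrightarrow> (\<Sum>r\<in>R. a r * N r J) \<noteq> 0"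
        "\<And>J. J \<in> E \<Longrightarrow> \<bar>- rv (\<Sum>r\<in>R. a r * N r J) - u J\<bar> < \<epsilon>"
        using bergman_vector_approx[where N = N, OF E(1) R N roots nontriv u(2)] by metis
      obtain P p where p: "P \<in> Y" "p \<in> P" "\<forall>J\<in>E. p J = (\<Sum>r\<in>R. a r * N r J)"
        using Y'[OF a(1)] by blast
      have "\<forall>J\<in>E. p J \<noteq> 0" using p(3) a(1) by simp
      with p(1,2) have "(\<lambda>J. - rv (p J)) \<in> ?S" by blast
      moreover have "\<forall>J\<in>E. \<bar>- rv (p J) - u J\<bar> < \<epsilon>" using p(3) a(2) by simp
      ultimately show "\<exists>w\<in>?S. \<forall>J\<in>E. \<bar>w J - u J\<bar> < \<epsilon>" by (rule bexI[where x = "\<lambda>J. - rv (p J)", rotated])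
    qed
  qed
  ultimately show ?thesis by (rule equalityI)
qed

end

section \<open>Spans and dimensions\<close>

text \<open>Spans are taken of sets of vectors, whereas the matroids concern families that may
  repeat. Coefficients are placed at one chosen preimage of each vector in one direction and summed
  over fibres in the other.\<close>

lemma span_image:
  fixes f :: "'e \<Rightarrow> 'a::field vec"
  assumes S: "finite S" and f: "\<And>J. J \<in> S \<Longrightarrow> f J \<in> carrier_vec n"
  shows "vec_span n (f ` S) = {vec n (\<lambda>i. \<Sum>J\<in>S. c J * f J $ i) | c. True}"
proof -
  interpret vec_space "TYPE('a)" n .
  have fS: "f ` S \<subseteq> carrier_vec n" "finite (f ` S)" using S f by auto
  have span: "span (f ` S) = {lincomb a (f ` S) | a. a \<in> f ` S \<rightarrow> carrier class_ring}"
    using finite_span[OF fS(2)] fS(1) by simp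
  show ?thesis
  proof (intro equalityI subsetI)
    fix x assume "x \<in> vec_span n (f ` S)"
    then obtain a where x: "x = lincomb a (f ` S)" unfolding span by blast
    define g where "g = inv_into S f"
    define c where "c = (\<lambda>J. if J \<in> g ` f ` S then a (f J) else 0)"
    have g: "g ` f ` S \<subseteq> S" by (auto simp: g_def inv_into_into)
    have inj: "inj_on g (f ` S)" unfolding g_def by (rule inj_on_inv_into) auto
    have "(\<Sum>J\<in>S. c J * f J $ i) = (\<Sum>y\<in>f ` S. a y * y $ i)" for i
    proof -
      have "(\<Sum>J\<in>S. c J * f J $ i) = (\<Sum>J\<in>g ` f ` S. a (f J) * f J $ i)"
        using S g by (intro sum.mono_neutral_cong_right) (auto simp: c_def)
      also have "\<dots> = (\<Sum>y\<in>f ` S. a (f (g y)) * f (g y) $ i)"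
        by (simp add: sum.reindex[OF inj])
      also have "\<dots> = (\<Sum>y\<in>f ` S. a y * y $ i)"
        by (intro sum.cong refl) (simp add: g_def f_inv_into_f)
      finally show ?thesis .
    qed
    then have "x = vec n (\<lambda>i. \<Sum>J\<in>S. c J * f J $ i)"
      unfolding x using lincomb_dim[OF fS(2,1)] lincomb_index[OF _ fS(1)] by (intro eq_vecI) auto
    then show "x \<in> {vec n (\<lambda>i. \<Sum>J\<in>S. c J * f J $ i) | c. True}" by blast
  next
    fix x assume "x \<in> {vec n (\<lambda>i. \<Sum>J\<in>S. c J * f J $ i) | c. True}"
    then obtain c where x: "x = vec n (\<lambda>i. \<Sum>J\<in>S. c J * f J $ i)" by blast
    define a where "a = (\<lambda>y. \<Sum>J\<in>{J \<in> S. f J = y}. c J)"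
    have "(\<Sum>J\<in>S. c J * f J $ i) = (\<Sum>y\<in>f ` S. a y * y $ i)" for i
      unfolding sum.image_gen[OF S, of _ f] a_def sum_distrib_right by (intro sum.cong refl) auto
    then have "x = lincomb a (f ` S)"
      unfolding x using lincomb_dim[OF fS(2,1)] lincomb_index[OF _ fS(1)] by (intro eq_vecI) auto
    then show "x \<in> vec_span n (f ` S)" unfolding span by auto
  qed
qed

text \<open>Full dimension forces \<open>f\<close> to be injective, because the image contains a
  basis of its span; conversely, two equal members of the family would form a relation. For
  injective \<open>f\<close> independence of the family and of its image coincide.\<close>

lemma dim_span_image:
  fixes f :: "'e \<Rightarrow> 'a::field vec"
  assumes S: "finite S" and f: "\<And>J. J \<in> S \<Longrightarrow> f J \<in> carrier_vec n"
  shows "subspace_dim n (vec_span n (f ` S)) = card S \<longleftrightarrow>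
    S \<in> column_matroid {..<n} S (\<lambda>i J. f J $ i)"
proof -
  interpret vec_space "TYPE('a)" n .
  let ?A = "f ` S"
  have A: "?A \<subseteq> carrier_vec n" "finite ?A" using S f by auto
  have lc: "lincomb a ?A = 0\<^sub>v n \<longleftrightarrow> (\<forall>i<n. (\<Sum>y\<in>?A. a y * y $ i) = 0)" for a
  proof
    assume "lincomb a ?A = 0\<^sub>v n"
    then show "\<forall>i<n. (\<Sum>y\<in>?A. a y * y $ i) = 0" using lincomb_index[OF _ A(1), of _ a] by auto
  next
    assume "\<forall>i<n. (\<Sum>y\<in>?A. a y * y $ i) = 0"
    then show "lincomb a ?A = 0\<^sub>v n"
      using lincomb_dim[OF A(2,1)] lincomb_index[OF _ A(1)] by (intro eq_vecI) auto
  qed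
  show ?thesis
  proof
    assume dim: "subspace_dim n (span ?A) = card S"
    have "\<exists>U. finite U \<and> maximal U (\<lambda>T. T \<subseteq> ?A \<and> lin_indpt T)"
    proof (rule maximal_exists)
      show "finite T \<and> card T \<le> card ?A" if "T \<subseteq> ?A \<and> lin_indpt T" for T
        using that A(2) by (auto intro: card_mono rev_finite_subset)
      show "{} \<subseteq> ?A \<and> lin_indpt {}" by (simp add: lin_dep_def)
    qed
    then obtain U where U: "maximal U (\<lambda>T. T \<subseteq> ?A \<and> lin_indpt T)" by blast
    then have "subspace_dim n (span ?A) = card U" "U \<subseteq> ?A"
      using dim_span[OF _ A(2) U] A(1) by (auto simp: maximal_def)
    then have "card S \<le> card ?A" using dim card_mono[OF A(2), of U] by simp
    then have cardA: "card ?A = card S" using card_image_le[OF S, of f] by simp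
    then have inj: "inj_on f S" using S by (rule eq_card_imp_inj_on[rotated])
    have "lin_indpt ?A" using full_dim_span[OF _ A(2)] A(1) dim cardA by simp
    show "S \<in> column_matroid {..<n} S (\<lambda>i J. f J $ i)"
    proof (rule column_matroidI)
      fix c J assume c: "\<forall>i\<in>{..<n}. (\<Sum>J\<in>S. c J * f J $ i) = 0" and J: "J \<in> S"
      define a where "a = (\<lambda>y. c (inv_into S f y))"
      have "(\<Sum>y\<in>?A. a y * y $ i) = (\<Sum>J\<in>S. c J * f J $ i)" for i
        using inj by (simp add: sum.reindex a_def)
      then have "lincomb a ?A = 0\<^sub>v n" unfolding lc using c by simp
      then have "a \<in> ?A \<rightarrow> {0}"
        using not_lindepD[OF \<open>lin_indpt ?A\<close> A(2) subset_refl, of a] by (auto simp: module_vec_simps)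
      then have "a (f J) = 0" using J by blast
      then show "c J = 0" using inv_into_f_f[OF inj J] by (simp add: a_def)
    qed simp
  next
    assume ind: "S \<in> column_matroid {..<n} S (\<lambda>i J. f J $ i)"
    have inj: "inj_on f S"
    proof (rule inj_onI, rule ccontr)
      fix x y assume xy: "x \<in> S" "y \<in> S" "f x = f y" "x \<noteq> y"
      define c :: "'e \<Rightarrow> 'a" where "c = (\<lambda>J. if J = x then 1 else if J = y then -1 else 0)"
      have "(\<Sum>J\<in>S. c J * f J $ i) = 0" for i
      proof -
        have "(\<Sum>J\<in>S. c J * f J $ i) = (\<Sum>J\<in>{x, y}. c J * f J $ i)"
          using xy S by (intro sum.mono_neutral_right) (auto simp: c_def)
        also have "\<dots> = c x * f x $ i + c y * f y $ i" using xy(4) by simp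
        also have "\<dots> = 0" unfolding xy(3) using xy(4) by (simp add: c_def)
        finally show ?thesis .
      qed
      then have "c x = 0" using column_matroidD[OF ind _ xy(1)] by blast
      then show False by (simp add: c_def)
    qed
    have "lin_indpt ?A"
    proof
      assume "lin_dep ?A"
      then obtain a v where a: "lincomb a ?A = 0\<^sub>v n" "v \<in> ?A" "a v \<noteq> 0"
        using finite_lin_dep[OF A(2)] A(1) by (auto simp: module_vec_simps)
      then have "\<forall>i\<in>{..<n}. (\<Sum>J\<in>S. a (f J) * f J $ i) = 0"
        using lc[of a] inj by (auto simp: sum.reindex)
      then have "a (f J) = 0" if "J \<in> S" for J
        using column_matroidD[OF ind, of "\<lambda>J. a (f J)"] that by blast
      then show False using a(2,3) by blast
    qed
    then have "maximal ?A (\<lambda>T. T \<subseteq> ?A \<and> lin_indpt T)" unfolding maximal_def by blast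
    then have "subspace_dim n (span ?A) = card ?A" using dim_span[OF _ A(2)] A(1) by simp
    then show "subspace_dim n (span ?A) = card S" using card_image[OF inj] by simp
  qed
qed

text \<open>To extract a basis, finite-dimensionality of \<open>Y\<close> is derived first:
  independent sets in \<open>Y\<close> are independent in the ambient space, so its dimension bounds
  their size.\<close>

lemma subspace_dim_1:
  fixes Y :: "'a::field vec set"
  assumes Y: "VectorSpace.subspace class_ring Y (module_vec TYPE('a) n)" and dim: "subspace_dim n Y = 1"
  obtains x where "x \<in> carrier_vec n" "Y = vec_span n {x}"
proof -
  interpret vec_space "TYPE('a)" n .
  interpret Y: vectorspace class_ring "vs Y" using Y by (rule subspace_is_vs)
  have sub: "submodule class_ring Y V" using Y by (simp add: subspace_def)
  then have YV: "Y \<subseteq> carrier_vec n" by (auto simp: submodule_def module_vec_simps)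
  have li: "Y.lin_indpt T \<longleftrightarrow> lin_indpt T" if "T \<subseteq> Y" for T using span_li_not_depend(2)[OF that sub] by simp
  have "\<exists>A. finite A \<and> maximal A (\<lambda>T. T \<subseteq> carrier (vs Y) \<and> Y.lin_indpt T)"
  proof (rule maximal_exists)
    show "finite T \<and> card T \<le> dim" if "T \<subseteq> carrier (vs Y) \<and> Y.lin_indpt T" for T
    proof -
      have "T \<subseteq> carrier V" "lin_indpt T" using that li YV by (auto simp: module_vec_simps)
      then show ?thesis using li_le_dim[OF fin_dim] by simp
    qed
    show "{} \<subseteq> carrier (vs Y) \<and> Y.lin_indpt {}" by (simp add: Y.lin_dep_def)
  qed
  then obtain A where "finite A \<and> maximal A (\<lambda>T. T \<subseteq> carrier (vs Y) \<and> Y.lin_indpt T)" ..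
  then have A: "finite A" "maximal A (\<lambda>T. T \<subseteq> carrier (vs Y) \<and> Y.lin_indpt T)" by (blast, blast)
  then have "Y.gen_set A" by (intro Y.max_li_is_gen)
  moreover have "A \<subseteq> carrier (vs Y)" using A(2) by (simp add: maximal_def)
  ultimately have "Y.fin_dim" using A(1) unfolding Y.fin_dim_def by blast
  then obtain b where b: "finite b" "Y.basis b" using Y.finite_basis_exists by blast
  then have "card b = 1" using Y.dim_basis dim by simp
  then obtain x where x: "b = {x}" by (auto simp: card_1_singleton_iff)
  have "x \<in> Y" "Y.span {x} = Y" using b(2) unfolding x Y.basis_def by auto
  moreover have "Y.span {x} = span {x}"
    using span_li_not_depend(1)[of "{x}" Y] \<open>x \<in> Y\<close> sub by simp
  ultimately have "Y = span {x}" by simp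
  moreover have "x \<in> carrier_vec n" using YV \<open>x \<in> Y\<close> by blast
  ultimately show ?thesis by (rule that[rotated])
qed

section \<open>Row spaces, singular matrices and nonzero maximal minors\<close>

lemma row_space_combinations:
  fixes W :: "'a::field mat"
  assumes W: "W \<in> carrier_mat m n"
  shows "vec_space.row_space n W = {vec n (\<lambda>j. \<Sum>r<m. a r * W $$ (r, j)) | a. True}"
proof -
  have "set (rows W) = row W ` {..<m}" using W by (auto simp: rows_def)
  then have "vec_space.row_space n W = vec_span n (row W ` {..<m})"
    by (simp add: vec_space.row_space_def)
  also have "\<dots> = {vec n (\<lambda>j. \<Sum>r<m. a r * row W r $ j) | a. True}"
    using W by (intro span_image) auto
  also have "\<dots> = {vec n (\<lambda>j. \<Sum>r<m. a r * W $$ (r, j)) | a. True}"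
  proof -
    have "vec n (\<lambda>j. \<Sum>r<m. a r * row W r $ j) = vec n (\<lambda>j. \<Sum>r<m. a r * W $$ (r, j))" for a
      using W by (intro eq_vecI) auto
    then show ?thesis by simp
  qed
  finally show ?thesis .
qed

lemma dim_row_space:
  fixes W :: "'a::field mat"
  assumes W: "W \<in> carrier_mat m n"
  shows "subspace_dim n (vec_space.row_space n W) = m \<longleftrightarrow>
    (\<forall>c. (\<forall>j<n. (\<Sum>r<m. c r * W $$ (r, j)) = 0) \<longrightarrow> (\<forall>r<m. c r = 0))"
proof -
  have "set (rows W) = row W ` {..<m}" using W by (auto simp: rows_def)
  then have "vec_space.row_space n W = vec_span n (row W ` {..<m})"
    by (simp add: vec_space.row_space_def)
  then have "subspace_dim n (vec_space.row_space n W) = m \<longleftrightarrow>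
      {..<m} \<in> column_matroid {..<n} {..<m} (\<lambda>j r. row W r $ j)"
    using dim_span_image[of "{..<m}" "row W" n] W by simp
  also have "\<dots> \<longleftrightarrow> (\<forall>c. (\<forall>j<n. (\<Sum>r<m. c r * row W r $ j) = 0) \<longrightarrow> (\<forall>r<m. c r = 0))"
    by (simp add: column_matroid_def Ball_def)
  also have "\<dots> \<longleftrightarrow> (\<forall>c. (\<forall>j<n. (\<Sum>r<m. c r * W $$ (r, j)) = 0) \<longrightarrow> (\<forall>r<m. c r = 0))"
  proof -
    have "(\<Sum>r<m. c r * row W r $ j) = (\<Sum>r<m. c r * W $$ (r, j))" if "j < n" for c j
      using W that by (intro sum.cong) auto
    then show ?thesis by simp
  qed
  finally show ?thesis .
qed

lemma det_eq_0_iff_row_combination: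
  fixes T :: "'a::field mat"
  assumes T: "T \<in> carrier_mat m m"
  shows "det T = 0 \<longleftrightarrow> (\<exists>b. (\<exists>s<m. b s \<noteq> 0) \<and> (\<forall>c<m. (\<Sum>s<m. b s * T $$ (s, c)) = 0))"
proof -
  have "det T = 0 \<longleftrightarrow> (\<exists>v. v \<in> carrier_vec m \<and> v \<noteq> 0\<^sub>v m \<and> T\<^sup>T *\<^sub>v v = 0\<^sub>v m)"
    using det_0_iff_vec_prod_zero_field[of "T\<^sup>T" m] T det_transpose[OF T] by simp
  also have "\<dots> \<longleftrightarrow> (\<exists>b. (\<exists>s<m. b s \<noteq> 0) \<and> (\<forall>c<m. (\<Sum>s<m. b s * T $$ (s, c)) = 0))"
  proof
    assume "\<exists>v. v \<in> carrier_vec m \<and> v \<noteq> 0\<^sub>v m \<and> T\<^sup>T *\<^sub>v v = 0\<^sub>v m"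
    then obtain v where v: "v \<in> carrier_vec m" "v \<noteq> 0\<^sub>v m" "T\<^sup>T *\<^sub>v v = 0\<^sub>v m" by blast
    have "\<exists>s<m. v $ s \<noteq> 0" using v(1,2) by (metis eq_vecI index_zero_vec carrier_vecD)
    moreover have "(\<Sum>s<m. v $ s * T $$ (s, c)) = 0" if "c < m" for c
    proof -
      have "0 = (T\<^sup>T *\<^sub>v v) $ c" using v(3) that by simp
      also have "\<dots> = (\<Sum>s<m. v $ s * T $$ (s, c))"
        using that T v(1) by (auto simp: scalar_prod_def atLeast0LessThan mult.commute intro!: sum.cong)
      finally show ?thesis by simp
    qed
    ultimately show "\<exists>b. (\<exists>s<m. b s \<noteq> 0) \<and> (\<forall>c<m. (\<Sum>s<m. b s * T $$ (s, c)) = 0)" by blast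
  next
    assume "\<exists>b. (\<exists>s<m. b s \<noteq> 0) \<and> (\<forall>c<m. (\<Sum>s<m. b s * T $$ (s, c)) = 0)"
    then obtain b s where b: "s < m" "b s \<noteq> 0" "\<forall>c<m. (\<Sum>s<m. b s * T $$ (s, c)) = 0" by blast
    have "vec m b \<noteq> 0\<^sub>v m" using b(1,2) by (metis index_vec index_zero_vec(1))
    moreover have "T\<^sup>T *\<^sub>v vec m b = 0\<^sub>v m"
      using T b(3) by (intro eq_vecI) (auto simp: scalar_prod_def atLeast0LessThan mult.commute)
    ultimately show "\<exists>v. v \<in> carrier_vec m \<and> v \<noteq> 0\<^sub>v m \<and> T\<^sup>T *\<^sub>v v = 0\<^sub>v m"
      by (intro exI[of _ "vec m b"]) simp
  qed
  finally show ?thesis .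
qed

lemma det_nonzero_inverse:
  fixes T :: "'a::field mat"
  assumes T: "T \<in> carrier_mat m m" and "det T \<noteq> 0"
  obtains G where "G \<in> carrier_mat m m" "G * T = 1\<^sub>m m" "T * G = 1\<^sub>m m"
  using det_non_zero_imp_unit[OF assms, of "()"] by (auto simp: Units_def ring_mat_def)

lemma pick_surj:
  assumes "finite I" "i \<in> I"
  obtains c where "c < card I" "pick I c = i"
proof -
  have "card {a \<in> I. a < i} < card I" using assms by (intro psubset_card_mono) auto
  then show ?thesis using that pick_card_in_set[OF assms(2)] by blast
qed

text \<open>A largest independent set \<open>I\<close> of columns spans all columns, so row
  combinations vanishing on \<open>I\<close> vanish everywhere and are trivial. Counting unknowns
  both ways gives \<open>card I = m\<close>, and the minor on \<open>I\<close> is then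
  nonzero.\<close>

lemma exists_nonzero_minor:
  fixes W :: "'a::field mat"
  assumes W: "W \<in> carrier_mat m n"
    and indep: "\<forall>c. (\<forall>j<n. (\<Sum>r<m. c r * W $$ (r, j)) = 0) \<longrightarrow> (\<forall>r<m. c r = 0)"
  obtains I where "I \<subseteq> {..<n}" "card I = m" "det (submatrix W UNIV I) \<noteq> 0"
proof -
  let ?M = "\<lambda>r j. W $$ (r, j)"
  let ?C = "column_matroid {..<m} {..<n} ?M"
  have mat: "matroid {..<n} ?C" by (rule matroid_column_matroid) simp
  obtain I where I: "I \<in> ?C" "I \<subseteq> {..<n}" "\<And>T. T \<in> ?C \<Longrightarrow> T \<subseteq> {..<n} \<Longrightarrow> card T \<le> card I"
    using matroid_rank_attained[OF mat subset_refl] by metis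
  have fI: "finite I" using column_matroid_finite[OF I(1)] by simp
  have span: "in_span {..<m} ?M I j" if "j < n" for j
  proof (cases "j \<in> I")
    case False
    show ?thesis
    proof (rule ccontr)
      assume "\<not> in_span {..<m} ?M I j"
      then have "insert j I \<in> ?C" using insert_in_column_matroid[OF I(1), of j] False that by simp
      then have "card (insert j I) \<le> card I" using I(2,3) that by auto
      then show False using False fI by simp
    qed
  qed (simp add: fI in_span_self)
  have vanish: "\<forall>r<m. c r = 0" if c: "\<forall>i\<in>I. (\<Sum>r<m. c r * W $$ (r, i)) = 0" for c
  proof -
    have "(\<Sum>r<m. c r * W $$ (r, j)) = 0" if j: "j < n" for j
    proof -
      obtain b where b: "\<forall>r\<in>{..<m}. W $$ (r, j) = (\<Sum>i\<in>I. b i * W $$ (r, i))"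
        using span[OF j] unfolding in_span_def by blast
      have "(\<Sum>r<m. c r * W $$ (r, j)) = (\<Sum>r<m. c r * (\<Sum>i\<in>I. b i * W $$ (r, i)))" using b by simp
      also have "\<dots> = (\<Sum>i\<in>I. b i * (\<Sum>r<m. c r * W $$ (r, i)))"
        unfolding sum_distrib_left by (subst sum.swap) (simp add: mult.left_commute)
      also have "\<dots> = 0" using c by simp
      finally show ?thesis .
    qed
    then show ?thesis using indep by blast
  qed
  have "card I \<le> m"
  proof (rule ccontr)
    assume "\<not> card I \<le> m"
    then obtain c where "\<exists>J\<in>I. c J \<noteq> 0" "\<forall>r\<in>{..<m}. (\<Sum>J\<in>I. c J * ?M r J) = 0"
      using underdetermined_system[of "{..<m}" I ?M] fI by auto
    then show False using column_matroidD[OF I(1)] by blast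
  qed
  moreover have "m \<le> card I"
  proof (rule ccontr)
    assume "\<not> m \<le> card I"
    then obtain c where c: "\<exists>r\<in>{..<m}. c r \<noteq> 0" "\<forall>i\<in>I. (\<Sum>r<m. c r * ?M r i) = 0"
      using underdetermined_system[of I "{..<m}" "\<lambda>i r. ?M r i"] fI by auto
    then show False using vanish[OF c(2)] by blast
  qed
  ultimately have card: "card I = m" by simp
  have T: "submatrix W UNIV I = mat m m (\<lambda>(r, c). W $$ (r, pick I c))"
    using submatrix_cols[OF W I(2)] card by simp
  have "det (submatrix W UNIV I) \<noteq> 0"
  proof
    assume "det (submatrix W UNIV I) = 0"
    then obtain b where b: "\<exists>s<m. b s \<noteq> 0" "\<forall>c<m. (\<Sum>s<m. b s * submatrix W UNIV I $$ (s, c)) = 0"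
      using det_eq_0_iff_row_combination[of "submatrix W UNIV I" m] by (auto simp: T)
    have "(\<Sum>r<m. b r * W $$ (r, i)) = 0" if "i \<in> I" for i
    proof -
      obtain c where c: "c < card I" "pick I c = i" using pick_surj[OF fI \<open>i \<in> I\<close>] .
      then have "(\<Sum>s<m. b s * submatrix W UNIV I $$ (s, c)) = 0" using b(2) card by blast
      then show ?thesis using c card by (simp add: T)
    qed
    then show False using vanish[of b] b(1) by blast
  qed
  then show ?thesis using that I(2) card by blast
qed

section \<open>The matroid of lines\<close>

lemma span_singleton:
  fixes y :: "'a::field vec"
  assumes y: "y \<in> carrier_vec n"
  shows "vec_span n {y} = {c \<cdot>\<^sub>v y | c. True}"
proof -
  have "vec_span n ((\<lambda>_::unit. y) ` {()}) = {vec n (\<lambda>i. \<Sum>J\<in>{()}. c J * y $ i) | c. True}"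
    by (rule span_image) (use y in auto)
  also have "\<dots> = {c \<cdot>\<^sub>v y | c. True}"
  proof (intro equalityI subsetI)
    fix x assume "x \<in> {vec n (\<lambda>i. \<Sum>J\<in>{()}. c J * y $ i) | c. True}"
    then obtain c :: "unit \<Rightarrow> 'a" where "x = vec n (\<lambda>i. c () * y $ i)" by auto
    then have "x = c () \<cdot>\<^sub>v y" using y by (intro eq_vecI) auto
    then show "x \<in> {c \<cdot>\<^sub>v y | c. True}" by blast
  next
    fix x assume "x \<in> {c \<cdot>\<^sub>v y | c. True}"
    then obtain c where "x = c \<cdot>\<^sub>v y" by blast
    then have "x = vec n (\<lambda>i. \<Sum>J\<in>{()}. (\<lambda>_. c) J * y $ i)" using y by (intro eq_vecI) auto
    then show "x \<in> {vec n (\<lambda>i. \<Sum>J\<in>{()}. c J * y $ i) | c. True}"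
      by (intro CollectI exI[of _ "\<lambda>_. c"] conjI TrueI)
  qed
  finally show ?thesis by simp
qed

lemma dim_span_singleton:
  fixes y :: "'a::field vec"
  assumes y: "y \<in> carrier_vec n"
  shows "subspace_dim n (vec_span n {y}) = 1 \<longleftrightarrow> y \<noteq> 0\<^sub>v n"
proof -
  have "subspace_dim n (vec_span n ((\<lambda>_::unit. y) ` {()})) = card {()} \<longleftrightarrow>
      {()} \<in> column_matroid {..<n} {()} (\<lambda>i J. y $ i)"
    by (rule dim_span_image) (use y in auto)
  also have "\<dots> \<longleftrightarrow> (\<exists>i<n. y $ i \<noteq> 0)"
  proof
    assume ind: "{()} \<in> column_matroid {..<n} {()} (\<lambda>i J. y $ i)"
    show "\<exists>i<n. y $ i \<noteq> 0"
    proof (rule ccontr)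
      assume "\<not> ?thesis"
      then have "\<forall>i\<in>{..<n}. (\<Sum>J\<in>{()}. (\<lambda>_. 1) J * y $ i) = 0" by auto
      then have "(1::'a) = 0" using column_matroidD[OF ind, of "\<lambda>_. 1" "()"] by simp
      then show False by simp
    qed
  next
    assume "\<exists>i<n. y $ i \<noteq> 0"
    then show "{()} \<in> column_matroid {..<n} {()} (\<lambda>i J. y $ i)"
      by (intro column_matroidI) auto
  qed
  also have "\<dots> \<longleftrightarrow> y \<noteq> 0\<^sub>v n" using y by (metis eq_vecI index_zero_vec carrier_vecD)
  finally show ?thesis by simp
qed

text \<open>Up to sign the entry is a minor, and it equals the determinant of the columns
  \<open>J\<close> bordered by the \<open>r\<close>-th unit vector. It detects whether the
  hyperplanes indexed by \<open>J\<close> meet the hyperplane \<open>b r = 0\<close>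
  nontrivially.\<close>

lemma V_matrix_eq_0_iff:
  fixes W :: "'a::field mat"
  assumes W: "W \<in> carrier_mat m n" and J: "J \<subseteq> {..<n}" "Suc (card J) = m" and r: "r < m"
  shows "V_matrix W r J = 0 \<longleftrightarrow>
    (\<exists>b. (\<exists>s<m. b s \<noteq> 0) \<and> b r = 0 \<and> (\<forall>k\<in>J. (\<Sum>s<m. b s * W $$ (s, k)) = 0))"
proof -
  have fJ: "finite J" using J(1) by (rule rev_finite_subset[rotated]) simp
  let ?e = "\<lambda>s. if s = r then 1 else (0::'a)"
  let ?B = "border_mat ?e W J"
  have B: "?B \<in> carrier_mat m m" using W by (auto simp: border_mat_def)
  have delta: "(\<Sum>s<m. g s * ?e s) = g r" for g :: "nat \<Rightarrow> 'a"
  proof -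
    have "(\<Sum>s<m. g s * ?e s) = (\<Sum>s\<in>{r}. g s * ?e s)"
      using r by (intro sum.mono_neutral_right) auto
    then show ?thesis by simp
  qed
  have "V_matrix W r J = det ?B"
    using det_border_mat[OF W J, of ?e] delta[of "\<lambda>s. V_matrix W s J"] by (simp add: mult.commute)
  moreover have "(\<forall>c<m. (\<Sum>s<m. b s * ?B $$ (s, c)) = 0) \<longleftrightarrow>
      b r = 0 \<and> (\<forall>k\<in>J. (\<Sum>s<m. b s * W $$ (s, k)) = 0)" for b
  proof (intro iffI conjI ballI allI impI)
    have col0: "(\<Sum>s<m. b s * ?B $$ (s, 0)) = b r"
    proof -
      have "(\<Sum>s<m. b s * ?B $$ (s, 0)) = (\<Sum>s<m. b s * ?e s)"
        using W J(2) by (intro sum.cong) (auto simp: border_mat_def)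
      then show ?thesis using delta by simp
    qed
    have colS: "(\<Sum>s<m. b s * ?B $$ (s, Suc c)) = (\<Sum>s<m. b s * W $$ (s, pick J c))" if "c < card J" for c
      using W J(2) that by (intro sum.cong) (auto simp: border_mat_def)
    {
      assume *: "\<forall>c<m. (\<Sum>s<m. b s * ?B $$ (s, c)) = 0"
      have "0 < m" using J(2) by simp
      from *[rule_format, OF this] show "b r = 0" unfolding col0 .
      fix k assume "k \<in> J"
      then obtain c where c: "c < card J" "pick J c = k" using pick_surj[OF fJ] by blast
      then have "Suc c < m" using J(2) by simp
      then show "(\<Sum>s<m. b s * W $$ (s, k)) = 0"
        using *[rule_format, of "Suc c"] colS[OF c(1)] c(2) by simp
    next
      assume *: "b r = 0 \<and> (\<forall>k\<in>J. (\<Sum>s<m. b s * W $$ (s, k)) = 0)"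
      fix c assume c: "c < m"
      show "(\<Sum>s<m. b s * ?B $$ (s, c)) = 0"
      proof (cases c)
        case 0
        then show ?thesis using col0 * by simp
      next
        case (Suc c')
        then have c': "c' < card J" using c J(2) by simp
        then have "pick J c' \<in> J" by (rule pick_in_set_le)
        then show ?thesis using colS[OF c'] * Suc by simp
      qed
    }
  qed
  ultimately show ?thesis using det_eq_0_iff_row_combination[OF B] by simp
qed

text \<open>Column \<open>J\<close> of \<open>V\<close> transported to \<open>X\<close> by the
  parametrisation through the rows of \<open>W\<close>. By \<open>V_matrix_cofactor\<close> it
  vanishes in all coordinates from \<open>J\<close>.\<close>

definition line_vector :: "'a::field mat \<Rightarrow> nat \<Rightarrow> nat \<Rightarrow> nat set \<Rightarrow> 'a vec" where
  "line_vector W m n J = vec n (\<lambda>j. \<Sum>r<m. V_matrix W r J * W $$ (r, j))"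

lemma line_vector_dim: "line_vector W m n J \<in> carrier_vec n"
  by (simp add: line_vector_def)

text \<open>If column \<open>J\<close> of \<open>V\<close> is nonzero at \<open>r\<close>, a point
  of the intersection is determined by its \<open>r\<close>-th parameter, so the intersection is a
  line. If the column is zero, the intersection contains for every \<open>r\<close> a nonzero point
  with \<open>r\<close>-th parameter zero, which is impossible on a line; both sides are then the
  zero space.\<close>

lemma arrangement_line_eq_span:
  fixes W :: "'a::field mat"
  assumes W: "W \<in> carrier_mat m n" and X: "X = vec_space.row_space n W"
    and indep: "\<forall>c. (\<forall>j<n. (\<Sum>r<m. c r * W $$ (r, j)) = 0) \<longrightarrow> (\<forall>r<m. c r = 0)"
    and J: "J \<subseteq> {..<n}" "Suc (card J) = m"
  shows "arrangement_line n X (coordinate_arrangement X) J = vec_span n {line_vector W m n J}"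
proof -
  interpret vec_space "TYPE('a)" n .
  let ?y = "line_vector W m n J"
  define comb where "comb = (\<lambda>a. vec n (\<lambda>j. \<Sum>r<m. a r * W $$ (r, j)))"
  define Y where "Y = X \<inter> (\<Inter>k\<in>J. coordinate_arrangement X k)"
  have Y: "Y = {comb a | a. \<forall>k\<in>J. (\<Sum>r<m. a r * W $$ (r, k)) = 0}"
  proof (intro equalityI subsetI)
    fix x assume x: "x \<in> Y"
    then obtain a where a: "x = comb a"
      unfolding Y_def X row_space_combinations[OF W] comb_def by blast
    have "(\<Sum>r<m. a r * W $$ (r, k)) = 0" if "k \<in> J" for k
    proof -
      have "x $ k = 0" using x that unfolding Y_def coordinate_arrangement_def by blast
      moreover have "k < n" using that J(1) by blast
      ultimately show ?thesis by (simp add: a comb_def)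
    qed
    then show "x \<in> {comb a | a. \<forall>k\<in>J. (\<Sum>r<m. a r * W $$ (r, k)) = 0}" using a by blast
  next
    fix x assume "x \<in> {comb a | a. \<forall>k\<in>J. (\<Sum>r<m. a r * W $$ (r, k)) = 0}"
    then obtain a where a: "x = comb a" "\<forall>k\<in>J. (\<Sum>r<m. a r * W $$ (r, k)) = 0" by blast
    then have "x \<in> X" unfolding X row_space_combinations[OF W] comb_def by blast
    moreover have "x $ k = 0" if "k \<in> J" for k
    proof -
      have "k < n" using that J(1) by blast
      then show ?thesis using a that by (simp add: comb_def)
    qed
    ultimately show "x \<in> Y" unfolding Y_def coordinate_arrangement_def by blast
  qed
  have y: "?y = comb (\<lambda>r. V_matrix W r J)" by (simp add: line_vector_def comb_def)
  have line: "arrangement_line n X (coordinate_arrangement X) J = (if subspace_dim n Y = 1 then Y else {0\<^sub>v n})"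
    unfolding arrangement_line_def Y_def by (simp add: Let_def)
  show ?thesis
  proof (cases "\<exists>r<m. V_matrix W r J \<noteq> 0")
    case True
    then obtain r where r: "r < m" "V_matrix W r J \<noteq> 0" by blast
    have y0: "?y \<noteq> 0\<^sub>v n"
    proof
      assume y0: "?y = 0\<^sub>v n"
      have "\<forall>j<n. (\<Sum>r<m. V_matrix W r J * W $$ (r, j)) = 0"
      proof (intro allI impI)
        fix j assume "j < n"
        then have "?y $ j = 0" using y0 by simp
        then show "(\<Sum>r<m. V_matrix W r J * W $$ (r, j)) = 0" using \<open>j < n\<close> by (simp add: line_vector_def)
      qed
      then have "\<forall>r<m. V_matrix W r J = 0" by (rule indep[THEN spec, THEN mp])
      then show False using r by blast
    qed
    have Yspan: "Y = vec_span n {?y}"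
    proof (intro equalityI subsetI)
      fix x assume "x \<in> Y"
      then obtain a where a: "x = comb a" "\<forall>k\<in>J. (\<Sum>r<m. a r * W $$ (r, k)) = 0"
        unfolding Y by blast
      \<comment> \<open>Subtracting \<open>t\<close> times column \<open>J\<close> of
        \<open>V\<close> makes the \<open>r\<close>-th parameter vanish.\<close>
      define t where "t = a r / V_matrix W r J"
      define b where "b = (\<lambda>s. a s - t * V_matrix W s J)"
      have "b r = 0" using r by (simp add: b_def t_def)
      moreover have "(\<Sum>s<m. b s * W $$ (s, k)) = 0" if "k \<in> J" for k
      proof -
        have "(\<Sum>s<m. b s * W $$ (s, k)) =
            (\<Sum>s<m. a s * W $$ (s, k)) - t * (\<Sum>s<m. W $$ (s, k) * V_matrix W s J)"
          unfolding sum_distrib_left sum_subtractf[symmetric] b_def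
          by (intro sum.cong refl) (simp add: algebra_simps)
        moreover have "k < n" using that J(1) by blast
        ultimately show ?thesis using a(2) that V_matrix_cofactor[OF W J, of k] by simp
      qed
      ultimately have "\<forall>s<m. b s = 0" using V_matrix_eq_0_iff[OF W J r(1)] r(2) by blast
      then have b: "a s = t * V_matrix W s J" if "s < m" for s using that by (simp add: b_def)
      have "x = t \<cdot>\<^sub>v ?y"
        unfolding a(1) y using b
        by (intro eq_vecI) (auto simp: comb_def sum_distrib_left mult.assoc intro!: sum.cong)
      then show "x \<in> vec_span n {?y}" unfolding span_singleton[OF line_vector_dim] by blast
    next
      fix x assume "x \<in> vec_span n {?y}"
      then obtain t where x: "x = t \<cdot>\<^sub>v ?y" unfolding span_singleton[OF line_vector_dim] by blast
      have "x = comb (\<lambda>r. t * V_matrix W r J)"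
        unfolding x y by (intro eq_vecI) (auto simp: comb_def sum_distrib_left mult.assoc)
      moreover have "(\<Sum>r<m. t * V_matrix W r J * W $$ (r, k)) = 0" if "k \<in> J" for k
      proof -
        have "k < n" using that J(1) by blast
        have "(\<Sum>r<m. t * V_matrix W r J * W $$ (r, k)) = t * (\<Sum>s<m. W $$ (s, k) * V_matrix W s J)"
          by (simp add: sum_distrib_left mult_ac)
        then show ?thesis using V_matrix_cofactor[OF W J \<open>k < n\<close>] that by simp
      qed
      ultimately show "x \<in> Y" unfolding Y by blast
    qed
    have "subspace_dim n Y = 1"
      unfolding Yspan dim_span_singleton[OF line_vector_dim] by (rule y0)
    then show ?thesis unfolding line Yspan by (rule if_P)
  next
    case False
    then have V0: "\<forall>r<m. V_matrix W r J = 0" by blast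
    have "subspace_dim n Y \<noteq> 1"
    proof
      assume dim: "subspace_dim n Y = 1"
      have "VectorSpace.subspace class_ring Y V"
      proof -
        have "submodule class_ring Y V"
        proof (rule submodule.intro)
          show "Y \<subseteq> carrier V" by (auto simp: Y comb_def module_vec_simps)
          have "comb (\<lambda>_. 0) \<in> Y" unfolding Y by (intro CollectI exI[of _ "\<lambda>_. 0"]) simp
          moreover have "comb (\<lambda>_. 0) = \<zero>\<^bsub>V\<^esub>" by (auto simp: comb_def module_vec_simps)
          ultimately show "\<zero>\<^bsub>V\<^esub> \<in> Y" by simp
          fix v w assume "v \<in> Y" "w \<in> Y"
          then obtain a b where ab: "v = comb a" "\<forall>k\<in>J. (\<Sum>r<m. a r * W $$ (r, k)) = 0"
            "w = comb b" "\<forall>k\<in>J. (\<Sum>r<m. b r * W $$ (r, k)) = 0" unfolding Y by blast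
          have "v \<oplus>\<^bsub>V\<^esub> w = comb (\<lambda>r. a r + b r)"
            unfolding ab by (auto simp: comb_def module_vec_simps distrib_right sum.distrib)
          moreover have "\<forall>k\<in>J. (\<Sum>r<m. (a r + b r) * W $$ (r, k)) = 0"
            using ab by (simp add: distrib_right sum.distrib)
          ultimately show "v \<oplus>\<^bsub>V\<^esub> w \<in> Y" unfolding Y by blast
        next
          fix c :: 'a and v assume "v \<in> Y"
          then obtain a where a: "v = comb a" "\<forall>k\<in>J. (\<Sum>r<m. a r * W $$ (r, k)) = 0" unfolding Y by blast
          have "c \<odot>\<^bsub>V\<^esub> v = comb (\<lambda>r. c * a r)"
            unfolding a by (auto simp: comb_def module_vec_simps sum_distrib_left mult.assoc)
          moreover have "\<forall>k\<in>J. (\<Sum>r<m. c * a r * W $$ (r, k)) = 0"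
            using a(2) by (simp add: mult.assoc flip: sum_distrib_left)
          ultimately show "c \<odot>\<^bsub>V\<^esub> v \<in> Y" unfolding Y by blast
        qed (rule module_axioms)
        then show ?thesis unfolding VectorSpace.subspace_def using vectorspace_axioms by blast
      qed
      then obtain x where x: "x \<in> carrier_vec n" "Y = vec_span n {x}" using subspace_dim_1 dim by blast
      have "x = 1 \<cdot>\<^sub>v x" by simp
      then have "x \<in> Y" unfolding x(2) span_singleton[OF x(1)] by blast
      then obtain a where a: "x = comb a" unfolding Y by blast
      \<comment> \<open>A parameter at which the spanning vector is nonzero, if there is one. A
        solution \<open>b\<close> with \<open>b r = 0\<close> is a multiple of \<open>a\<close>, and
        this choice forces it to vanish.\<close>
      obtain r where r: "r < m" "a r \<noteq> 0 \<or> (\<forall>s<m. a s = 0)" using J(2) by blast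
      obtain b where b: "\<exists>s<m. b s \<noteq> 0" "b r = 0" "\<forall>k\<in>J. (\<Sum>s<m. b s * W $$ (s, k)) = 0"
        using V_matrix_eq_0_iff[OF W J r(1)] V0 r(1) by blast
      then have "comb b \<in> vec_span n {x}" unfolding x(2)[symmetric] unfolding Y by blast
      then obtain t where t: "comb b = t \<cdot>\<^sub>v x" unfolding span_singleton[OF x(1)] by blast
      have "\<forall>j<n. (\<Sum>s<m. (b s - t * a s) * W $$ (s, j)) = 0"
      proof (intro allI impI)
        fix j assume "j < n"
        have "comb b $ j = (t \<cdot>\<^sub>v comb a) $ j" using t a by simp
        then show "(\<Sum>s<m. (b s - t * a s) * W $$ (s, j)) = 0" using \<open>j < n\<close>
          by (simp add: comb_def left_diff_distrib sum_subtractf sum_distrib_left mult.assoc)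
      qed
      then have "\<forall>s<m. b s - t * a s = 0" by (rule indep[THEN spec, THEN mp])
      then have eq: "b s = t * a s" if "s < m" for s using that by simp
      have "t = 0 \<or> (\<forall>s<m. a s = 0)" using eq[OF r(1)] b(2) r(2) by auto
      then show False using eq b(1) by auto
    qed
    moreover have "?y = 0\<^sub>v n" using V0 by (auto simp: line_vector_def)
    moreover have "vec_span n {0\<^sub>v n :: 'a vec} = {0\<^sub>v n}"
      unfolding span_singleton[OF zero_carrier_vec] by auto
    ultimately show ?thesis unfolding line by simp
  qed
qed

text \<open>The rows of \<open>W\<close> are independent, so the parametrisation of \<open>X\<close>
  is injective and the line vectors satisfy the same linear relations as the columns of
  \<open>V\<close>. The union of the lines has the same span as the line vectors.\<close>

lemma matroid_of_lines_eq:
  fixes W :: "'a::field mat"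
  assumes W: "W \<in> carrier_mat (d + 1) n" and X: "X = vec_space.row_space n W"
    and indep: "\<forall>c. (\<forall>j<n. (\<Sum>r<d + 1. c r * W $$ (r, j)) = 0) \<longrightarrow> (\<forall>r<d + 1. c r = 0)"
  shows "matroid_of_lines n X (coordinate_arrangement X) (nsets {..<n} d) =
    column_matroid {..<d + 1} (nsets {..<n} d) (V_matrix W)"
proof -
  interpret vec_space "TYPE('a)" n .
  let ?E = "nsets {..<n} d" and ?y = "line_vector W (d + 1) n"
  have "subspace_dim n (vec_span n (\<Union>J\<in>S. arrangement_line n X (coordinate_arrangement X) J)) = card S \<longleftrightarrow>
      S \<in> column_matroid {..<d + 1} ?E (V_matrix W)" if S: "S \<subseteq> ?E" for S
  proof -
    have fS: "finite S" using finite_nsets_lessThan S by (rule rev_finite_subset)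
    have line: "arrangement_line n X (coordinate_arrangement X) J = span {?y J}" if "J \<in> S" for J
    proof (rule arrangement_line_eq_span[OF W X indep])
      have "J \<in> ?E" using that S by blast
      then show "J \<subseteq> {..<n}" "Suc (card J) = d + 1" by (auto simp: nsets_iff)
    qed
    have yS: "?y ` S \<subseteq> carrier_vec n" using line_vector_dim by blast
    have span_eq: "span (\<Union>J\<in>S. span {?y J}) = span (?y ` S)"
    proof
      have "span {?y J} \<subseteq> span (?y ` S)" if "J \<in> S" for J
        using that by (intro span_is_monotone) auto
      then have "(\<Union>J\<in>S. span {?y J}) \<subseteq> span (?y ` S)" by blast
      then show "span (\<Union>J\<in>S. span {?y J}) \<subseteq> span (?y ` S)"
        using span_is_submodule[OF yS] by (intro span_is_subset) auto
      have "?y J \<in> span {?y J}" for J by (rule span_self) (simp add: line_vector_dim)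
      then have "?y ` S \<subseteq> (\<Union>J\<in>S. span {?y J})" by blast
      then show "span (?y ` S) \<subseteq> span (\<Union>J\<in>S. span {?y J})" by (rule span_is_monotone)
    qed
    have lines_eq: "(\<Union>J\<in>S. arrangement_line n X (coordinate_arrangement X) J) = (\<Union>J\<in>S. span {?y J})"
      using line by simp
    have "subspace_dim n (vec_span n (\<Union>J\<in>S. arrangement_line n X (coordinate_arrangement X) J)) = card S \<longleftrightarrow>
        S \<in> column_matroid {..<n} S (\<lambda>i J. ?y J $ i)"
      unfolding lines_eq span_eq by (rule dim_span_image[OF fS line_vector_dim])
    also have "\<dots> \<longleftrightarrow> S \<in> column_matroid {..<d + 1} ?E (V_matrix W)"
    proof -
      have "(\<forall>i\<in>{..<n}. (\<Sum>J\<in>S. c J * ?y J $ i) = 0) \<longleftrightarrow>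
          (\<forall>r\<in>{..<d + 1}. (\<Sum>J\<in>S. c J * V_matrix W r J) = 0)" for c
      proof -
        let ?g = "\<lambda>r. \<Sum>J\<in>S. c J * V_matrix W r J"
        have "(\<Sum>J\<in>S. c J * ?y J $ i) = (\<Sum>r<d + 1. ?g r * W $$ (r, i))" if "i < n" for i
        proof -
          have "(\<Sum>J\<in>S. c J * ?y J $ i) = (\<Sum>J\<in>S. \<Sum>r<d + 1. c J * V_matrix W r J * W $$ (r, i))"
            using that by (intro sum.cong refl) (simp only: line_vector_def index_vec sum_distrib_left mult.assoc)
          then show ?thesis by (subst (asm) sum.swap) (simp only: sum_distrib_right)
        qed
        then have "(\<forall>i\<in>{..<n}. (\<Sum>J\<in>S. c J * ?y J $ i) = 0) \<longleftrightarrow>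
            (\<forall>i<n. (\<Sum>r<d + 1. ?g r * W $$ (r, i)) = 0)"
          by (simp only: Ball_def lessThan_iff cong: imp_cong)
        also have "\<dots> \<longleftrightarrow> (\<forall>r<d + 1. ?g r = 0)"
        proof
          assume "\<forall>i<n. (\<Sum>r<d + 1. ?g r * W $$ (r, i)) = 0"
          then show "\<forall>r<d + 1. ?g r = 0" by (rule indep[THEN spec, THEN mp])
        next
          assume "\<forall>r<d + 1. ?g r = 0"
          then show "\<forall>i<n. (\<Sum>r<d + 1. ?g r * W $$ (r, i)) = 0" by (intro allI impI sum.neutral) simp
        qed
        finally show ?thesis by (simp add: Ball_def)
      qed
      then show ?thesis unfolding column_matroid_def using S by simp
    qed
    finally show ?thesis .
  qed
  then show ?thesis
    unfolding matroid_of_lines_def using column_matroid_subset by blast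
qed

section \<open>Change of basis\<close>

lemma field_subset_subfield:
  fixes k :: "'a::field set"
  assumes "subfield k (class_ring :: 'a ring)"
  shows "field_subset k"
proof -
  have ring: "ring (class_ring :: 'a ring)" by (rule class_ring.ring_axioms)
  note sub = subringE[OF subfieldE(1)[OF assms]]
  show ?thesis
  proof
    fix x assume x: "x \<in> k"
    have "\<ominus>\<^bsub>class_ring\<^esub> x \<in> k" using sub(5)[OF x] .
    moreover have "x + \<ominus>\<^bsub>class_ring\<^esub> x = 0" using abelian_group.r_neg[OF ring.is_abelian_group[OF ring], of x] by simp
    ultimately show "- x \<in> k" using minus_unique by metis
    show "inverse x \<in> k"
    proof (cases "x = 0")
      case False
      then have "x \<in> k - {\<zero>\<^bsub>class_ring\<^esub>}" using x by simp
      from ring.subfield_m_inv(1,2)[OF ring assms this]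
      have "inv\<^bsub>class_ring\<^esub> x \<in> k" "x * inv\<^bsub>class_ring\<^esub> x = 1" by auto
      then show ?thesis using inverse_unique by metis
    qed (use x in simp)
  qed (use sub in auto)
qed

lemma (in field_subset) det_closed:
  assumes T: "T \<in> carrier_mat m m" and k: "\<And>i j. i < m \<Longrightarrow> j < m \<Longrightarrow> T $$ (i, j) \<in> k"
  shows "det T \<in> k"
  unfolding det_def'[OF T]
proof (intro sum_closed mult_closed prod_closed)
  fix p assume "p \<in> {p. p permutes {0..<m}}"
  then have p: "p permutes {0..<m}" by simp
  show "signof p \<in> k" by (auto simp: one_closed uminus_closed sign_def)
  show "T $$ (i, p i) \<in> k" if "i \<in> {0..<m}" for i
    using k[of i "p i"] that permutes_in_image[OF p, of i] by auto
qed

lemma (in field_subset) V_matrix_closed: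
  assumes W: "W \<in> carrier_mat (d + 1) n" and k: "\<And>i j. i < d + 1 \<Longrightarrow> j < n \<Longrightarrow> W $$ (i, j) \<in> k"
    and r: "r < d + 1" and J: "J \<in> nsets {..<n} d"
  shows "V_matrix W r J \<in> k"
proof -
  have J: "J \<subseteq> {..<n}" "card J = d" using J by (auto simp: nsets_iff)
  have S: "submatrix W (UNIV - {r}) J =
      mat d d (\<lambda>(s, c). W $$ (if s < r then s else Suc s, pick J c))"
    using submatrix_del_row_cols[of W d n J r] W r J by simp
  have "det (submatrix W (UNIV - {r}) J) \<in> k"
    by (rule det_closed[of _ d]) (use k r pick_less[OF J(1)] J(2) in \<open>auto simp: S\<close>)
  moreover have "(-1) ^ r \<in> k" by (induction r) (auto simp: one_closed uminus_closed)
  ultimately show ?thesis unfolding V_matrix_def by (rule mult_closed[rotated])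
qed

lemma submatrix_mult:
  assumes G: "G \<in> carrier_mat m m" and W: "W \<in> carrier_mat m n" and I: "I \<subseteq> {..<n}"
  shows "submatrix (G * W) UNIV I = G * submatrix W UNIV I"
  unfolding submatrix_cols[OF mult_carrier_mat[OF G W] I] submatrix_cols[OF W I]
  using G W pick_less[OF I] by (intro eq_matI) (auto simp: scalar_prod_def)

lemma V_row_space_mult:
  fixes W :: "'a::field mat"
  assumes G: "G \<in> carrier_mat (d + 1) (d + 1)" "det G \<noteq> 0" and W: "W \<in> carrier_mat (d + 1) n"
    and p: "\<forall>J\<in>nsets {..<n} d. p J = (\<Sum>r<d + 1. a r * V_matrix W r J)"
  shows "\<exists>b. \<forall>J\<in>nsets {..<n} d. p J = (\<Sum>r<d + 1. b r * V_matrix (G * W) r J)"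
proof (intro exI ballI)
  fix J assume J: "J \<in> nsets {..<n} d"
  then have "J \<subseteq> {..<n}" "Suc (card J) = d + 1" by (auto simp: nsets_iff)
  from V_matrix_mult[OF G(1) W this, of a]
  have "(\<Sum>s<d + 1. (\<Sum>t<d + 1. G $$ (s, t) * a t) * V_matrix (G * W) s J) / det G = p J"
    using p J G(2) by simp
  then show "p J = (\<Sum>s<d + 1. (\<Sum>t<d + 1. G $$ (s, t) * a t) / det G * V_matrix (G * W) s J)"
    unfolding times_divide_eq_left sum_divide_distrib[symmetric] by (rule sym)
qed

text \<open>A relation among the columns of \<open>V'\<close> persists for every matrix whose rows
  are combinations of the rows of \<open>V'\<close>.\<close>

lemma column_matroid_row_space:
  assumes E: "finite E"
    and V: "\<And>r. r \<in> R \<Longrightarrow> \<exists>a. \<forall>J\<in>E. V r J = (\<Sum>s\<in>R'. a s * V' s J)"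
  shows "column_matroid R E V \<subseteq> column_matroid R' E V'"
proof
  fix S assume S: "S \<in> column_matroid R E V"
  show "S \<in> column_matroid R' E V'"
  proof (rule column_matroidI[OF column_matroid_subset[OF S]])
    fix c J assume c: "\<forall>s\<in>R'. (\<Sum>J\<in>S. c J * V' s J) = 0" and J: "J \<in> S"
    have "(\<Sum>J\<in>S. c J * V r J) = 0" if r: "r \<in> R" for r
    proof -
      obtain a where "\<forall>J\<in>E. V r J = (\<Sum>s\<in>R'. a s * V' s J)" using V[OF r] by blast
      then have "(\<Sum>J\<in>S. c J * V r J) = (\<Sum>J\<in>S. c J * (\<Sum>s\<in>R'. a s * V' s J))"
        using column_matroid_subset[OF S] by (intro sum.cong) auto
      also have "\<dots> = (\<Sum>s\<in>R'. a s * (\<Sum>J\<in>S. c J * V' s J))"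
        unfolding sum_distrib_left by (subst sum.swap) (simp add: mult.left_commute)
      also have "\<dots> = 0" using c by simp
      finally show ?thesis .
    qed
    then show "c J = 0" using column_matroidD[OF S _ J] by blast
  qed
qed

text \<open>Equality of the two matroids results from using this also for the inverse change of
  basis.\<close>

lemma V_matroid_mult_subset:
  fixes W :: "'a::field mat"
  assumes G: "G \<in> carrier_mat (d + 1) (d + 1)" "det G \<noteq> 0" and W: "W \<in> carrier_mat (d + 1) n"
  shows "column_matroid {..<d + 1} (nsets {..<n} d) (V_matrix W) \<subseteq>
    column_matroid {..<d + 1} (nsets {..<n} d) (V_matrix (G * W))"
proof (rule column_matroid_row_space[OF finite_nsets_lessThan])
  fix r assume "r \<in> {..<d + 1}"
  then have "V_matrix W r J = (\<Sum>s<d + 1. (if s = r then 1 else 0) * V_matrix W s J)" for J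
    by (subst sum.mono_neutral_right[of "{..<d + 1}" "{r}"]) auto
  then have "\<forall>J\<in>nsets {..<n} d. V_matrix W r J = (\<Sum>s<d + 1. (if s = r then 1 else 0) * V_matrix W s J)"
    by (rule ballI)
  then show "\<exists>a. \<forall>J\<in>nsets {..<n} d. V_matrix W r J = (\<Sum>s<d + 1. a s * V_matrix (G * W) s J)"
    by (rule V_row_space_mult[OF G W])
qed

lemma row_in_row_space:
  assumes A: "A \<in> carrier_mat m n" and r: "r < m"
  shows "row A r \<in> vec_space.row_space n A"
proof -
  interpret vec_space "TYPE('a)" n .
  have "set (rows A) \<subseteq> carrier_vec n" using A rows_carrier[of A] by auto
  then have "set (rows A) \<subseteq> row_space A" unfolding row_space_def by (rule in_own_span)
  moreover have "row A r \<in> set (rows A)" using A r by (auto simp: rows_def)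
  ultimately show ?thesis by blast
qed

text \<open>The reduced echelon basis of \<open>X\<close> with respect to a nonzero minor: an element of \<open>X\<close> is
  determined by its coordinates in \<open>I\<close>, and if those lie in \<open>k\<close> then all of them do.\<close>

lemma (in field_subset) exists_matrix_over_subfield:
  fixes W :: "'a mat"
  assumes W: "W \<in> carrier_mat m n" and X: "X = vec_space.row_space n W"
    and I: "I \<subseteq> {..<n}" "card I = m" "det (submatrix W UNIV I) \<noteq> 0"
    and S: "S \<subseteq> {x \<in> carrier_vec n. \<forall>i<n. x $ i \<in> k}" "X = vec_span n S"
  obtains G P where "G \<in> carrier_mat m m" "P \<in> carrier_mat m m" "det G \<noteq> 0" "det P \<noteq> 0"
    "P * (G * W) = W" "vec_space.row_space n (G * W) = X" "submatrix (G * W) UNIV I = 1\<^sub>m m"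
    "\<And>r j. r < m \<Longrightarrow> j < n \<Longrightarrow> (G * W) $$ (r, j) \<in> k"
proof -
  interpret vec_space "TYPE('a)" n .
  have fI: "finite I" using I(1) by (rule rev_finite_subset[rotated]) simp
  \<comment> \<open>Multiplying by the inverse of the minor on \<open>I\<close> turns the columns
    \<open>I\<close> into an identity matrix.\<close>
  define P where "P = submatrix W UNIV I"
  have P: "P \<in> carrier_mat m m" using submatrix_cols[OF W I(1)] I(2) by (simp add: P_def)
  obtain G where G: "G \<in> carrier_mat m m" "G * P = 1\<^sub>m m" "P * G = 1\<^sub>m m"
    using det_nonzero_inverse[OF P] I(3) P_def by blast
  have "det G * det P = 1" using det_mult[OF G(1) P] G(2) by simp
  then have det: "det G \<noteq> 0" "det P \<noteq> 0" by auto
  define W0 where "W0 = G * W"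
  have W0: "W0 \<in> carrier_mat m n" using G W by (simp add: W0_def)
  have PW0: "P * W0 = W"
    unfolding W0_def using assoc_mult_mat[OF P G(1) W] G(3) W by simp
  have sub: "submatrix W0 UNIV I = 1\<^sub>m m"
    unfolding W0_def submatrix_mult[OF G(1) W I(1)] using G(2) by (simp add: P_def)
  have "invertible_mat G"
    using G P unfolding invertible_mat_def inverts_mat_def square_mat.simps by auto
  then have row0: "row_space W0 = X"
    unfolding W0_def X using row_space_is_preserved[OF _ G(1) W] by simp
  have pick: "W0 $$ (r, pick I c) = (if r = c then 1 else 0)" if "r < m" "c < m" for r c
  proof -
    have "submatrix W0 UNIV I $$ (r, c) = W0 $$ (r, pick I c)"
      using submatrix_cols[OF W0 I(1)] I(2) that by simp
    then show ?thesis using sub that by simp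
  qed
  have unique: "x = row W0 r"
    if x: "x \<in> X" and r: "r < m" and xI: "\<And>i. i \<in> I \<Longrightarrow> x $ i = W0 $$ (r, i)" for x r
  proof -
    obtain a where a: "x = vec n (\<lambda>j. \<Sum>s<m. a s * W0 $$ (s, j))"
      using x unfolding row0[symmetric] row_space_combinations[OF W0] by blast
    have "a c = (if c = r then 1 else 0)" if c: "c < m" for c
    proof -
      have pc: "pick I c \<in> I" "pick I c < n" using c I pick_in_set_le[of c I] pick_less[OF I(1), of c] by auto
      have "x $ pick I c = (\<Sum>s<m. a s * W0 $$ (s, pick I c))" using pc by (simp add: a)
      also have "\<dots> = (\<Sum>s\<in>{c}. a s * W0 $$ (s, pick I c))"
        using c pick[OF _ c] by (intro sum.mono_neutral_right) auto
      also have "\<dots> = a c" using pick[OF c c] by simp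
      finally show ?thesis using xI[OF pc(1)] pick[OF r c] by auto
    qed
    then have "(\<Sum>s<m. a s * W0 $$ (s, j)) = W0 $$ (r, j)" for j
      using r by (subst sum.mono_neutral_right[of "{..<m}" "{r}"]) auto
    then show ?thesis unfolding a using W0 r by (intro eq_vecI) auto
  qed
  have "W0 $$ (r, j) \<in> k" if r: "r < m" and j: "j < n" for r j
  proof -
    let ?x = "row W0 r"
    have x_index: "?x $ i = W0 $$ (r, i)" if "i < n" for i using that r W0 by simp
    have "?x \<in> X" unfolding row0[symmetric] by (rule row_in_row_space[OF W0 r])
    then obtain b A where A: "finite A" "A \<subseteq> S" "?x = lincomb b A"
      unfolding S(2) span_def by blast
    have Ac: "A \<subseteq> carrier_vec n" using A(2) S(1) by blast
    have Ak: "s $ i \<in> k" if "s \<in> A" "i < n" for s i using A(2) S(1) that by blast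
    have xs: "W0 $$ (r, i) = (\<Sum>s\<in>A. b s * s $ i)" if "i < n" for i
      using lincomb_index[OF that Ac, of b] A(3) x_index[OF that] by simp
    \<comment> \<open>A row that is itself among the generators has entries in \<open>k\<close> at
      once; otherwise it can be adjoined to \<open>A\<close> as a new column.\<close>
    show ?thesis
    proof (cases "?x \<in> A")
      case True
      then show ?thesis using Ak j x_index by metis
    next
      case False
      let ?N = "\<lambda>i s. s $ i"
      have Ik: "?N i s \<in> k" if i: "i \<in> I" and s: "s \<in> insert ?x A" for i s
      proof (cases "s = ?x")
        case True
        obtain c where c: "c < card I" "pick I c = i" using pick_surj[OF fI i] .
        then have "W0 $$ (r, i) \<in> k" using pick[OF r, of c] I(2) by (auto simp: closed(1,2))
        moreover have "i < n" using i I(1) by blast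
        ultimately show ?thesis using True x_index by simp
      next
        case False
        moreover have "i < n" using i I(1) by blast
        ultimately show ?thesis using Ak s by blast
      qed
      \<comment> \<open>The row is a combination of \<open>A\<close> over the large field, so no
        functional on the coordinates \<open>I\<close> separates it from \<open>A\<close>. Hence
        some combination of \<open>A\<close> over \<open>k\<close> agrees with it on
        \<open>I\<close>.\<close>
      have "\<not> (\<forall>s\<in>insert ?x A. (\<Sum>i\<in>I. f i * ?N i s) = (if s = ?x then 1 else 0))" for f
      proof
        assume f: "\<forall>s\<in>insert ?x A. (\<Sum>i\<in>I. f i * ?N i s) = (if s = ?x then 1 else 0)"
        have "1 = (\<Sum>i\<in>I. f i * ?x $ i)" using f by simp
        also have "\<dots> = (\<Sum>i\<in>I. f i * (\<Sum>s\<in>A. b s * s $ i))"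
          using I(1) x_index xs by (intro sum.cong) auto
        also have "\<dots> = (\<Sum>s\<in>A. b s * (\<Sum>i\<in>I. f i * s $ i))"
          unfolding sum_distrib_left by (subst sum.swap) (simp add: mult.left_commute)
        also have "\<dots> = 0" using f False by (intro sum.neutral) auto
        finally show False by simp
      qed
      then obtain c where c: "\<forall>s. c s \<in> k" "c ?x = 1" "\<forall>i\<in>I. (\<Sum>s\<in>insert ?x A. c s * ?N i s) = 0"
        using linear_alternative[OF fI, of "insert ?x A" ?x ?N] Ik A(1) by blast
      \<comment> \<open>This combination lies in \<open>X\<close> and agrees with the row on
        \<open>I\<close>, so it is the row itself by \<open>unique\<close>.\<close>
      define z where "z = lincomb (\<lambda>s. - c s) A"
      have z: "z $ i = - (\<Sum>s\<in>A. c s * s $ i)" if "i < n" for i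
        using lincomb_index[OF that Ac, of "\<lambda>s. - c s"] by (simp add: z_def sum_negf)
      have "z \<in> X" unfolding S(2) span_def z_def using A(1,2) by auto
      moreover have "z $ i = W0 $$ (r, i)" if "i \<in> I" for i
      proof -
        have "?x $ i + (\<Sum>s\<in>A. c s * s $ i) = 0" using c(2,3) that A(1) False by simp
        then have "?x $ i = - (\<Sum>s\<in>A. c s * s $ i)" by (simp only: eq_neg_iff_add_eq_0)
        moreover have "i < n" using that I(1) by blast
        ultimately show ?thesis using z x_index by simp
      qed
      ultimately have "z = ?x" using unique r by blast
      then have "W0 $$ (r, j) = - (\<Sum>s\<in>A. c s * s $ j)" using z[OF j] x_index[OF j] by simp
      then show ?thesis using c(1) Ak j by (auto intro!: uminus_closed sum_closed mult_closed)
    qed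
  qed
  then show ?thesis using that[OF G(1) P det] PW0 row0 sub unfolding W0_def by blast
qed

section \<open>The locus of subspaces\<close>

text \<open>The rows of a matrix representing a subspace of \<open>X\<close> are combinations of the
  rows of \<open>W\<close>. Its minors therefore satisfy the relations \<open>U\<close>, whose
  solutions form the row space of \<open>V\<close>.\<close>

lemma plucker_in_V_row_space:
  fixes W :: "'a::field mat"
  assumes W: "W \<in> carrier_mat (d + 1) n" and X: "X = vec_space.row_space n W"
    and I: "I \<subseteq> {..<n}" "card I = d + 1" "det (submatrix W UNIV I) \<noteq> 0"
    and P: "P \<in> subspaces_locus d n X" "p \<in> P"
  shows "\<exists>a. \<forall>J\<in>nsets {..<n} d. p J = (\<Sum>r<d + 1. a r * V_matrix W r J)"
proof -
  obtain Y where Y: "P = plucker_point d n Y" "Y \<subseteq> X" using P(1) unfolding subspaces_locus_def by blast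
  obtain A c where p: "p = (\<lambda>J\<in>nsets {..<n} d. c * det (submatrix A UNIV J))"
    and A: "A \<in> carrier_mat d n" "vec_space.row_space n A = Y"
    using P(2) unfolding Y(1) plucker_point_def by blast
  have "\<exists>b. \<forall>j<n. A $$ (r, j) = (\<Sum>s<d + 1. b s * W $$ (s, j))" if r: "r < d" for r
  proof -
    have "row A r \<in> vec_space.row_space n A" by (rule row_in_row_space[OF A(1) r])
    then have "row A r \<in> X" using A(2) Y(2) by blast
    then obtain b where b: "row A r = vec n (\<lambda>j. \<Sum>s<d + 1. b s * W $$ (s, j))"
      unfolding X row_space_combinations[OF W] by blast
    have "A $$ (r, j) = (\<Sum>s<d + 1. b s * W $$ (s, j))" if "j < n" for j
    proof -
      have "A $$ (r, j) = row A r $ j" using r A(1) that by simp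
      also have "\<dots> = (\<Sum>s<d + 1. b s * W $$ (s, j))" unfolding b using that by simp
      finally show ?thesis .
    qed
    then show ?thesis by blast
  qed
  then obtain b where b: "\<And>r j. r < d \<Longrightarrow> j < n \<Longrightarrow> A $$ (r, j) = (\<Sum>s<d + 1. b r s * W $$ (s, j))"
    by metis
  have "(\<Sum>J\<in>nsets {..<n} d. p J * U_matrix W s J) = 0" if s: "s \<in> U_rows d n" for s
  proof -
    obtain A' B' where s': "s = (A', B')" by (cases s)
    have "(\<Sum>J\<in>nsets {..<n} d. p J * U_matrix W s J) =
        c * (\<Sum>J\<in>nsets {..<n} d. det (submatrix A UNIV J) * U_matrix W s J)"
      by (simp add: p sum_distrib_left mult.assoc)
    then show ?thesis using minors_satisfy_U[OF W A(1) b] s unfolding s' by simp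
  qed
  then show ?thesis using U_kernel[OF W I, of p] by blast
qed

lemma minor_imp_independent_rows:
  fixes M :: "'a::field mat"
  assumes M: "M \<in> carrier_mat m n" and J: "J \<subseteq> {..<n}" "card J = m" "det (submatrix M UNIV J) \<noteq> 0"
  shows "\<forall>c. (\<forall>j<n. (\<Sum>r<m. c r * M $$ (r, j)) = 0) \<longrightarrow> (\<forall>r<m. c r = 0)"
proof (intro allI impI, rule ccontr)
  fix c r assume c: "\<forall>j<n. (\<Sum>r<m. c r * M $$ (r, j)) = 0" and r: "r < m" "c r \<noteq> 0"
  have S: "submatrix M UNIV J = mat m m (\<lambda>(r, c). M $$ (r, pick J c))"
    using submatrix_cols[OF M J(1)] J(2) by simp
  have "\<forall>i<m. (\<Sum>s<m. c s * submatrix M UNIV J $$ (s, i)) = 0"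
    using c pick_less[OF J(1)] J(2) by (simp add: S)
  then have "det (submatrix M UNIV J) = 0"
    using det_eq_0_iff_row_combination[of "submatrix M UNIV J" m] r by (auto simp: S)
  then show False using J(3) by contradiction
qed

text \<open>After a change of basis carrying \<open>a\<close> to a multiple of a unit vector, a
  single row of \<open>V\<close> contributes, and up to sign it lists the minors of a matrix with
  \<open>d\<close> rows. The coordinate at \<open>{..<d}\<close> shows both that \<open>a\<close> is
  nonzero and that these rows are independent.\<close>

lemma V_row_space_in_locus:
  fixes W :: "'a::field mat"
  assumes n: "n \<ge> d" and W: "W \<in> carrier_mat (d + 1) n" and X: "X = vec_space.row_space n W"
    and nz: "\<And>J. J \<in> nsets {..<n} d \<Longrightarrow> (\<Sum>r<d + 1. a r * V_matrix W r J) \<noteq> 0"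
  shows "\<exists>P\<in>subspaces_locus d n X. \<exists>p\<in>P. \<forall>J\<in>nsets {..<n} d. p J = (\<Sum>r<d + 1. a r * V_matrix W r J)"
proof -
  let ?E = "nsets {..<n} d" and ?m = "d + 1"
  have J0: "{..<d} \<in> ?E" using n by (auto simp: nsets_iff)
  obtain r0 where r0: "r0 < ?m" "a r0 \<noteq> 0"
  proof (rule ccontr)
    assume "\<not> thesis"
    then have "\<forall>r<?m. a r = 0" using that by blast
    then have "(\<Sum>r<?m. a r * V_matrix W r {..<d}) = 0" by (intro sum.neutral) simp
    then show False using nz[OF J0] by contradiction
  qed
  \<comment> \<open>Row operations sending \<open>a\<close> to a multiple of the \<open>r0\<close>-th unit vector.\<close>
  define g where "g = (\<lambda>t s. (if s = t then 1 else 0) - (if s = r0 \<and> t \<noteq> r0 then a t / a r0 else 0))"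
  define G where "G = mat ?m ?m (\<lambda>(t, s). g t s)"
  have G: "G \<in> carrier_mat ?m ?m" by (simp add: G_def)
  have delta: "(\<Sum>s<?m. (if s = t then 1 else 0) * x s) = x t" if "t < ?m" for t and x :: "nat \<Rightarrow> 'a"
    using that by (subst sum.mono_neutral_right[of "{..<?m}" "{t}"]) auto
  have Gx: "(\<Sum>s<?m. G $$ (t, s) * x s) = x t - (if t \<noteq> r0 then a t / a r0 * x r0 else 0)"
    if t: "t < ?m" for t and x :: "nat \<Rightarrow> 'a"
  proof -
    have "(\<Sum>s<?m. G $$ (t, s) * x s) = (\<Sum>s<?m. (if s = t then 1 else 0) * x s -
        (if t \<noteq> r0 then a t / a r0 else 0) * ((if s = r0 then 1 else 0) * x s))"
      using t by (intro sum.cong) (auto simp: G_def g_def left_diff_distrib)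
    also have "\<dots> = x t - (if t \<noteq> r0 then a t / a r0 else 0) * x r0"
      using delta[OF t, of x] delta[OF r0(1), of x] by (simp only: sum_subtractf flip: sum_distrib_left)
    finally show ?thesis by simp
  qed
  have "det G \<noteq> 0"
  proof
    assume "det G = 0"
    then obtain w where w: "w \<in> carrier_vec ?m" "w \<noteq> 0\<^sub>v ?m" "G *\<^sub>v w = 0\<^sub>v ?m"
      using det_0_iff_vec_prod_zero_field[OF G] by blast
    have eq: "w $ t = (if t \<noteq> r0 then a t / a r0 * w $ r0 else 0)" if t: "t < ?m" for t
    proof -
      have "0 = (G *\<^sub>v w) $ t" using w(3) t by simp
      also have "\<dots> = (\<Sum>s<?m. G $$ (t, s) * w $ s)"
        using t w(1) G by (auto simp: scalar_prod_def atLeast0LessThan intro!: sum.cong)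
      also have "\<dots> = w $ t - (if t \<noteq> r0 then a t / a r0 * w $ r0 else 0)" by (rule Gx[OF t])
      finally show ?thesis by simp
    qed
    have "w $ r0 = 0" using eq[OF r0(1)] by simp
    then have "w $ t = 0" if "t < ?m" for t using eq[OF that] by simp
    then have "w = 0\<^sub>v ?m" using w(1) by (intro eq_vecI) auto
    then show False using w(2) by contradiction
  qed
  define W' where "W' = G * W"
  have W': "W' \<in> carrier_mat ?m n" using G W by (simp add: W'_def)
  define A where "A = mat d n (\<lambda>(r, j). W' $$ (if r < r0 then r else Suc r, j))"
  have A: "A \<in> carrier_mat d n" by (simp add: A_def)
  \<comment> \<open>The sign comes from row \<open>r0\<close> of \<open>V\<close>, the factor
    \<open>a r0\<close> from \<open>G a\<close>, and \<open>det G\<close> from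
    \<open>V_matrix_mult\<close>.\<close>
  define c where "c = (-1) ^ r0 * a r0 / det G"
  have minor: "(\<Sum>r<?m. a r * V_matrix W r J) = c * det (submatrix A UNIV J)" if J: "J \<in> ?E" for J
  proof -
    have J': "J \<subseteq> {..<n}" "Suc (card J) = ?m" using J by (auto simp: nsets_iff)
    have "det G * (\<Sum>r<?m. a r * V_matrix W r J) =
        (\<Sum>s<?m. (\<Sum>t<?m. G $$ (s, t) * a t) * V_matrix W' s J)"
      unfolding W'_def by (rule V_matrix_mult[OF G W J', symmetric])
    also have "\<dots> = (\<Sum>s<?m. (if s = r0 then 1 else 0) * (a r0 * V_matrix W' s J))"
    proof (intro sum.cong refl)
      fix s assume "s \<in> {..<?m}"
      then have "s < ?m" by simp
      show "(\<Sum>t<?m. G $$ (s, t) * a t) * V_matrix W' s J =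
          (if s = r0 then 1 else 0) * (a r0 * V_matrix W' s J)"
        unfolding Gx[OF \<open>s < ?m\<close>] using r0(2) by simp
    qed
    also have "\<dots> = a r0 * V_matrix W' r0 J" by (rule delta[OF r0(1)])
    also have "V_matrix W' r0 J = (-1) ^ r0 * det (submatrix A UNIV J)"
      unfolding V_matrix_def A_def submatrix_delete_row[OF W' r0(1) J] by (rule refl)
    finally show ?thesis using \<open>det G \<noteq> 0\<close> by (simp only: c_def) (simp add: field_simps)
  qed
  define Y where "Y = vec_space.row_space n A"
  have "c \<noteq> 0" using r0(2) \<open>det G \<noteq> 0\<close> by (simp add: c_def)
  have "Y \<in> grassmannian d n"
  proof -
    interpret vec_space "TYPE('a)" n .
    have "set (rows A) \<subseteq> carrier_vec n" using A rows_carrier[of A] by auto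
    then have "VectorSpace.subspace class_ring Y V"
      unfolding Y_def row_space_def by (rule span_is_subspace)
    moreover have "det (submatrix A UNIV {..<d}) \<noteq> 0" using nz[OF J0] minor[OF J0] by auto
    then have "subspace_dim n Y = d"
      unfolding Y_def dim_row_space[OF A] using J0 by (intro minor_imp_independent_rows[OF A]) (auto simp: nsets_iff)
    ultimately show ?thesis by (simp add: grassmannian_def)
  qed
  moreover have "Y \<subseteq> X"
  proof
    fix x assume "x \<in> Y"
    then obtain b where b: "x = vec n (\<lambda>j. \<Sum>r<d. b r * A $$ (r, j))"
      unfolding Y_def row_space_combinations[OF A] by blast
    let ?sk = "\<lambda>r. if r < r0 then r else Suc r"
    define e where "e = (\<lambda>t. \<Sum>r<d. b r * G $$ (?sk r, t))"
    have "(\<Sum>r<d. b r * A $$ (r, j)) = (\<Sum>t<?m. e t * W $$ (t, j))" if j: "j < n" for j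
    proof -
      have "(\<Sum>r<d. b r * A $$ (r, j)) = (\<Sum>r<d. b r * (\<Sum>t<?m. G $$ (?sk r, t) * W $$ (t, j)))"
        using j G W r0(1)
        by (intro sum.cong refl) (auto simp: A_def W'_def scalar_prod_def atLeast0LessThan)
      also have "\<dots> = (\<Sum>t<?m. e t * W $$ (t, j))"
        unfolding e_def sum_distrib_left sum_distrib_right by (subst sum.swap) (simp only: mult.assoc)
      finally show ?thesis .
    qed
    then have "x = vec n (\<lambda>j. \<Sum>t<?m. e t * W $$ (t, j))" unfolding b by (intro eq_vecI) auto
    then show "x \<in> X" unfolding X row_space_combinations[OF W] by blast
  qed
  ultimately have "plucker_point d n Y \<in> subspaces_locus d n X"
    unfolding subspaces_locus_def by blast
  moreover have "(\<lambda>J\<in>?E. c * det (submatrix A UNIV J)) \<in> plucker_point d n Y"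
    unfolding plucker_point_def using A \<open>c \<noteq> 0\<close> Y_def by blast
  ultimately show ?thesis using minor by (intro bexI) auto
qed

section \<open>Equality of the three matroids and the tropicalization of the locus\<close>

theorem corollary19:
  fixes val :: "'a::alg_closed_field \<Rightarrow> ereal"
    and d n :: nat
    and W :: "'a mat"
    and X :: "'a vec set"
  assumes "nonarch_valuation val"
    and "\<not> trivial_on val UNIV"
    and "n \<ge> d + 1"
    and "W \<in> carrier_mat (d + 1) n"
    and "X = vec_space.row_space n W"
    and "subspace_dim n X = d + 1"
    and "constant_coefficient val n X"
  shows "let E = nsets {..<n} d;
             T = tropicalization val E (subspaces_locus d n X);
             MV = column_matroid {..<d + 1} E (V_matrix W);
             MU = column_matroid (U_rows d n) E (U_matrix W);
             ML = matroid_of_lines n X (coordinate_arrangement X) E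
         in matroid E MV \<and> matroid E MU \<and> matroid E ML \<and>
            MV = dual_matroid E MU \<and> MV = ML \<and>
            T = bergman_fan E MV \<and>
            T = bergman_fan E (dual_matroid E MU) \<and>
            T = bergman_fan E ML"
proof -
  let ?E = "nsets {..<n} d"
  let ?MV = "column_matroid {..<d + 1} ?E (V_matrix W)"
  let ?MU = "column_matroid (U_rows d n) ?E (U_matrix W)"
  note W = assms(4) and X = assms(5)
  have E: "finite ?E" "{..<d} \<in> ?E" using assms(3) by (auto simp: finite_nsets_lessThan nsets_iff)
  have indep: "\<forall>c. (\<forall>j<n. (\<Sum>r<d + 1. c r * W $$ (r, j)) = 0) \<longrightarrow> (\<forall>r<d + 1. c r = 0)"
    using assms(6) unfolding X dim_row_space[OF W] .
  obtain I where I: "I \<subseteq> {..<n}" "card I = d + 1" "det (submatrix W UNIV I) \<noteq> 0"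
    using exists_nonzero_minor[OF W indep] .
  have dual: "?MV = dual_matroid ?E ?MU"
    by (rule dual_column_matroid[OF E(1) _ U_kernel[OF W I]]) simp
  have lines: "matroid_of_lines n X (coordinate_arrangement X) ?E = ?MV"
    by (rule matroid_of_lines_eq[OF W X indep])
  obtain k S where k: "subfield k (class_ring :: 'a ring)" "trivial_on val k"
    and S: "S \<subseteq> {x \<in> carrier_vec n. \<forall>i<n. x $ i \<in> k}" "X = vec_span n S"
    using assms(7) unfolding constant_coefficient_def by blast
  interpret field_subset k by (rule field_subset_subfield[OF k(1)])
  interpret trivially_valued_subfield val k
    by (unfold_locales) (rule assms(1), rule k(2))
  \<comment> \<open>The locus depends only on \<open>X\<close>, so the tropicalization may be
    computed from a basis of \<open>X\<close> with entries in \<open>k\<close>.\<close>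
  obtain G P where G: "G \<in> carrier_mat (d + 1) (d + 1)" "P \<in> carrier_mat (d + 1) (d + 1)"
    "det G \<noteq> 0" "det P \<noteq> 0" "P * (G * W) = W" "vec_space.row_space n (G * W) = X"
    "submatrix (G * W) UNIV I = 1\<^sub>m (d + 1)"
    and Gk: "\<And>r j. r < d + 1 \<Longrightarrow> j < n \<Longrightarrow> (G * W) $$ (r, j) \<in> k"
    using exists_matrix_over_subfield[OF W X I S] by blast
  have GW: "G * W \<in> carrier_mat (d + 1) n" using G W by simp
  have I': "det (submatrix (G * W) UNIV I) \<noteq> 0" using G(7) by simp
  \<comment> \<open>The two inclusions come from \<open>G\<close> and from \<open>P\<close>, which
    carries \<open>G * W\<close> back to \<open>W\<close>.\<close>
  have "?MV = column_matroid {..<d + 1} ?E (V_matrix (G * W))"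
    using V_matroid_mult_subset[OF G(1,3) W] V_matroid_mult_subset[OF G(2,4) GW] G(5) by simp
  moreover have "tropicalization val ?E (subspaces_locus d n X) =
      bergman_fan ?E (column_matroid {..<d + 1} ?E (V_matrix (G * W)))"
  proof (rule tropicalization_linear_space)
    show "V_matrix (G * W) r J \<in> k" if "r \<in> {..<d + 1}" "J \<in> ?E" for r J
      using V_matrix_closed[OF GW Gk] that by simp
    show "\<exists>y. y ^ i = x" if "i > 0" for x :: 'a and i using nth_root_exists[OF that] .
    show "\<exists>a. \<forall>J\<in>?E. p J = (\<Sum>r<d + 1. a r * V_matrix (G * W) r J)"
      if "Q \<in> subspaces_locus d n X" "p \<in> Q" for Q p
      by (rule plucker_in_V_row_space[OF GW G(6)[symmetric] I(1,2) I' that])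
    show "\<exists>Q\<in>subspaces_locus d n X. \<exists>p\<in>Q. \<forall>J\<in>?E. p J = (\<Sum>r<d + 1. a r * V_matrix (G * W) r J)"
      if "\<And>J. J \<in> ?E \<Longrightarrow> (\<Sum>r<d + 1. a r * V_matrix (G * W) r J) \<noteq> 0" for a
      by (rule V_row_space_in_locus[OF _ GW G(6)[symmetric] that]) (use assms(3) in auto)
  qed (use E assms(2) in auto)
  ultimately have "tropicalization val ?E (subspaces_locus d n X) = bergman_fan ?E ?MV" by simp
  moreover have "matroid ?E ?MV" "matroid ?E ?MU" by (rule matroid_column_matroid[OF E(1)])+
  ultimately show ?thesis unfolding Let_def lines dual[symmetric] by blast
qed

end
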